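(* Let $\mathcal{E}$ be a category with pullbacks and pullback-stable coequalisers. Then coequalisers in $\mathbf{Cat}(\mathcal{E})$ of parallel pairs of internal functors that agree on objects are stable under pullback along discrete Conduché fibrations. That is: if $F,G:\mathbb{A}\rightrightarrows\mathbb{B}$ is a parallel pair in $\mathbf{Cat}(\mathcal{E})/\mathbb{Y}$ with $F_0=G_0$ and coequaliser $Q:\mathbb{B}\to\mathbb{C}$, and $f:\mathbb{X}\to\mathbb{Y}$ is a discrete Conduché fibration, then $f^*(Q):f^*(\mathbb{B})\to f^*(\mathbb{C})$ is the coequaliser of $f^*(F),f^*(G):f^*(\mathbb{A})\rightrightarrows f^*(\mathbb{B})$.
   Context: A category $\mathcal{E}$ with pullbacks has pullback-stable coequalisers if it has coequalisers and for every $f: X \to Y$ in $\mathcal{E}$ the pullback functor $f^{*}: \mathcal{E}/Y \to \mathcal{E}/X$ preserves coequalisers. $\mathbf{Cat}(\mathcal{E})$ is the $2$-category of internal categories, internal functors and internal natural transformations in $\mathcal{E}$. An internal category $\mathbb{A}$ has object of objects $A_0$, object of morphisms $A_1$ and object of composable pairs $A_2$ with composition $m:A_2\to A_1$; an internal functor $F$ has components $F_0,F_1$ and induced map $F_2$ on composable pairs. Internal functors $F,G:\mathbb{A}\to\mathbb{B}$ agree on objects if $F_0=G_0$. An internal functor $F:\mathbb{X}\to\mathbb{Y}$ is a discrete Conduché fibration if the commutative square $m\circ F_2=F_1\circ m$, with corners $X_2,Y_2,X_1,Y_1$, is a pullback. *)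

theory Defs
  imports Main
begin

section \<open>Categories\<close>

text \<open>Composition is written in applicative order: \<open>g \<cdot>\<^bsub>C\<^esub> f\<close> is \<open>f\<close> followed by \<open>g\<close>. It is only
  meaningful when \<open>Dom C g = Cod C f\<close>.\<close>

record ('o, 'm) cat =
  Obj :: "'o set"
  Arr :: "'m set"
  Dom :: "'m \<Rightarrow> 'o"
  Cod :: "'m \<Rightarrow> 'o"
  Idn :: "'o \<Rightarrow> 'm"
  Cmp :: "'m \<Rightarrow> 'm \<Rightarrow> 'm" (infixr "\<cdot>\<index>" 70)

definition hom :: "('o, 'm) cat \<Rightarrow> 'o \<Rightarrow> 'o \<Rightarrow> 'm set" where
  "hom C a b = {f \<in> Arr C. Dom C f = a \<and> Cod C f = b}"

locale category =
  fixes C :: "('o, 'm) cat" (structure)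
  assumes Dom_Obj: "f \<in> Arr C \<Longrightarrow> Dom C f \<in> Obj C"
    and Cod_Obj: "f \<in> Arr C \<Longrightarrow> Cod C f \<in> Obj C"
    and Idn_hom: "a \<in> Obj C \<Longrightarrow> Idn C a \<in> hom C a a"
    and Cmp_hom: "\<lbrakk>f \<in> hom C a b; g \<in> hom C b c\<rbrakk> \<Longrightarrow> g \<cdot> f \<in> hom C a c"
    and Cmp_Idn_left: "f \<in> hom C a b \<Longrightarrow> Idn C b \<cdot> f = f"
    and Cmp_Idn_right: "f \<in> hom C a b \<Longrightarrow> f \<cdot> Idn C a = f"
    and Cmp_assoc: "\<lbrakk>f \<in> hom C a b; g \<in> hom C b c; h \<in> hom C c d\<rbrakk> \<Longrightarrow> (h \<cdot> g) \<cdot> f = h \<cdot> (g \<cdot> f)"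

text \<open>\<open>is_pullback C f g p q\<close>: the span \<open>p, q\<close> is a pullback of the cospan \<open>f, g\<close>, with \<open>p\<close> lying
  over the domain of \<open>f\<close> and \<open>q\<close> over the domain of \<open>g\<close>.\<close>

definition is_pullback :: "('o, 'm) cat \<Rightarrow> 'm \<Rightarrow> 'm \<Rightarrow> 'm \<Rightarrow> 'm \<Rightarrow> bool" where
  "is_pullback C f g p q \<longleftrightarrow>
     f \<in> Arr C \<and> g \<in> Arr C \<and> Cod C f = Cod C g \<and>
     p \<in> Arr C \<and> q \<in> Arr C \<and> Dom C p = Dom C q \<and> Cod C p = Dom C f \<and> Cod C q = Dom C g \<and>
     f \<cdot>\<^bsub>C\<^esub> p = g \<cdot>\<^bsub>C\<^esub> q \<and>
     (\<forall>T u v. u \<in> hom C T (Dom C f) \<and> v \<in> hom C T (Dom C g) \<and> f \<cdot>\<^bsub>C\<^esub> u = g \<cdot>\<^bsub>C\<^esub> v \<longrightarrow>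
        (\<exists>!w. w \<in> hom C T (Dom C p) \<and> p \<cdot>\<^bsub>C\<^esub> w = u \<and> q \<cdot>\<^bsub>C\<^esub> w = v))"

definition has_pullbacks :: "('o, 'm) cat \<Rightarrow> bool" where
  "has_pullbacks C \<longleftrightarrow>
     (\<forall>f \<in> Arr C. \<forall>g \<in> Arr C. Cod C f = Cod C g \<longrightarrow> (\<exists>p q. is_pullback C f g p q))"

definition pairing :: "('o, 'm) cat \<Rightarrow> 'm \<Rightarrow> 'm \<Rightarrow> 'm \<Rightarrow> 'm \<Rightarrow> 'm" where
  "pairing C p q u v =
     (THE w. w \<in> hom C (Dom C u) (Dom C p) \<and> p \<cdot>\<^bsub>C\<^esub> w = u \<and> q \<cdot>\<^bsub>C\<^esub> w = v)"

definition is_coequaliser :: "('o, 'm) cat \<Rightarrow> 'm \<Rightarrow> 'm \<Rightarrow> 'm \<Rightarrow> bool" where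
  "is_coequaliser C f g q \<longleftrightarrow>
     f \<in> Arr C \<and> g \<in> Arr C \<and> Dom C f = Dom C g \<and> Cod C f = Cod C g \<and>
     q \<in> Arr C \<and> Dom C q = Cod C f \<and> q \<cdot>\<^bsub>C\<^esub> f = q \<cdot>\<^bsub>C\<^esub> g \<and>
     (\<forall>D h. h \<in> hom C (Cod C f) D \<and> h \<cdot>\<^bsub>C\<^esub> f = h \<cdot>\<^bsub>C\<^esub> g \<longrightarrow>
        (\<exists>!k. k \<in> hom C (Cod C q) D \<and> k \<cdot>\<^bsub>C\<^esub> q = h))"

definition has_coequalisers :: "('o, 'm) cat \<Rightarrow> bool" where
  "has_coequalisers C \<longleftrightarrow>
     (\<forall>f \<in> Arr C. \<forall>g \<in> Arr C. Dom C f = Dom C g \<and> Cod C f = Cod C g \<longrightarrow>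
        (\<exists>q. is_coequaliser C f g q))"


section \<open>Slices and pullback functors\<close>

text \<open>An arrow \<open>h : a \<rightarrow> b\<close> of the slice is represented by the triple \<open>(a, h, b)\<close>, so that domain and
  codomain are functions of the arrow.\<close>

definition slice :: "('o, 'm) cat \<Rightarrow> 'o \<Rightarrow> ('m, 'm \<times> 'm \<times> 'm) cat" where
  "slice C Y =
     \<lparr> Obj = {a \<in> Arr C. Cod C a = Y},
       Arr = {(a, h, b). a \<in> Arr C \<and> Cod C a = Y \<and> b \<in> Arr C \<and> Cod C b = Y \<and>
                h \<in> hom C (Dom C a) (Dom C b) \<and> b \<cdot>\<^bsub>C\<^esub> h = a},
       Dom = (\<lambda>(a, h, b). a),
       Cod = (\<lambda>(a, h, b). b),
       Idn = (\<lambda>a. (a, Idn C (Dom C a), a)),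
       Cmp = (\<lambda>(b, k, c) (a, h, b'). (a, k \<cdot>\<^bsub>C\<^esub> h, c)) \<rparr>"

text \<open>The pullback functor \<open>f\<^sup>* : C/Y \<rightarrow> C/X\<close> along \<open>f : X \<rightarrow> Y\<close> is determined up to unique isomorphism
  by universal properties, and no choice of pullbacks is made. A value of \<open>f\<^sup>*\<close> at \<open>a : A \<rightarrow> Y\<close> is any
  \<open>a' : P \<rightarrow> X\<close> such that \<open>is_pullback C f a a' \<pi>\<close> for some \<open>\<pi> : P \<rightarrow> A\<close>. Given such values
  \<open>(a', \<pi>)\<close> at \<open>a\<close> and \<open>(b', \<rho>)\<close> at \<open>b\<close>, the value at \<open>h : a \<rightarrow> b\<close> is the unique arrow \<open>h' : a' \<rightarrow> b'\<close>
  over \<open>X\<close> with \<open>\<rho> \<cdot> h' = h \<cdot> \<pi>\<close>.\<close>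

definition is_pullback_arrow ::
    "('o, 'm) cat \<Rightarrow> 'm \<Rightarrow> 'm \<Rightarrow> 'm \<Rightarrow> 'm \<Rightarrow> 'm \<Rightarrow> 'm \<Rightarrow> bool" where
  "is_pullback_arrow C a' \<pi> b' \<rho> h h' \<longleftrightarrow>
     h' \<in> hom C (Dom C a') (Dom C b') \<and> b' \<cdot>\<^bsub>C\<^esub> h' = a' \<and> \<rho> \<cdot>\<^bsub>C\<^esub> h' = h \<cdot>\<^bsub>C\<^esub> \<pi>"

definition pullback_preserves_coequalisers :: "('o, 'm) cat \<Rightarrow> 'm \<Rightarrow> bool" where
  "pullback_preserves_coequalisers C f \<longleftrightarrow>
     (\<forall>a b c h k q a' \<pi> b' \<rho> c' \<sigma> h' k' q'.
        is_coequaliser (slice C (Cod C f)) (a, h, b) (a, k, b) (b, q, c) \<and>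
        is_pullback C f a a' \<pi> \<and> is_pullback C f b b' \<rho> \<and> is_pullback C f c c' \<sigma> \<and>
        is_pullback_arrow C a' \<pi> b' \<rho> h h' \<and>
        is_pullback_arrow C a' \<pi> b' \<rho> k k' \<and>
        is_pullback_arrow C b' \<rho> c' \<sigma> q q' \<longrightarrow>
        is_coequaliser (slice C (Dom C f)) (a', h', b') (a', k', b') (b', q', c'))"

definition has_pullback_stable_coequalisers :: "('o, 'm) cat \<Rightarrow> bool" where
  "has_pullback_stable_coequalisers C \<longleftrightarrow>
     has_coequalisers C \<and> (\<forall>f \<in> Arr C. pullback_preserves_coequalisers C f)"


section \<open>Internal categories\<close>

text \<open>The object of composable pairs, with its projections, is part of the data of an internal
  category, so that no choice of pullbacks in the ambient category is needed. A composable pair is listed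
  in diagrammatic order: \<open>icomp\<close> sends \<open>(x, y)\<close> with \<open>tgt x = src y\<close> to \<open>x\<close> followed by \<open>y\<close>.\<close>

record ('o, 'm) icat =
  ob0 :: 'o
  ob1 :: 'o
  ob2 :: 'o
  src :: 'm
  tgt :: 'm
  unit :: 'm
  fst_arr :: 'm
  snd_arr :: 'm
  icomp :: 'm

abbreviation ipair :: "('o, 'm) cat \<Rightarrow> ('o, 'm) icat \<Rightarrow> 'm \<Rightarrow> 'm \<Rightarrow> 'm" where
  "ipair E A \<equiv> pairing E (fst_arr A) (snd_arr A)"

text \<open>Associativity is an equation between arrows out of the object of composable triples, which is a
  pullback \<open>A\<^sub>2 \<leftarrow> A\<^sub>3 \<rightarrow> A\<^sub>2\<close> of the two projections \<open>A\<^sub>2 \<rightarrow> A\<^sub>1\<close>; quantifying over all such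
  pullbacks avoids choosing one.\<close>

locale internal_category =
  fixes E :: "('o, 'm) cat" (structure) and A :: "('o, 'm) icat"
  assumes ob0: "ob0 A \<in> Obj E"
    and src: "src A \<in> hom E (ob1 A) (ob0 A)"
    and tgt: "tgt A \<in> hom E (ob1 A) (ob0 A)"
    and unit: "unit A \<in> hom E (ob0 A) (ob1 A)"
    and fst_arr: "fst_arr A \<in> hom E (ob2 A) (ob1 A)"
    and snd_arr: "snd_arr A \<in> hom E (ob2 A) (ob1 A)"
    and icomp: "icomp A \<in> hom E (ob2 A) (ob1 A)"
    and composable_pairs: "is_pullback E (tgt A) (src A) (fst_arr A) (snd_arr A)"
    and src_unit: "src A \<cdot> unit A = Idn E (ob0 A)"
    and tgt_unit: "tgt A \<cdot> unit A = Idn E (ob0 A)"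
    and src_icomp: "src A \<cdot> icomp A = src A \<cdot> fst_arr A"
    and tgt_icomp: "tgt A \<cdot> icomp A = tgt A \<cdot> snd_arr A"
    and unit_left: "icomp A \<cdot> ipair E A (unit A \<cdot> src A) (Idn E (ob1 A)) = Idn E (ob1 A)"
    and unit_right: "icomp A \<cdot> ipair E A (Idn E (ob1 A)) (unit A \<cdot> tgt A) = Idn E (ob1 A)"
    and icomp_assoc: "is_pullback E (snd_arr A) (fst_arr A) r s \<Longrightarrow>
          icomp A \<cdot> ipair E A (icomp A \<cdot> r) (snd_arr A \<cdot> s) =
          icomp A \<cdot> ipair E A (fst_arr A \<cdot> r) (icomp A \<cdot> s)"

record ('o, 'm) ifun =
  idom :: "('o, 'm) icat"
  icod :: "('o, 'm) icat"
  F0 :: 'm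
  F1 :: 'm

definition F2 :: "('o, 'm) cat \<Rightarrow> ('o, 'm) ifun \<Rightarrow> 'm" where
  "F2 E F = ipair E (icod F) (F1 F \<cdot>\<^bsub>E\<^esub> fst_arr (idom F)) (F1 F \<cdot>\<^bsub>E\<^esub> snd_arr (idom F))"

locale internal_functor =
  fixes E :: "('o, 'm) cat" (structure) and F :: "('o, 'm) ifun"
  assumes idom: "internal_category E (idom F)"
    and icod: "internal_category E (icod F)"
    and F0: "F0 F \<in> hom E (ob0 (idom F)) (ob0 (icod F))"
    and F1: "F1 F \<in> hom E (ob1 (idom F)) (ob1 (icod F))"
    and src_F1: "src (icod F) \<cdot> F1 F = F0 F \<cdot> src (idom F)"
    and tgt_F1: "tgt (icod F) \<cdot> F1 F = F0 F \<cdot> tgt (idom F)"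
    and F1_unit: "F1 F \<cdot> unit (idom F) = unit (icod F) \<cdot> F0 F"
    and F1_icomp: "icomp (icod F) \<cdot> F2 E F = F1 F \<cdot> icomp (idom F)"

definition Cat :: "('o, 'm) cat \<Rightarrow> (('o, 'm) icat, ('o, 'm) ifun) cat" where
  "Cat E =
     \<lparr> Obj = {A. internal_category E A},
       Arr = {F. internal_functor E F},
       Dom = idom,
       Cod = icod,
       Idn = (\<lambda>A. \<lparr>idom = A, icod = A, F0 = Idn E (ob0 A), F1 = Idn E (ob1 A)\<rparr>),
       Cmp = (\<lambda>G F. \<lparr>idom = idom F, icod = icod G, F0 = F0 G \<cdot>\<^bsub>E\<^esub> F0 F, F1 = F1 G \<cdot>\<^bsub>E\<^esub> F1 F\<rparr>) \<rparr>"

record ('o, 'm) inat =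
  nsrc :: "('o, 'm) ifun"
  ntgt :: "('o, 'm) ifun"
  component :: 'm

locale internal_nat_trans =
  fixes E :: "('o, 'm) cat" (structure) and \<alpha> :: "('o, 'm) inat"
  assumes nsrc: "internal_functor E (nsrc \<alpha>)"
    and ntgt: "internal_functor E (ntgt \<alpha>)"
    and idom_eq: "idom (nsrc \<alpha>) = idom (ntgt \<alpha>)"
    and icod_eq: "icod (nsrc \<alpha>) = icod (ntgt \<alpha>)"
    and component: "component \<alpha> \<in> hom E (ob0 (idom (nsrc \<alpha>))) (ob1 (icod (nsrc \<alpha>)))"
    and src_component: "src (icod (nsrc \<alpha>)) \<cdot> component \<alpha> = F0 (nsrc \<alpha>)"
    and tgt_component: "tgt (icod (nsrc \<alpha>)) \<cdot> component \<alpha> = F0 (ntgt \<alpha>)"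
    and naturality:
      "icomp (icod (nsrc \<alpha>)) \<cdot> ipair E (icod (nsrc \<alpha>)) (component \<alpha> \<cdot> src (idom (nsrc \<alpha>))) (F1 (ntgt \<alpha>)) =
       icomp (icod (nsrc \<alpha>)) \<cdot> ipair E (icod (nsrc \<alpha>)) (F1 (nsrc \<alpha>)) (component \<alpha> \<cdot> tgt (idom (nsrc \<alpha>)))"

definition nat_transs :: "('o, 'm) cat \<Rightarrow> ('o, 'm) ifun \<Rightarrow> ('o, 'm) ifun \<Rightarrow> ('o, 'm) inat set" where
  "nat_transs E H K = {\<alpha>. internal_nat_trans E \<alpha> \<and> nsrc \<alpha> = H \<and> ntgt \<alpha> = K}"

definition whisker :: "('o, 'm) cat \<Rightarrow> ('o, 'm) inat \<Rightarrow> ('o, 'm) ifun \<Rightarrow> ('o, 'm) inat" where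
  "whisker E \<alpha> F =
     \<lparr>nsrc = nsrc \<alpha> \<cdot>\<^bsub>Cat E\<^esub> F, ntgt = ntgt \<alpha> \<cdot>\<^bsub>Cat E\<^esub> F, component = component \<alpha> \<cdot>\<^bsub>E\<^esub> F0 F\<rparr>"

text \<open>Coequalisers in the 2-category of internal categories: precomposition with \<open>Q\<close> is an isomorphism from
  the category of functors and transformations out of the codomain of \<open>Q\<close> to the category of those out of
  the domain of \<open>Q\<close> that are equalised by precomposition with \<open>F\<close> and \<open>G\<close>. The first conjunct is
  bijectivity on functors, the second on transformations.\<close>

definition is_Cat_coequaliser ::
    "('o, 'm) cat \<Rightarrow> ('o, 'm) ifun \<Rightarrow> ('o, 'm) ifun \<Rightarrow> ('o, 'm) ifun \<Rightarrow> bool" where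
  "is_Cat_coequaliser E F G Q \<longleftrightarrow>
     is_coequaliser (Cat E) F G Q \<and>
     (\<forall>D H K \<alpha>. H \<in> hom (Cat E) (icod Q) D \<and> K \<in> hom (Cat E) (icod Q) D \<and>
        \<alpha> \<in> nat_transs E (H \<cdot>\<^bsub>Cat E\<^esub> Q) (K \<cdot>\<^bsub>Cat E\<^esub> Q) \<and>
        whisker E \<alpha> F = whisker E \<alpha> G \<longrightarrow>
        (\<exists>!\<beta>. \<beta> \<in> nat_transs E H K \<and> whisker E \<beta> Q = \<alpha>))"

definition discrete_Conduche_fibration :: "('o, 'm) cat \<Rightarrow> ('o, 'm) ifun \<Rightarrow> bool" where
  "discrete_Conduche_fibration E f \<longleftrightarrow>
     internal_functor E f \<and>
     is_pullback E (icomp (icod f)) (F1 f) (F2 E f) (icomp (idom f))"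

end

theory Submission
  imports Defs
begin

text \<open>Since \<open>F\<close> and \<open>G\<close> agree on objects, their coequaliser leaves the objects unchanged and is computed on
  arrows: it identifies \<open>l \<cdot> F m \<cdot> r\<close> with \<open>l \<cdot> G m \<cdot> r\<close>, so its arrow object is the coequaliser in \<open>E\<close> of two
  arrows from the object \<open>R\<close> of composable triples \<open>(l, F m, r)\<close> to the arrow object of the codomain. Pullback
  stability lets composition descend to this quotient, one factor at a time; conversely a functor that is
  invertible on objects and such a coequaliser on arrows is a coequaliser of internal categories.
  Pullbacks of internal categories are componentwise, and unique factorisation along a discrete Conduche
  fibration identifies the pullback of \<open>R\<close> with the object of composable triples of the pulled-back pair. Hence
  stability of coequalisers in \<open>E\<close> transports the description to the pullback.\<close>

text \<open>Two-sided contexts make the relation a congruence. Identifying \<open>F m\<close> with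
  \<open>G m\<close> alone is not stable under composition, but a further factor next to a triple
  \<open>(l, F m, r)\<close> is absorbed into \<open>l\<close> or \<open>r\<close> by associativity,
  so a single coequaliser on arrows already carries a composition. The obstacle is that stability
  concerns one pullback of the coequaliser at a time, while composable pairs of classes involve two.
  Hence an intermediate object of pairs with one factor a class and the other still an arrow. At the
  second stage the first factor has no representative at hand. Representatives exist only after
  restriction along an epimorphism, namely the pullback of the coequaliser along the given class;
  laws of the quotient are tested there and the epimorphism is cancelled. Composable classes have
  composable representatives because objects are unchanged. Stability is assumed in slices and must
  first be moved to \<open>E\<close>. Since no pullbacks or coequalisers are chosen, a given one in
  \<open>Cat E\<close> is always compared with a constructed one by an isomorphism, and on objects
  the coequaliser is merely invertible.\<close>

context category
begin

section \<open>Rewriting of composites, epimorphisms and inverse pairs\<close>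

lemma Cmp_Arr [simp]: "\<lbrakk>f \<in> Arr C; g \<in> Arr C; Dom C g = Cod C f\<rbrakk> \<Longrightarrow> g \<cdot> f \<in> Arr C"
  and Dom_Cmp [simp]: "\<lbrakk>f \<in> Arr C; g \<in> Arr C; Dom C g = Cod C f\<rbrakk> \<Longrightarrow> Dom C (g \<cdot> f) = Dom C f"
  and Cod_Cmp [simp]: "\<lbrakk>f \<in> Arr C; g \<in> Arr C; Dom C g = Cod C f\<rbrakk> \<Longrightarrow> Cod C (g \<cdot> f) = Cod C g"
  using Cmp_hom [of f "Dom C f" "Cod C f" g "Cod C g"] by (auto simp: hom_def)

lemma Cmp_assoc' [simp]:
  "\<lbrakk>f \<in> Arr C; g \<in> Arr C; h \<in> Arr C; Dom C g = Cod C f; Dom C h = Cod C g\<rbrakk>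
     \<Longrightarrow> (h \<cdot> g) \<cdot> f = h \<cdot> g \<cdot> f"
  using Cmp_assoc [of f "Dom C f" "Cod C f" g "Cod C g" h "Cod C h"] by (auto simp: hom_def)

lemma Idn_Arr [simp]: "a \<in> Obj C \<Longrightarrow> Idn C a \<in> Arr C"
  and Dom_Idn [simp]: "a \<in> Obj C \<Longrightarrow> Dom C (Idn C a) = a"
  and Cod_Idn [simp]: "a \<in> Obj C \<Longrightarrow> Cod C (Idn C a) = a"
  using Idn_hom [of a] by (auto simp: hom_def)

lemmas Dom_Obj [simp] and Cod_Obj [simp]

lemma Idn_left [simp]: "\<lbrakk>f \<in> Arr C; Cod C f = b\<rbrakk> \<Longrightarrow> Idn C b \<cdot> f = f"
  and Idn_right [simp]: "\<lbrakk>f \<in> Arr C; Dom C f = a\<rbrakk> \<Longrightarrow> f \<cdot> Idn C a = f"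
  using Cmp_Idn_left [of f a b] Cmp_Idn_left [of f "Dom C f" b] Cmp_Idn_right [of f a "Cod C f"]
  by (auto simp: hom_def)

text \<open>The simplifier nests composites to the right, so a known \<open>g \<cdot> f = k\<close>
  no longer matches inside \<open>g \<cdot> f \<cdot> x\<close>; this is the form in which it still
  applies.\<close>

lemma Cmp_reassoc:
  assumes "g \<cdot> f = k" "f \<in> Arr C" "g \<in> Arr C" "Dom C g = Cod C f" "x \<in> Arr C" "Cod C x = Dom C f"
  shows "g \<cdot> f \<cdot> x = k \<cdot> x"
  using assms Cmp_assoc' [of x f g] by simp

definition epi :: "'m \<Rightarrow> bool" where
  "epi e \<longleftrightarrow> e \<in> Arr C \<and>
     (\<forall>g \<in> Arr C. \<forall>h \<in> Arr C. Dom C g = Cod C e \<and> Dom C h = Cod C e \<and> g \<cdot> e = h \<cdot> e \<longrightarrow> g = h)"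

definition inverse_arrows :: "'m \<Rightarrow> 'm \<Rightarrow> bool" where
  "inverse_arrows f g \<longleftrightarrow> f \<in> Arr C \<and> g \<in> Arr C \<and> Dom C g = Cod C f \<and> Cod C g = Dom C f \<and>
     g \<cdot> f = Idn C (Dom C f) \<and> f \<cdot> g = Idn C (Cod C f)"

lemma epiD:
  assumes "epi e" "g \<cdot> e = h \<cdot> e" "g \<in> Arr C" "h \<in> Arr C" "Dom C g = Cod C e" "Dom C h = Cod C e"
  shows "g = h"
  using assms by (auto simp: epi_def)

lemma epi_Arr: "epi e \<Longrightarrow> e \<in> Arr C"
  by (simp add: epi_def)

lemma epi_Cmp:
  assumes "epi e" "epi d" "Dom C e = Cod C d"
  shows "epi (e \<cdot> d)"
  unfolding epi_def
proof (intro conjI ballI impI)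
  show "e \<cdot> d \<in> Arr C"
    using assms epi_Arr by simp
  fix g h
  assume gh: "g \<in> Arr C" "h \<in> Arr C"
    "Dom C g = Cod C (e \<cdot> d) \<and> Dom C h = Cod C (e \<cdot> d) \<and> g \<cdot> e \<cdot> d = h \<cdot> e \<cdot> d"
  have "(g \<cdot> e) \<cdot> d = (h \<cdot> e) \<cdot> d"
    using gh assms epi_Arr by simp
  then have "g \<cdot> e = h \<cdot> e"
    by (rule epiD [OF assms(2)]) (use gh assms epi_Arr in auto)
  then show "g = h"
    by (rule epiD [OF assms(1)]) (use gh assms epi_Arr in auto)
qed

lemma inverse_arrowsD:
  assumes "inverse_arrows f g"
  shows "f \<in> Arr C" "g \<in> Arr C" "Dom C g = Cod C f" "Cod C g = Dom C f"
    "g \<cdot> f = Idn C (Dom C f)" "f \<cdot> g = Idn C (Cod C f)"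
  using assms by (auto simp: inverse_arrows_def)

lemma inverse_arrows_cancel:
  assumes "inverse_arrows f g" "x \<in> Arr C"
  shows "Cod C x = Dom C f \<Longrightarrow> g \<cdot> f \<cdot> x = x" "Cod C x = Cod C f \<Longrightarrow> f \<cdot> g \<cdot> x = x"
  using assms Cmp_reassoc [of g f _ x] Cmp_reassoc [of f g _ x] by (auto simp: inverse_arrows_def)

lemma inverse_arrows_Cmp:
  assumes "inverse_arrows f f'" "inverse_arrows g g'" "Dom C g = Cod C f"
  shows "inverse_arrows (g \<cdot> f) (f' \<cdot> g')"
proof -
  note d = inverse_arrowsD [OF assms(1)] inverse_arrowsD [OF assms(2)]
  have "g' \<cdot> g \<cdot> f = f" "f \<cdot> f' \<cdot> g' = g'"
    using inverse_arrows_cancel [OF assms(2), of f] inverse_arrows_cancel [OF assms(1), of g'] d assms(3) by simp_all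
  then show ?thesis
    unfolding inverse_arrows_def using d assms(3) by simp
qed


subsection \<open>Pullbacks\<close>

lemma is_pullbackD:
  assumes "is_pullback C f g p q"
  shows "f \<in> Arr C" "g \<in> Arr C" "Cod C f = Cod C g" "p \<in> Arr C" "q \<in> Arr C" "Dom C p = Dom C q"
    "Cod C p = Dom C f" "Cod C q = Dom C g" "f \<cdot> p = g \<cdot> q"
  using assms by (auto simp: is_pullback_def)

lemma pullback_ex:
  assumes "is_pullback C f g p q" "u \<in> Arr C" "v \<in> Arr C" "Cod C u = Dom C f" "Cod C v = Dom C g"
    "f \<cdot> u = g \<cdot> v"
  shows "\<exists>!w. w \<in> hom C (Dom C u) (Dom C p) \<and> p \<cdot> w = u \<and> q \<cdot> w = v"
proof -
  have "Dom C u = Dom C v"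
    using assms by (metis Dom_Cmp is_pullback_def)
  then have "u \<in> hom C (Dom C u) (Dom C f) \<and> v \<in> hom C (Dom C u) (Dom C g) \<and> f \<cdot> u = g \<cdot> v"
    using assms by (auto simp: hom_def)
  with assms(1) show ?thesis
    unfolding is_pullback_def by blast
qed

lemma pairing_props:
  assumes "is_pullback C f g p q" "u \<in> Arr C" "v \<in> Arr C" "Cod C u = Dom C f" "Cod C v = Dom C g"
    "f \<cdot> u = g \<cdot> v"
  shows "pairing C p q u v \<in> Arr C" "Dom C (pairing C p q u v) = Dom C u"
    "Cod C (pairing C p q u v) = Dom C p" "p \<cdot> pairing C p q u v = u" "q \<cdot> pairing C p q u v = v"
  using theI' [OF pullback_ex [OF assms]] unfolding pairing_def hom_def by auto

lemma pullback_eqI: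
  assumes "is_pullback C f g p q" "w \<in> Arr C" "w' \<in> Arr C" "Cod C w = Dom C p" "Cod C w' = Dom C p"
    "p \<cdot> w = p \<cdot> w'" "q \<cdot> w = q \<cdot> w'"
  shows "w = w'"
proof -
  note pb = is_pullbackD [OF assms(1)]
  have "Dom C w = Dom C w'"
    using assms pb by (metis Dom_Cmp)
  moreover have "f \<cdot> p \<cdot> w = g \<cdot> q \<cdot> w"
    using assms(2,4) pb by (metis Cmp_assoc')
  ultimately have "\<exists>!w'. w' \<in> hom C (Dom C (p \<cdot> w)) (Dom C p) \<and> p \<cdot> w' = p \<cdot> w \<and> q \<cdot> w' = q \<cdot> w"
    using assms pb by (intro pullback_ex [OF assms(1)]) auto
  moreover have "w \<in> hom C (Dom C (p \<cdot> w)) (Dom C p)" "w' \<in> hom C (Dom C (p \<cdot> w)) (Dom C p)"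
    using assms pb \<open>Dom C w = Dom C w'\<close> by (auto simp: hom_def)
  ultimately show ?thesis
    using assms(6,7) by metis
qed

lemma pairing_unique:
  assumes "is_pullback C f g p q" "w \<in> Arr C" "Cod C w = Dom C p"
  shows "pairing C p q (p \<cdot> w) (q \<cdot> w) = w"
proof -
  note pb = is_pullbackD [OF assms(1)]
  have "f \<cdot> p \<cdot> w = g \<cdot> q \<cdot> w"
    using assms(2,3) pb by (metis Cmp_assoc')
  show ?thesis
    by (rule pullback_eqI [OF assms(1)])
      (use assms pb \<open>f \<cdot> p \<cdot> w = g \<cdot> q \<cdot> w\<close> in \<open>auto simp: pairing_props [OF assms(1)]\<close>)
qed

lemma pairing_Cmp:
  assumes "is_pullback C f g p q" "u \<in> Arr C" "v \<in> Arr C" "Cod C u = Dom C f" "Cod C v = Dom C g"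
    "f \<cdot> u = g \<cdot> v" "t \<in> Arr C" "Cod C t = Dom C u"
  shows "pairing C p q u v \<cdot> t = pairing C p q (u \<cdot> t) (v \<cdot> t)"
proof -
  note pb = is_pullbackD [OF assms(1)] and pr = pairing_props [OF assms(1-6)]
  have "Dom C v = Dom C u"
    using assms pb by (metis Dom_Cmp)
  then have "p \<cdot> pairing C p q u v \<cdot> t = u \<cdot> t" "q \<cdot> pairing C p q u v \<cdot> t = v \<cdot> t"
    using pb pr assms by (metis Cmp_assoc')+
  then show ?thesis
    using pairing_unique [OF assms(1), of "pairing C p q u v \<cdot> t"] pr assms(7,8) by simp
qed

lemma is_pullbackI:
  assumes "f \<in> Arr C" "g \<in> Arr C" "Cod C f = Cod C g" "p \<in> Arr C" "q \<in> Arr C" "Dom C p = Dom C q"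
    "Cod C p = Dom C f" "Cod C q = Dom C g" "f \<cdot> p = g \<cdot> q"
    and "\<And>u v. \<lbrakk>u \<in> Arr C; v \<in> Arr C; Dom C u = Dom C v; Cod C u = Dom C f; Cod C v = Dom C g;
           f \<cdot> u = g \<cdot> v\<rbrakk> \<Longrightarrow> \<exists>w \<in> Arr C. Dom C w = Dom C u \<and> Cod C w = Dom C p \<and> p \<cdot> w = u \<and> q \<cdot> w = v"
    and "\<And>w w'. \<lbrakk>w \<in> Arr C; w' \<in> Arr C; Dom C w = Dom C w'; Cod C w = Dom C p; Cod C w' = Dom C p;
           p \<cdot> w = p \<cdot> w'; q \<cdot> w = q \<cdot> w'\<rbrakk> \<Longrightarrow> w = w'"
  shows "is_pullback C f g p q"
  unfolding is_pullback_def
proof (intro conjI allI impI)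
  fix T u v
  assume uv: "u \<in> hom C T (Dom C f) \<and> v \<in> hom C T (Dom C g) \<and> f \<cdot> u = g \<cdot> v"
  then obtain w where "w \<in> Arr C" "Dom C w = T" "Cod C w = Dom C p" "p \<cdot> w = u" "q \<cdot> w = v"
    using assms(10) [of u v] by (auto simp: hom_def)
  then show "\<exists>!w. w \<in> hom C T (Dom C p) \<and> p \<cdot> w = u \<and> q \<cdot> w = v"
    using assms(11) by (intro ex1I [of _ w]) (auto simp: hom_def)
qed (use assms in auto)

lemma is_pullback_sym:
  assumes "is_pullback C f g p q"
  shows "is_pullback C g f q p"
proof -
  note pb = is_pullbackD [OF assms]
  show ?thesis
  proof (rule is_pullbackI)
    fix u v
    assume "u \<in> Arr C" "v \<in> Arr C" "Dom C u = Dom C v" "Cod C u = Dom C g" "Cod C v = Dom C f"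
      "g \<cdot> u = f \<cdot> v"
    then show "\<exists>w \<in> Arr C. Dom C w = Dom C u \<and> Cod C w = Dom C q \<and> q \<cdot> w = u \<and> p \<cdot> w = v"
      using pairing_props [OF assms, of v u] pb by auto
  qed (use pb pullback_eqI [OF assms] in auto)
qed

lemma is_pullback_inverse_arrows:
  assumes pb: "is_pullback C f g p q" and w: "inverse_arrows w w'" "Cod C w = Dom C p"
  shows "is_pullback C f g (p \<cdot> w) (q \<cdot> w)"
proof -
  note d = is_pullbackD [OF pb] and wd = inverse_arrowsD [OF w(1)]
  show ?thesis
  proof (rule is_pullbackI)
    show "f \<cdot> p \<cdot> w = g \<cdot> q \<cdot> w"
      using d wd w(2) by (metis Cmp_assoc')
  next
    fix u v
    assume uv: "u \<in> Arr C" "v \<in> Arr C" "Dom C u = Dom C v" "Cod C u = Dom C f" "Cod C v = Dom C g"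
      "f \<cdot> u = g \<cdot> v"
    show "\<exists>x \<in> Arr C. Dom C x = Dom C u \<and> Cod C x = Dom C (p \<cdot> w) \<and> (p \<cdot> w) \<cdot> x = u \<and> (q \<cdot> w) \<cdot> x = v"
      by (rule bexI [of _ "w' \<cdot> pairing C p q u v"])
        (use uv d wd w(2) pairing_props [OF pb, of u v] in
          \<open>auto simp: inverse_arrows_cancel [OF w(1)]\<close>)
  next
    fix x x'
    assume x: "x \<in> Arr C" "x' \<in> Arr C" "Dom C x = Dom C x'" "Cod C x = Dom C (p \<cdot> w)"
      "Cod C x' = Dom C (p \<cdot> w)" "(p \<cdot> w) \<cdot> x = (p \<cdot> w) \<cdot> x'" "(q \<cdot> w) \<cdot> x = (q \<cdot> w) \<cdot> x'"
    have "w \<cdot> x = w \<cdot> x'"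
      by (rule pullback_eqI [OF pb]) (use x d wd w(2) in auto)
    then have "w' \<cdot> w \<cdot> x = w' \<cdot> w \<cdot> x'"
      by simp
    then show "x = x'"
      using x d wd w(2) by (simp add: inverse_arrows_cancel [OF w(1)])
  qed (use d wd w(2) in auto)
qed

lemma pullback_unique_up_to_iso:
  assumes pb: "is_pullback C f g p q" "is_pullback C f g p' q'"
  shows "\<exists>w w'. inverse_arrows w w' \<and> Dom C w = Dom C p' \<and> Cod C w = Dom C p \<and> p \<cdot> w = p' \<and> q \<cdot> w = q'"
proof -
  note d = is_pullbackD [OF pb(1)] and d' = is_pullbackD [OF pb(2)]
  define w where "w = pairing C p q p' q'"
  define w' where "w' = pairing C p' q' p q"
  have w: "w \<in> Arr C" "Dom C w = Dom C p'" "Cod C w = Dom C p" "p \<cdot> w = p'" "q \<cdot> w = q'"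
    unfolding w_def using d d' pairing_props [OF pb(1), of p' q'] by auto
  have w': "w' \<in> Arr C" "Dom C w' = Dom C p" "Cod C w' = Dom C p'" "p' \<cdot> w' = p" "q' \<cdot> w' = q"
    unfolding w'_def using d d' pairing_props [OF pb(2), of p q] by auto
  have 1: "p \<cdot> w \<cdot> w' = p" "q \<cdot> w \<cdot> w' = q" "p' \<cdot> w' \<cdot> w = p'" "q' \<cdot> w' \<cdot> w = q'"
    using w w' d d' by (metis Cmp_assoc')+
  have "w \<cdot> w' = Idn C (Dom C p)"
    by (rule pullback_eqI [OF pb(1)]) (use w w' d d' 1 in auto)
  moreover have "w' \<cdot> w = Idn C (Dom C p')"
    by (rule pullback_eqI [OF pb(2)]) (use w w' d d' 1 in auto)
  ultimately have "inverse_arrows w w'"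
    using w w' unfolding inverse_arrows_def by simp
  then show ?thesis
    using w by blast
qed


subsection \<open>Coequalisers\<close>

lemma is_coequaliserD:
  assumes "is_coequaliser C f g q"
  shows "f \<in> Arr C" "g \<in> Arr C" "Dom C f = Dom C g" "Cod C f = Cod C g" "q \<in> Arr C"
    "Dom C q = Cod C g" "q \<cdot> f = q \<cdot> g"
  using assms by (auto simp: is_coequaliser_def)

lemma coequaliser_ex:
  assumes "is_coequaliser C f g q" "h \<in> Arr C" "Dom C h = Cod C g" "h \<cdot> f = h \<cdot> g"
  obtains k where "k \<in> Arr C" "Dom C k = Cod C q" "Cod C k = Cod C h" "k \<cdot> q = h"
proof -
  have "h \<in> hom C (Cod C f) (Cod C h) \<and> h \<cdot> f = h \<cdot> g"
    using assms is_coequaliserD(4) [OF assms(1)] by (auto simp: hom_def)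
  with assms(1) have "\<exists>!k. k \<in> hom C (Cod C q) (Cod C h) \<and> k \<cdot> q = h"
    unfolding is_coequaliser_def by blast
  then show thesis
    using that by (auto simp: hom_def)
qed

lemma coequaliser_epi:
  assumes "is_coequaliser C f g q"
  shows "epi q"
  unfolding epi_def
proof (intro conjI ballI impI)
  note d = is_coequaliserD [OF assms]
  show "q \<in> Arr C"
    by (fact d)
  fix k l
  assume kl: "k \<in> Arr C" "l \<in> Arr C" "Dom C k = Cod C q \<and> Dom C l = Cod C q \<and> k \<cdot> q = l \<cdot> q"
  have "(k \<cdot> q) \<cdot> f = (k \<cdot> q) \<cdot> g"
    using kl d by simp
  moreover have "Cod C l = Cod C k"
    using kl d Cod_Cmp by metis
  ultimately have "k \<cdot> q \<in> hom C (Cod C f) (Cod C k) \<and> (k \<cdot> q) \<cdot> f = (k \<cdot> q) \<cdot> g"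
    using kl d by (auto simp: hom_def)
  with assms have "\<exists>!k'. k' \<in> hom C (Cod C q) (Cod C k) \<and> k' \<cdot> q = k \<cdot> q"
    unfolding is_coequaliser_def by blast
  then show "k = l"
    using kl \<open>Cod C l = Cod C k\<close> by (auto simp: hom_def)
qed

text \<open>Uniqueness of the factorisation is traded for \<open>epi q\<close>, which does not
  mention the parallel pair and can be obtained from composites or checked componentwise.\<close>

lemma is_coequaliserI:
  assumes "f \<in> Arr C" "g \<in> Arr C" "Dom C f = Dom C g" "Cod C f = Cod C g" "epi q"
    "Dom C q = Cod C g" "q \<cdot> f = q \<cdot> g"
    and "\<And>h. \<lbrakk>h \<in> Arr C; Dom C h = Cod C g; h \<cdot> f = h \<cdot> g\<rbrakk> \<Longrightarrow>
           \<exists>k \<in> Arr C. Dom C k = Cod C q \<and> Cod C k = Cod C h \<and> k \<cdot> q = h"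
  shows "is_coequaliser C f g q"
  unfolding is_coequaliser_def
proof (intro conjI allI impI)
  fix D h
  assume "h \<in> hom C (Cod C f) D \<and> h \<cdot> f = h \<cdot> g"
  then obtain k where "k \<in> Arr C" "Dom C k = Cod C q" "Cod C k = D" "k \<cdot> q = h"
    using assms by (auto simp: hom_def)
  then show "\<exists>!k. k \<in> hom C (Cod C q) D \<and> k \<cdot> q = h"
    using epiD [OF assms(5)] by (intro ex1I [of _ k]) (auto simp: hom_def)
qed (use assms in \<open>auto simp: epi_def\<close>)

lemma is_coequaliser_inverse_arrows:
  assumes q: "is_coequaliser C f g q" and k: "inverse_arrows k k'" "Dom C k = Cod C q"
  shows "is_coequaliser C f g (k \<cdot> q)"
proof -
  note d = is_coequaliserD [OF q] and kd = inverse_arrowsD [OF k(1)]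
  have "epi k"
    unfolding epi_def
  proof (intro conjI ballI impI)
    fix g h
    assume gh: "g \<in> Arr C" "h \<in> Arr C" "Dom C g = Cod C k \<and> Dom C h = Cod C k \<and> g \<cdot> k = h \<cdot> k"
    then have "(g \<cdot> k) \<cdot> k' = (h \<cdot> k) \<cdot> k'"
      by simp
    then have "g \<cdot> k \<cdot> k' = h \<cdot> k \<cdot> k'"
      using gh kd by (metis Cmp_assoc')
    then show "g = h"
      using gh kd by simp
  qed (fact kd)
  show ?thesis
  proof (rule is_coequaliserI)
    show "epi (k \<cdot> q)"
      using epi_Cmp \<open>epi k\<close> coequaliser_epi [OF q] k by blast
  next
    fix h
    assume h: "h \<in> Arr C" "Dom C h = Cod C g" "h \<cdot> f = h \<cdot> g"
    then obtain l where l: "l \<in> Arr C" "Dom C l = Cod C q" "Cod C l = Cod C h" "l \<cdot> q = h"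
      using coequaliser_ex [OF q] by metis
    show "\<exists>l \<in> Arr C. Dom C l = Cod C (k \<cdot> q) \<and> Cod C l = Cod C h \<and> l \<cdot> k \<cdot> q = h"
      by (rule bexI [of _ "l \<cdot> k'"])
        (use l kd k d in \<open>auto simp: inverse_arrows_cancel [OF k(1)]\<close>)
  qed (use d kd k in auto)
qed

lemma coequaliser_unique_up_to_iso:
  assumes q: "is_coequaliser C f g q" "is_coequaliser C f g q'"
  shows "\<exists>k k'. inverse_arrows k k' \<and> Dom C k = Cod C q \<and> Cod C k = Cod C q' \<and> k \<cdot> q = q'"
proof -
  note d = is_coequaliserD [OF q(1)] and d' = is_coequaliserD [OF q(2)]
  obtain k where k: "k \<in> Arr C" "Dom C k = Cod C q" "Cod C k = Cod C q'" "k \<cdot> q = q'"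
    using coequaliser_ex [OF q(1) d'(5-7)] by blast
  obtain k' where k': "k' \<in> Arr C" "Dom C k' = Cod C q'" "Cod C k' = Cod C q" "k' \<cdot> q' = q"
    using coequaliser_ex [OF q(2) d(5-7)] by blast
  have "k' \<cdot> k = Idn C (Cod C q)"
    by (rule epiD [OF coequaliser_epi [OF q(1)]]) (use k k' d d' in auto)
  moreover have "k \<cdot> k' = Idn C (Cod C q')"
    by (rule epiD [OF coequaliser_epi [OF q(2)]]) (use k k' d d' in auto)
  ultimately have "inverse_arrows k k'"
    using k k' unfolding inverse_arrows_def by simp
  then show ?thesis
    using k by blast
qed

end


subsection \<open>Slices and stability\<close>

locale stable_category = category E for E :: "('o, 'm) cat" (structure) +
  assumes pullbacks: "has_pullbacks E"
    and stable: "has_pullback_stable_coequalisers E"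
begin

lemma pullback_obtain:
  assumes "f \<in> Arr E" "g \<in> Arr E" "Cod E f = Cod E g"
  obtains p q where "is_pullback E f g p q"
  using pullbacks assms unfolding has_pullbacks_def by blast

text \<open>A slice arrow \<open>l\<close> that equalises the pair factors as
  \<open>m \<cdot> q\<close> in \<open>E\<close>, and the factor lies over the base automatically:
  \<open>D \<cdot> m\<close> and \<open>c\<close> agree after the epimorphism \<open>q\<close>.
  Together with the converse below, this moves stability from slices to \<open>E\<close>.\<close>

lemma coequaliser_in_slice:
  assumes q: "is_coequaliser E h k q" and c: "c \<in> Arr E" "Dom E c = Cod E q"
  shows "is_coequaliser (slice E (Cod E c)) (c \<cdot> q \<cdot> h, h, c \<cdot> q) (c \<cdot> q \<cdot> h, k, c \<cdot> q) (c \<cdot> q, q, c)"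
proof -
  note d = is_coequaliserD [OF q]
  show ?thesis
    unfolding is_coequaliser_def
  proof (intro conjI allI impI)
    fix D H
    assume "H \<in> hom (slice E (Cod E c)) (Cod (slice E (Cod E c)) (c \<cdot> q \<cdot> h, h, c \<cdot> q)) D \<and>
      H \<cdot>\<^bsub>slice E (Cod E c)\<^esub> (c \<cdot> q \<cdot> h, h, c \<cdot> q) = H \<cdot>\<^bsub>slice E (Cod E c)\<^esub> (c \<cdot> q \<cdot> h, k, c \<cdot> q)"
    then obtain l where H: "H = (c \<cdot> q, l, D)" and l: "D \<in> Arr E" "Cod E D = Cod E c"
      "l \<in> Arr E" "Dom E l = Dom E q" "Cod E l = Dom E D" "D \<cdot> l = c \<cdot> q" "l \<cdot> h = l \<cdot> k"
      using d c by (cases H) (auto simp: slice_def hom_def)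
    obtain m where m: "m \<in> Arr E" "Dom E m = Cod E q" "Cod E m = Cod E l" "m \<cdot> q = l"
      using coequaliser_ex [OF q] l d by metis
    have "D \<cdot> m = c"
      by (rule epiD [OF coequaliser_epi [OF q]]) (use l m c d in auto)
    show "\<exists>!K. K \<in> hom (slice E (Cod E c)) (Cod (slice E (Cod E c)) (c \<cdot> q, q, c)) D \<and>
            K \<cdot>\<^bsub>slice E (Cod E c)\<^esub> (c \<cdot> q, q, c) = H"
    proof (rule ex1I [of _ "(c, m, D)"])
      fix K
      assume K: "K \<in> hom (slice E (Cod E c)) (Cod (slice E (Cod E c)) (c \<cdot> q, q, c)) D \<and>
            K \<cdot>\<^bsub>slice E (Cod E c)\<^esub> (c \<cdot> q, q, c) = H"
      then obtain m' where m': "K = (c, m', D)" "m' \<in> Arr E" "Dom E m' = Cod E q" "m' \<cdot> q = l"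
        using H c by (cases K) (auto simp: slice_def hom_def)
      moreover have "m' = m"
        by (rule epiD [OF coequaliser_epi [OF q]]) (use m' m in auto)
      ultimately show "K = (c, m, D)"
        by simp
    qed (use H l m c d \<open>D \<cdot> m = c\<close> in \<open>auto simp: slice_def hom_def\<close>)
  qed (use d c in \<open>auto simp: slice_def hom_def\<close>)
qed

text \<open>Without products the slice projection has no right adjoint; instead the coequaliser in the
  ambient category lifts to the slice and is compared with the given one.\<close>

lemma coequaliser_from_slice:
  assumes q: "is_coequaliser (slice E Y) (a, h, b) (a, k, b) (b, q, c)"
  shows "is_coequaliser E h k q"
proof -
  have d: "a \<in> Arr E" "Cod E a = Y" "b \<in> Arr E" "Cod E b = Y" "c \<in> Arr E" "Cod E c = Y"
    "h \<in> Arr E" "Dom E h = Dom E a" "Cod E h = Dom E b" "b \<cdot> h = a"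
    "k \<in> Arr E" "Dom E k = Dom E a" "Cod E k = Dom E b" "b \<cdot> k = a"
    "q \<in> Arr E" "Dom E q = Dom E b" "Cod E q = Dom E c" "c \<cdot> q = b" "q \<cdot> h = q \<cdot> k"
    using q unfolding is_coequaliser_def by (auto simp: slice_def hom_def)
  have univ: "\<exists>!K. K \<in> Arr (slice E Y) \<and> Dom (slice E Y) K = c \<and> Cod (slice E Y) K = D \<and>
      K \<cdot>\<^bsub>slice E Y\<^esub> (b, q, c) = H"
    if "H \<in> Arr (slice E Y)" "Dom (slice E Y) H = b" "Cod (slice E Y) H = D"
      "H \<cdot>\<^bsub>slice E Y\<^esub> (a, h, b) = H \<cdot>\<^bsub>slice E Y\<^esub> (a, k, b)" for H D
  proof -
    have cod: "Cod (slice E Y) (a, h, b) = b" "Cod (slice E Y) (b, q, c) = c"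
      by (auto simp: slice_def)
    from q have "H \<in> hom (slice E Y) b D \<and>
        H \<cdot>\<^bsub>slice E Y\<^esub> (a, h, b) = H \<cdot>\<^bsub>slice E Y\<^esub> (a, k, b) \<longrightarrow>
        (\<exists>!K. K \<in> hom (slice E Y) c D \<and> K \<cdot>\<^bsub>slice E Y\<^esub> (b, q, c) = H)"
      unfolding is_coequaliser_def cod by blast
    then show ?thesis
      using that unfolding hom_def by simp
  qed
  obtain r where r: "is_coequaliser E h k r"
    using stable d unfolding has_pullback_stable_coequalisers_def has_coequalisers_def by metis
  note rd = is_coequaliserD [OF r]
  \<comment> \<open>\<open>b\<close> equalises the pair because
    \<open>b \<cdot> h = a = b \<cdot> k\<close>, so the coequaliser \<open>r\<close> taken in
    \<open>E\<close> acquires a structure arrow \<open>e\<close> to \<open>Y\<close> and becomes an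
    arrow of the slice.\<close>
  obtain e where e: "e \<in> Arr E" "Dom E e = Cod E r" "Cod E e = Y" "e \<cdot> r = b"
    using coequaliser_ex [OF r, of b] d by metis
  obtain l where l: "l \<in> Arr E" "Dom E l = Cod E r" "Cod E l = Cod E q" "l \<cdot> r = q"
    using coequaliser_ex [OF r, of q] d by metis
  have "c \<cdot> l = e"
    by (rule epiD [OF coequaliser_epi [OF r]]) (use l e rd d in auto)
  obtain K where K: "K \<in> Arr (slice E Y)" "Dom (slice E Y) K = c" "Cod (slice E Y) K = e"
      "K \<cdot>\<^bsub>slice E Y\<^esub> (b, q, c) = (b, r, e)"
    using univ [of "(b, r, e)" e] d rd e by (auto simp: slice_def hom_def)
  obtain m where m: "m \<in> Arr E" "Dom E m = Dom E c" "Cod E m = Dom E e" "e \<cdot> m = c" "m \<cdot> q = r"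
    using K by (cases K) (auto simp: slice_def hom_def)
  \<comment> \<open>Uniqueness of the factorisation of \<open>q\<close> through itself: both
    \<open>l \<cdot> m\<close> and the identity are such factorisations, which gives one half of the
    isomorphism. The other half cancels the epimorphism \<open>r\<close>.\<close>
  have "\<exists>!K. K \<in> Arr (slice E Y) \<and> Dom (slice E Y) K = c \<and> Cod (slice E Y) K = c \<and>
      K \<cdot>\<^bsub>slice E Y\<^esub> (b, q, c) = (b, q, c)"
    using d by (intro univ) (auto simp: slice_def hom_def)
  then have uniq: "K = K'" if "K \<in> Arr (slice E Y)" "Dom (slice E Y) K = c" "Cod (slice E Y) K = c"
      "K \<cdot>\<^bsub>slice E Y\<^esub> (b, q, c) = (b, q, c)"
      "K' \<in> Arr (slice E Y)" "Dom (slice E Y) K' = c" "Cod (slice E Y) K' = c"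
      "K' \<cdot>\<^bsub>slice E Y\<^esub> (b, q, c) = (b, q, c)" for K K'
    using that by blast
  have "c \<cdot> l \<cdot> m = c"
    using \<open>c \<cdot> l = e\<close> l m d e by (metis Cmp_assoc')
  have "(c, l \<cdot> m, c) = (c, Idn E (Dom E c), c)"
    by (rule uniq) (use d l m e \<open>c \<cdot> l \<cdot> m = c\<close> in \<open>auto simp: slice_def hom_def\<close>)
  then have "l \<cdot> m = Idn E (Dom E c)"
    by simp
  moreover have "m \<cdot> l = Idn E (Cod E r)"
    by (rule epiD [OF coequaliser_epi [OF r]]) (use l m rd d e in auto)
  ultimately have "inverse_arrows l m"
    using l m e d unfolding inverse_arrows_def by auto
  then show ?thesis
    using is_coequaliser_inverse_arrows [OF r, of l m] l by simp
qed

text \<open>Stability restated in \<open>E\<close> itself. The arrow \<open>c\<close> supplies the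
  base over which the fork lives, and \<open>h'\<close>, \<open>k'\<close>, \<open>q'\<close> are
  known only by their two projections, which is what the pullbacks occurring later provide.\<close>

lemma coequaliser_stable:
  assumes q: "is_coequaliser E h k q" and c: "c \<in> Arr E" "Dom E c = Cod E q"
    and pb: "is_pullback E f (c \<cdot> q \<cdot> h) a' \<pi>" "is_pullback E f (c \<cdot> q) b' \<rho>" "is_pullback E f c c' \<sigma>"
    and h': "h' \<in> Arr E" "Cod E h' = Dom E b'" "b' \<cdot> h' = a'" "\<rho> \<cdot> h' = h \<cdot> \<pi>"
    and k': "k' \<in> Arr E" "Cod E k' = Dom E b'" "b' \<cdot> k' = a'" "\<rho> \<cdot> k' = k \<cdot> \<pi>"
    and q': "q' \<in> Arr E" "Cod E q' = Dom E c'" "c' \<cdot> q' = b'" "\<sigma> \<cdot> q' = q \<cdot> \<rho>"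
  shows "is_coequaliser E h' k' q'"
proof -
  note pd = is_pullbackD [OF pb(1)] is_pullbackD [OF pb(2)] is_pullbackD [OF pb(3)]
  have "Dom E h' = Dom E a'" "Dom E k' = Dom E a'" "Dom E q' = Dom E b'"
    using h' k' q' pd by (metis Dom_Cmp)+
  then have pa: "is_pullback_arrow E a' \<pi> b' \<rho> h h'" "is_pullback_arrow E a' \<pi> b' \<rho> k k'"
    "is_pullback_arrow E b' \<rho> c' \<sigma> q q'"
    using h' k' q' unfolding is_pullback_arrow_def hom_def by auto
  have "Cod E f = Cod E c"
    using pd by simp
  then have "is_coequaliser (slice E (Cod E f)) (c \<cdot> q \<cdot> h, h, c \<cdot> q) (c \<cdot> q \<cdot> h, k, c \<cdot> q) (c \<cdot> q, q, c)"
    using coequaliser_in_slice [OF q c] by simp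
  moreover have "pullback_preserves_coequalisers E f"
    using stable pd unfolding has_pullback_stable_coequalisers_def by blast
  ultimately have "is_coequaliser (slice E (Dom E f)) (a', h', b') (a', k', b') (b', q', c')"
    unfolding pullback_preserves_coequalisers_def using pa pb by blast
  then show ?thesis
    by (rule coequaliser_from_slice)
qed

text \<open>The pullback \<open>e\<close> of \<open>q\<close> along \<open>x\<close> is again a
  coequaliser, hence epi. So an arrow into the quotient has a representative after restriction along
  an epimorphism.\<close>

lemma coequaliser_lift:
  assumes q: "is_coequaliser E h k q" and x: "x \<in> Arr E" "Cod E x = Cod E q"
  obtains e y where "epi e" "Cod E e = Dom E x" "y \<in> Arr E" "Dom E y = Dom E e" "Cod E y = Dom E q"
    "q \<cdot> y = x \<cdot> e"
proof -
  note d = is_coequaliserD [OF q]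
  let ?c = "Idn E (Cod E q)"
  obtain e y where pb: "is_pullback E x q e y"
    using pullback_obtain [of x q] x d by metis
  note pd = is_pullbackD [OF pb]
  obtain a p where pa: "is_pullback E x (q \<cdot> h) a p"
    using pullback_obtain [of x "q \<cdot> h"] x d by auto
  note ad = is_pullbackD [OF pa]
  \<comment> \<open>With the identity as structure arrow, the cospan \<open>x, q\<close> is already
    of the form that stability requires; the third pullback is then the trivial one.\<close>
  have pc: "is_pullback E x ?c (Idn E (Dom E x)) x"
  proof (rule is_pullbackI)
    fix u v
    assume "u \<in> Arr E" "v \<in> Arr E" "Dom E u = Dom E v" "Cod E u = Dom E x" "Cod E v = Dom E ?c"
      "x \<cdot> u = ?c \<cdot> v"
    then show "\<exists>w \<in> Arr E. Dom E w = Dom E u \<and> Cod E w = Dom E (Idn E (Dom E x)) \<and>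
        Idn E (Dom E x) \<cdot> w = u \<and> x \<cdot> w = v"
      using d x by (intro bexI [of _ u]) auto
  qed (use x d in auto)
  have h: "x \<cdot> a = q \<cdot> h \<cdot> p" "x \<cdot> a = q \<cdot> k \<cdot> p"
    using ad d by (auto simp: Cmp_reassoc [OF d(7)])
  note ph = pairing_props [OF pb, of a "h \<cdot> p"] and pk = pairing_props [OF pb, of a "k \<cdot> p"]
  have "is_coequaliser E (pairing E e y a (h \<cdot> p)) (pairing E e y a (k \<cdot> p)) e"
    by (rule coequaliser_stable [OF q, of ?c x a p e y "Idn E (Dom E x)" x])
      (use pa pb pc d x pd ad h ph pk in auto)
  then show thesis
    using that [of e y] coequaliser_epi pd by metis
qed

text \<open>An arrow defined on representatives of the first component of a fibre product descends along the
  pulled-back coequaliser. It is stated for arrows \<open>v, w\<close> with prescribed projections, so that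
  it applies to either component.\<close>

lemma coequaliser_descent:
  assumes q: "is_coequaliser E h k q" and c: "c \<in> Arr E" "Dom E c = Cod E q"
    and pb: "is_pullback E u (c \<cdot> q) x y" and pc: "is_pullback E u c x' y'"
    and g: "g \<in> Arr E" "Dom E g = Dom E x"
    and compat: "\<And>w w' r. \<lbrakk>w \<in> Arr E; w' \<in> Arr E; r \<in> Arr E; Cod E w = Dom E x; Cod E w' = Dom E x;
        Cod E r = Dom E h; x \<cdot> w = x \<cdot> w'; y \<cdot> w = h \<cdot> r; y \<cdot> w' = k \<cdot> r\<rbrakk> \<Longrightarrow> g \<cdot> w = g \<cdot> w'"
  obtains g' where "g' \<in> Arr E" "Dom E g' = Dom E x'" "Cod E g' = Cod E g"
    "\<And>v w. \<lbrakk>v \<in> Arr E; w \<in> Arr E; Cod E v = Dom E x'; Cod E w = Dom E x; x' \<cdot> v = x \<cdot> w;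
       y' \<cdot> v = q \<cdot> y \<cdot> w\<rbrakk> \<Longrightarrow> g' \<cdot> v = g \<cdot> w"
proof -
  note d = is_coequaliserD [OF q] and bd = is_pullbackD [OF pb] and cd = is_pullbackD [OF pc]
  obtain a p where pa: "is_pullback E u (c \<cdot> q \<cdot> h) a p"
    using pullback_obtain [of u "c \<cdot> q \<cdot> h"] bd d c by auto
  note ad = is_pullbackD [OF pa]
  have cqp: "u \<cdot> a = c \<cdot> q \<cdot> h \<cdot> p" "u \<cdot> a = c \<cdot> q \<cdot> k \<cdot> p"
    using ad d c by (auto simp: Cmp_reassoc [OF d(7)])
  have cqy: "u \<cdot> x = c \<cdot> q \<cdot> y"
    using bd c d by simp
  \<comment> \<open>\<open>s\<close>, \<open>t\<close> and \<open>e\<close> are the base changes of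
    \<open>h\<close>, \<open>k\<close> and \<open>q\<close> along \<open>u\<close>.\<close>
  define s where "s = pairing E x y a (h \<cdot> p)"
  define t where "t = pairing E x y a (k \<cdot> p)"
  define e where "e = pairing E x' y' x (q \<cdot> y)"
  have s: "s \<in> Arr E" "Dom E s = Dom E a" "Cod E s = Dom E x" "x \<cdot> s = a" "y \<cdot> s = h \<cdot> p"
    unfolding s_def using pairing_props [OF pb, of a "h \<cdot> p"] ad d c bd cqp by auto
  have t: "t \<in> Arr E" "Dom E t = Dom E a" "Cod E t = Dom E x" "x \<cdot> t = a" "y \<cdot> t = k \<cdot> p"
    unfolding t_def using pairing_props [OF pb, of a "k \<cdot> p"] ad d c bd cqp by auto
  have e: "e \<in> Arr E" "Dom E e = Dom E x" "Cod E e = Dom E x'" "x' \<cdot> e = x" "y' \<cdot> e = q \<cdot> y"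
    unfolding e_def using pairing_props [OF pc, of x "q \<cdot> y"] cd bd d c cqy by auto
  have "is_coequaliser E s t e"
    by (rule coequaliser_stable [OF q c pa pb pc]) (use s t e cd in auto)
  moreover have "g \<cdot> s = g \<cdot> t"
    using s t ad d c by (intro compat [of s t p]) simp_all
  ultimately obtain g' where g': "g' \<in> Arr E" "Dom E g' = Cod E e" "Cod E g' = Cod E g" "g' \<cdot> e = g"
    using coequaliser_ex [of s t e g] g(1) g(2) t(3) by metis
  show thesis
  proof (rule that [of g'])
    fix v w
    assume vw: "v \<in> Arr E" "w \<in> Arr E" "Cod E v = Dom E x'" "Cod E w = Dom E x" "x' \<cdot> v = x \<cdot> w"
      "y' \<cdot> v = q \<cdot> y \<cdot> w"
    have "x' \<cdot> e \<cdot> w = x \<cdot> w" "y' \<cdot> e \<cdot> w = q \<cdot> y \<cdot> w"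
      using vw(2,4) e cd(4-6) bd(4-8) d(5,6) c by (simp_all add: Cmp_reassoc [OF e(4)] Cmp_reassoc [OF e(5)])
    \<comment> \<open>\<open>w\<close> represents \<open>v\<close>: both have the same projections
      to the pullback of \<open>u\<close> and \<open>c\<close>, so
      \<open>g' \<cdot> v = g' \<cdot> e \<cdot> w = g \<cdot> w\<close>.\<close>
    then have "v = e \<cdot> w"
      using vw e cd(6) pullback_eqI [OF pc, of v "e \<cdot> w"] by simp
    then show "g' \<cdot> v = g \<cdot> w"
      using Cmp_reassoc [of g' e g w] g' e vw by simp
  qed (use g' e in auto)
qed

end


subsection \<open>Internal categories through generalised elements\<close>

context category
begin

text \<open>Composition of generalised elements of the object of arrows, \<open>x\<close> coming
  first. With it the axioms read as those of an ordinary category. It is meaningful only if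
  \<open>tgt A \<cdot> x = src A \<cdot> y\<close>.\<close>

definition mul :: "('o, 'm) icat \<Rightarrow> 'm \<Rightarrow> 'm \<Rightarrow> 'm" where
  "mul A x y = icomp A \<cdot> ipair C A x y"

lemma icat_simps [simp]:
  assumes "internal_category C A"
  shows "ob0 A \<in> Obj C" "ob1 A \<in> Obj C" "ob2 A \<in> Obj C"
    "src A \<in> Arr C" "Dom C (src A) = ob1 A" "Cod C (src A) = ob0 A"
    "tgt A \<in> Arr C" "Dom C (tgt A) = ob1 A" "Cod C (tgt A) = ob0 A"
    "unit A \<in> Arr C" "Dom C (unit A) = ob0 A" "Cod C (unit A) = ob1 A"
    "fst_arr A \<in> Arr C" "Dom C (fst_arr A) = ob2 A" "Cod C (fst_arr A) = ob1 A"
    "snd_arr A \<in> Arr C" "Dom C (snd_arr A) = ob2 A" "Cod C (snd_arr A) = ob1 A"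
    "icomp A \<in> Arr C" "Dom C (icomp A) = ob2 A" "Cod C (icomp A) = ob1 A"
    "src A \<cdot> unit A = Idn C (ob0 A)" "tgt A \<cdot> unit A = Idn C (ob0 A)"
    "src A \<cdot> icomp A = src A \<cdot> fst_arr A" "tgt A \<cdot> icomp A = tgt A \<cdot> snd_arr A"
proof -
  interpret A: internal_category C A by fact
  note facts = A.ob0 A.src A.tgt A.unit A.fst_arr A.snd_arr A.icomp A.src_unit A.tgt_unit
    A.src_icomp A.tgt_icomp
  show "ob1 A \<in> Obj C" "ob2 A \<in> Obj C"
    using A.src A.icomp Dom_Obj [of "src A"] Dom_Obj [of "icomp A"] by (auto simp: hom_def)
  show "ob0 A \<in> Obj C"
    "src A \<in> Arr C" "Dom C (src A) = ob1 A" "Cod C (src A) = ob0 A"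
    "tgt A \<in> Arr C" "Dom C (tgt A) = ob1 A" "Cod C (tgt A) = ob0 A"
    "unit A \<in> Arr C" "Dom C (unit A) = ob0 A" "Cod C (unit A) = ob1 A"
    "fst_arr A \<in> Arr C" "Dom C (fst_arr A) = ob2 A" "Cod C (fst_arr A) = ob1 A"
    "snd_arr A \<in> Arr C" "Dom C (snd_arr A) = ob2 A" "Cod C (snd_arr A) = ob1 A"
    "icomp A \<in> Arr C" "Dom C (icomp A) = ob2 A" "Cod C (icomp A) = ob1 A"
    "src A \<cdot> unit A = Idn C (ob0 A)" "tgt A \<cdot> unit A = Idn C (ob0 A)"
    "src A \<cdot> icomp A = src A \<cdot> fst_arr A" "tgt A \<cdot> icomp A = tgt A \<cdot> snd_arr A"
    using facts by (auto simp: hom_def)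
qed

lemma icat_unit_Cmp [simp]:
  assumes "internal_category C A" "x \<in> Arr C" "Cod C x = ob0 A"
  shows "src A \<cdot> unit A \<cdot> x = x" "tgt A \<cdot> unit A \<cdot> x = x"
  using assms Cmp_reassoc [of "src A" "unit A" _ x] Cmp_reassoc [of "tgt A" "unit A" _ x] by simp_all

lemma icat_pullback: "internal_category C A \<Longrightarrow> is_pullback C (tgt A) (src A) (fst_arr A) (snd_arr A)"
  by (simp add: internal_category.composable_pairs)

lemma ipair_simps:
  assumes "internal_category C A" "x \<in> Arr C" "y \<in> Arr C" "Cod C x = ob1 A" "Cod C y = ob1 A"
    "tgt A \<cdot> x = src A \<cdot> y"
  shows "ipair C A x y \<in> Arr C" "Dom C (ipair C A x y) = Dom C x" "Cod C (ipair C A x y) = ob2 A"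
    "fst_arr A \<cdot> ipair C A x y = x" "snd_arr A \<cdot> ipair C A x y = y"
  using pairing_props [OF icat_pullback, of A x y] assms by simp_all

lemma mul_simps [simp]:
  assumes "internal_category C A" "x \<in> Arr C" "y \<in> Arr C" "Cod C x = ob1 A" "Cod C y = ob1 A"
    "tgt A \<cdot> x = src A \<cdot> y"
  shows "mul A x y \<in> Arr C" "Dom C (mul A x y) = Dom C x" "Cod C (mul A x y) = ob1 A"
    "src A \<cdot> mul A x y = src A \<cdot> x" "tgt A \<cdot> mul A x y = tgt A \<cdot> y"
proof -
  note p = ipair_simps [OF assms]
  show "mul A x y \<in> Arr C" "Dom C (mul A x y) = Dom C x" "Cod C (mul A x y) = ob1 A"
    unfolding mul_def using assms p by simp_all
  show "src A \<cdot> mul A x y = src A \<cdot> x" "tgt A \<cdot> mul A x y = tgt A \<cdot> y"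
    unfolding mul_def using assms(1) p
      Cmp_reassoc [of "src A" "icomp A" _ "ipair C A x y"] Cmp_reassoc [of "tgt A" "icomp A" _ "ipair C A x y"]
    by simp_all
qed

lemma mul_Cmp [simp]:
  assumes "internal_category C A" "x \<in> Arr C" "y \<in> Arr C" "Cod C x = ob1 A" "Cod C y = ob1 A"
    "tgt A \<cdot> x = src A \<cdot> y" "t \<in> Arr C" "Cod C t = Dom C x"
  shows "mul A x y \<cdot> t = mul A (x \<cdot> t) (y \<cdot> t)"
  using assms ipair_simps [OF assms(1-6)] pairing_Cmp [OF icat_pullback, of A x y t]
  by (simp add: mul_def)

text \<open>The unit axiom is the case of the identity arrow; precomposition with \<open>x\<close>
  gives all others. The separate \<open>s\<close> lets the rule fire after
  \<open>src A \<cdot> x\<close> has been rewritten.\<close>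

lemma mul_unit_left [simp]:
  assumes "internal_category C A" "x \<in> Arr C" "Cod C x = ob1 A" "src A \<cdot> x = s"
  shows "mul A (unit A \<cdot> s) x = x"
proof -
  have "(icomp A \<cdot> ipair C A (unit A \<cdot> src A) (Idn C (ob1 A))) \<cdot> x = x"
    using assms internal_category.unit_left [OF assms(1)] by simp
  moreover have "tgt A \<cdot> unit A \<cdot> src A = src A"
    using assms by simp
  ultimately show ?thesis
    using assms mul_Cmp [of A "unit A \<cdot> src A" "Idn C (ob1 A)" x] by (simp add: mul_def [symmetric])
qed

lemma mul_unit_right [simp]:
  assumes "internal_category C A" "x \<in> Arr C" "Cod C x = ob1 A" "tgt A \<cdot> x = s"
  shows "mul A x (unit A \<cdot> s) = x"
proof -
  have "(icomp A \<cdot> ipair C A (Idn C (ob1 A)) (unit A \<cdot> tgt A)) \<cdot> x = x"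
    using assms internal_category.unit_right [OF assms(1)] by simp
  moreover have "src A \<cdot> unit A \<cdot> tgt A = tgt A"
    using assms by simp
  ultimately show ?thesis
    using assms mul_Cmp [of A "Idn C (ob1 A)" "unit A \<cdot> tgt A" x] by (simp add: mul_def [symmetric])
qed

text \<open>Only the pullback property is assumed, so that the rule is available while the axioms of
  \<open>A\<close> are still being established.\<close>

lemma icomp_Cmp:
  assumes "is_pullback C (tgt A) (src A) (fst_arr A) (snd_arr A)" "w \<in> Arr C" "Cod C w = Dom C (fst_arr A)"
  shows "icomp A \<cdot> w = mul A (fst_arr A \<cdot> w) (snd_arr A \<cdot> w)"
  unfolding mul_def using pairing_unique [OF assms] by simp

lemma icomp_eq_mul:
  "internal_category C A \<Longrightarrow> icomp A = mul A (fst_arr A) (snd_arr A)"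
  using icomp_Cmp [OF icat_pullback, of A "Idn C (ob2 A)"] by simp

end

context stable_category
begin

text \<open>The axiom concerns the object of composable triples. A pullback for it exists here,
  \<open>(x, y, z)\<close> factors through it by \<open>w\<close>, and the axiom is precomposed with
  \<open>w\<close>.\<close>

lemma mul_assoc [simp]:
  assumes A: "internal_category E A" and x: "x \<in> Arr E" "y \<in> Arr E" "z \<in> Arr E"
    "Cod E x = ob1 A" "Cod E y = ob1 A" "Cod E z = ob1 A" "tgt A \<cdot> x = src A \<cdot> y" "tgt A \<cdot> y = src A \<cdot> z"
  shows "mul A (mul A x y) z = mul A x (mul A y z)"
proof -
  obtain r s where rs: "is_pullback E (snd_arr A) (fst_arr A) r s"
    using pullback_obtain [of "snd_arr A" "fst_arr A"] A by auto
  note d = is_pullbackD [OF rs]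
  define w where "w = pairing E r s (ipair E A x y) (ipair E A y z)"
  have w: "w \<in> Arr E" "Dom E w = Dom E x" "Cod E w = Dom E r" "r \<cdot> w = ipair E A x y" "s \<cdot> w = ipair E A y z"
    unfolding w_def using pairing_props [OF rs, of "ipair E A x y" "ipair E A y z"] A x ipair_simps [OF A]
    by simp_all
  have mr: "icomp A \<cdot> r = mul A (fst_arr A \<cdot> r) (snd_arr A \<cdot> r)"
    "icomp A \<cdot> s = mul A (fst_arr A \<cdot> s) (snd_arr A \<cdot> s)"
    using icomp_Cmp [OF icat_pullback] A d by simp_all
  have e: "tgt A \<cdot> fst_arr A \<cdot> r = src A \<cdot> snd_arr A \<cdot> r" "tgt A \<cdot> fst_arr A \<cdot> s = src A \<cdot> snd_arr A \<cdot> s"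
    using is_pullbackD(9) [OF icat_pullback [OF A]] A d Cmp_reassoc [of "tgt A" "fst_arr A"] by simp_all
  have "mul A (icomp A \<cdot> r) (snd_arr A \<cdot> s) = mul A (fst_arr A \<cdot> r) (icomp A \<cdot> s)"
    using internal_category.icomp_assoc [OF A rs] by (simp add: mul_def)
  then have "mul A (mul A (fst_arr A \<cdot> r) (snd_arr A \<cdot> r)) (snd_arr A \<cdot> s) \<cdot> w =
      mul A (fst_arr A \<cdot> r) (mul A (fst_arr A \<cdot> s) (snd_arr A \<cdot> s)) \<cdot> w"
    using mr by simp
  then show ?thesis
    using A d e x w ipair_simps [OF A] by simp
qed

end

context category
begin

lemma internal_categoryI:
  assumes "ob0 A \<in> Obj C" "src A \<in> hom C (ob1 A) (ob0 A)" "tgt A \<in> hom C (ob1 A) (ob0 A)"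
    "unit A \<in> hom C (ob0 A) (ob1 A)" "fst_arr A \<in> hom C (ob2 A) (ob1 A)"
    "snd_arr A \<in> hom C (ob2 A) (ob1 A)" "icomp A \<in> hom C (ob2 A) (ob1 A)"
    and pb: "is_pullback C (tgt A) (src A) (fst_arr A) (snd_arr A)"
    and "src A \<cdot> unit A = Idn C (ob0 A)" "tgt A \<cdot> unit A = Idn C (ob0 A)"
      "src A \<cdot> icomp A = src A \<cdot> fst_arr A" "tgt A \<cdot> icomp A = tgt A \<cdot> snd_arr A"
      "mul A (unit A \<cdot> src A) (Idn C (ob1 A)) = Idn C (ob1 A)"
      "mul A (Idn C (ob1 A)) (unit A \<cdot> tgt A) = Idn C (ob1 A)"
    and assoc: "\<And>x y z. \<lbrakk>x \<in> Arr C; y \<in> Arr C; z \<in> Arr C; Cod C x = ob1 A; Cod C y = ob1 A; Cod C z = ob1 A;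
        Dom C y = Dom C x; Dom C z = Dom C x; tgt A \<cdot> x = src A \<cdot> y; tgt A \<cdot> y = src A \<cdot> z\<rbrakk> \<Longrightarrow>
        mul A (mul A x y) z = mul A x (mul A y z)"
  shows "internal_category C A"
proof
  fix r s
  assume rs: "is_pullback C (snd_arr A) (fst_arr A) r s"
  note d = is_pullbackD [OF rs] is_pullbackD [OF pb]
  have m: "icomp A \<cdot> r = mul A (fst_arr A \<cdot> r) (snd_arr A \<cdot> r)"
    "icomp A \<cdot> s = mul A (fst_arr A \<cdot> s) (snd_arr A \<cdot> s)"
    by (rule icomp_Cmp [OF pb]; use d in simp)+
  have "mul A (icomp A \<cdot> r) (snd_arr A \<cdot> s) = mul A (fst_arr A \<cdot> r) (icomp A \<cdot> s)"
    \<comment> \<open>\<open>d(9)\<close> identifies \<open>snd_arr A \<cdot> r\<close> with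
      \<open>fst_arr A \<cdot> s\<close>, the middle arrow of the universal composable triple, to
      which \<open>assoc\<close> is applied.\<close>
    unfolding m d(9)
    by (rule assoc)
      (use assms(1-7) d Cmp_reassoc [OF d(18), of r] Cmp_reassoc [OF d(18), of s] in
        \<open>auto simp: hom_def d(9) [symmetric]\<close>)
  then show "icomp A \<cdot> ipair C A (icomp A \<cdot> r) (snd_arr A \<cdot> s) =
      icomp A \<cdot> ipair C A (fst_arr A \<cdot> r) (icomp A \<cdot> s)"
    by (simp add: mul_def)
qed (use assms in \<open>auto simp: mul_def\<close>)


subsection \<open>Internal functors\<close>

lemma ifun_simps [simp]:
  assumes "internal_functor C F"
  shows "internal_category C (idom F)" "internal_category C (icod F)"
    "F0 F \<in> Arr C" "Dom C (F0 F) = ob0 (idom F)" "Cod C (F0 F) = ob0 (icod F)"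
    "F1 F \<in> Arr C" "Dom C (F1 F) = ob1 (idom F)" "Cod C (F1 F) = ob1 (icod F)"
  using internal_functor.idom [OF assms] internal_functor.icod [OF assms]
    internal_functor.F0 [OF assms] internal_functor.F1 [OF assms] by (auto simp: hom_def)

text \<open>Domains and codomains enter through premises such as \<open>icod F = B\<close> because
  the proofs below replace them by named categories, and a left-hand side containing
  \<open>icod F\<close> would then fail to match.\<close>

lemma ifun_Cmp_simps [simp]:
  assumes F: "internal_functor C F"
  shows "icod F = B \<Longrightarrow> src B \<cdot> F1 F = F0 F \<cdot> src (idom F)"
    "icod F = B \<Longrightarrow> tgt B \<cdot> F1 F = F0 F \<cdot> tgt (idom F)"
    "idom F = A \<Longrightarrow> F1 F \<cdot> unit A = unit (icod F) \<cdot> F0 F"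
    "\<lbrakk>icod F = B; x \<in> Arr C; Cod C x = ob1 (idom F)\<rbrakk> \<Longrightarrow> src B \<cdot> F1 F \<cdot> x = F0 F \<cdot> src (idom F) \<cdot> x"
    "\<lbrakk>icod F = B; x \<in> Arr C; Cod C x = ob1 (idom F)\<rbrakk> \<Longrightarrow> tgt B \<cdot> F1 F \<cdot> x = F0 F \<cdot> tgt (idom F) \<cdot> x"
    "\<lbrakk>idom F = A; x \<in> Arr C; Cod C x = ob0 (idom F)\<rbrakk> \<Longrightarrow> F1 F \<cdot> unit A \<cdot> x = unit (icod F) \<cdot> F0 F \<cdot> x"
proof -
  note e = internal_functor.src_F1 [OF F] internal_functor.tgt_F1 [OF F] internal_functor.F1_unit [OF F]
  show "icod F = B \<Longrightarrow> src B \<cdot> F1 F = F0 F \<cdot> src (idom F)"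
    "icod F = B \<Longrightarrow> tgt B \<cdot> F1 F = F0 F \<cdot> tgt (idom F)"
    "idom F = A \<Longrightarrow> F1 F \<cdot> unit A = unit (icod F) \<cdot> F0 F"
    using e by auto
  show "\<lbrakk>icod F = B; x \<in> Arr C; Cod C x = ob1 (idom F)\<rbrakk> \<Longrightarrow> src B \<cdot> F1 F \<cdot> x = F0 F \<cdot> src (idom F) \<cdot> x"
    using Cmp_reassoc [OF e(1), of x] F by auto
  show "\<lbrakk>icod F = B; x \<in> Arr C; Cod C x = ob1 (idom F)\<rbrakk> \<Longrightarrow> tgt B \<cdot> F1 F \<cdot> x = F0 F \<cdot> tgt (idom F) \<cdot> x"
    using Cmp_reassoc [OF e(2), of x] F by auto
  show "\<lbrakk>idom F = A; x \<in> Arr C; Cod C x = ob0 (idom F)\<rbrakk> \<Longrightarrow> F1 F \<cdot> unit A \<cdot> x = unit (icod F) \<cdot> F0 F \<cdot> x"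
    using Cmp_reassoc [OF e(3), of x] F by auto
qed

lemma F2_simps:
  assumes F: "internal_functor C F"
  shows "F2 C F \<in> Arr C" "Dom C (F2 C F) = ob2 (idom F)" "Cod C (F2 C F) = ob2 (icod F)"
    "fst_arr (icod F) \<cdot> F2 C F = F1 F \<cdot> fst_arr (idom F)"
    "snd_arr (icod F) \<cdot> F2 C F = F1 F \<cdot> snd_arr (idom F)"
  using ipair_simps [of "icod F" "F1 F \<cdot> fst_arr (idom F)" "F1 F \<cdot> snd_arr (idom F)"] F
    is_pullbackD(9) [OF icat_pullback, of "idom F"]
  by (simp_all add: F2_def)

lemma ifun_mul [simp]:
  assumes F: "internal_functor C F" and A: "idom F = A"
    and x: "x \<in> Arr C" "y \<in> Arr C" "Cod C x = ob1 A" "Cod C y = ob1 A" "tgt A \<cdot> x = src A \<cdot> y"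
  shows "F1 F \<cdot> mul A x y = mul (icod F) (F1 F \<cdot> x) (F1 F \<cdot> y)"
proof -
  note p = ipair_simps [OF _ x] and f = F2_simps [OF F]
  have A': "internal_category C A"
    using F A by auto
  have "F1 F \<cdot> mul A x y = (F1 F \<cdot> icomp A) \<cdot> ipair C A x y"
    using F A A' p by (simp add: mul_def)
  also have "\<dots> = (icomp (icod F) \<cdot> F2 C F) \<cdot> ipair C A x y"
    using internal_functor.F1_icomp [OF F] A by simp
  also have "\<dots> = icomp (icod F) \<cdot> F2 C F \<cdot> ipair C A x y"
    using F A A' p f by simp
  also have "\<dots> = mul (icod F) (F1 F \<cdot> x) (F1 F \<cdot> y)"
    using F A A' p f Cmp_reassoc [OF f(4), of "ipair C A x y"] Cmp_reassoc [OF f(5), of "ipair C A x y"]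
    by (subst icomp_Cmp [OF icat_pullback]) auto
  finally show ?thesis .
qed

text \<open>Preservation of composition is tested on generalised elements; the pair of projections
  \<open>fst_arr\<close>, \<open>snd_arr\<close> is the universal instance and returns the stated
  axiom.\<close>

lemma internal_functorI:
  assumes A: "internal_category C (idom F)" "internal_category C (icod F)"
    and F: "F0 F \<in> Arr C" "Dom C (F0 F) = ob0 (idom F)" "Cod C (F0 F) = ob0 (icod F)"
      "F1 F \<in> Arr C" "Dom C (F1 F) = ob1 (idom F)" "Cod C (F1 F) = ob1 (icod F)"
      "src (icod F) \<cdot> F1 F = F0 F \<cdot> src (idom F)" "tgt (icod F) \<cdot> F1 F = F0 F \<cdot> tgt (idom F)"
      "F1 F \<cdot> unit (idom F) = unit (icod F) \<cdot> F0 F"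
    and mul: "\<And>x y. \<lbrakk>x \<in> Arr C; y \<in> Arr C; Cod C x = ob1 (idom F); Cod C y = ob1 (idom F); Dom C y = Dom C x;
      tgt (idom F) \<cdot> x = src (idom F) \<cdot> y\<rbrakk> \<Longrightarrow> F1 F \<cdot> mul (idom F) x y = mul (icod F) (F1 F \<cdot> x) (F1 F \<cdot> y)"
  shows "internal_functor C F"
proof (rule internal_functor.intro)
  have "F1 F \<cdot> icomp (idom F) = F1 F \<cdot> mul (idom F) (fst_arr (idom F)) (snd_arr (idom F))"
    using A icomp_eq_mul by simp
  also have "\<dots> = mul (icod F) (F1 F \<cdot> fst_arr (idom F)) (F1 F \<cdot> snd_arr (idom F))"
    using A is_pullbackD(9) [OF icat_pullback, of "idom F"] by (intro mul) auto
  finally show "icomp (icod F) \<cdot> F2 C F = F1 F \<cdot> icomp (idom F)"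
    by (simp add: mul_def F2_def)
qed (use A F in \<open>auto simp: hom_def\<close>)

lemma Cat_simps [simp]:
  "A \<in> Obj (Cat C) \<longleftrightarrow> internal_category C A" "F \<in> Arr (Cat C) \<longleftrightarrow> internal_functor C F"
  "Dom (Cat C) F = idom F" "Cod (Cat C) F = icod F"
  "idom (G \<cdot>\<^bsub>Cat C\<^esub> F) = idom F" "icod (G \<cdot>\<^bsub>Cat C\<^esub> F) = icod G"
  "F0 (G \<cdot>\<^bsub>Cat C\<^esub> F) = F0 G \<cdot> F0 F" "F1 (G \<cdot>\<^bsub>Cat C\<^esub> F) = F1 G \<cdot> F1 F"
  "idom (Idn (Cat C) A) = A" "icod (Idn (Cat C) A) = A"
  "F0 (Idn (Cat C) A) = Idn C (ob0 A)" "F1 (Idn (Cat C) A) = Idn C (ob1 A)"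
  by (auto simp: Cat_def)

lemma Cat_Cmp_eqD:
  assumes "G \<cdot>\<^bsub>Cat C\<^esub> F = G' \<cdot>\<^bsub>Cat C\<^esub> F'"
  shows "F0 G \<cdot> F0 F = F0 G' \<cdot> F0 F'" "F1 G \<cdot> F1 F = F1 G' \<cdot> F1 F'"
  using assms by (metis Cat_simps(7,8))+

lemma ifun_eqI:
  fixes F G :: "('o, 'm) ifun"
  shows "\<lbrakk>idom F = idom G; icod F = icod G; F0 F = F0 G; F1 F = F1 G\<rbrakk> \<Longrightarrow> F = G"
  by (cases F; cases G) simp

lemma internal_functor_Cmp [simp]:
  assumes "internal_functor C F" "internal_functor C G" "idom G = icod F"
  shows "internal_functor C (G \<cdot>\<^bsub>Cat C\<^esub> F)"
  by (rule internal_functorI) (use assms in simp_all)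

lemma category_Cat: "category (Cat C)"
proof
  fix A assume "A \<in> Obj (Cat C)"
  then show "Idn (Cat C) A \<in> hom (Cat C) A A"
    unfolding hom_def by (auto intro!: internal_functorI)
qed (auto simp: hom_def intro!: ifun_eqI)

end


subsection \<open>Pullbacks of internal categories are computed componentwise\<close>

context stable_category
begin

text \<open>Objects and arrows are pulled back separately in \<open>E\<close>, and the structure
  arrows are induced. The projections to \<open>X\<close> and \<open>A\<close> are jointly monic on
  objects and on arrows, so every law of the new category is inherited from those two.\<close>

lemma Cat_pullback_exists:
  assumes f: "internal_functor E f" and a: "internal_functor E a" and Y: "icod f = icod a"
  shows "\<exists>p q. is_pullback (Cat E) f a p q \<and>
    is_pullback E (F0 f) (F0 a) (F0 p) (F0 q) \<and> is_pullback E (F1 f) (F1 a) (F1 p) (F1 q)"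
proof -
  define X where "X = idom f"
  define A where "A = idom a"
  define Y where "Y = icod a"
  have icat: "internal_category E X" "internal_category E A" "internal_category E Y"
    and dom: "idom f = X" "idom a = A" "icod f = Y" "icod a = Y"
    using f a assms(3) by (auto simp: X_def A_def Y_def)
  obtain p0 q0 where pb0: "is_pullback E (F0 f) (F0 a) p0 q0"
    using pullback_obtain [of "F0 f" "F0 a"] f a dom by auto
  obtain p1 q1 where pb1: "is_pullback E (F1 f) (F1 a) p1 q1"
    using pullback_obtain [of "F1 f" "F1 a"] f a dom by auto
  have d0: "p0 \<in> Arr E" "q0 \<in> Arr E" "Dom E q0 = Dom E p0" "Cod E p0 = ob0 X" "Cod E q0 = ob0 A"
      "F0 f \<cdot> p0 = F0 a \<cdot> q0"
    and d1: "p1 \<in> Arr E" "q1 \<in> Arr E" "Dom E q1 = Dom E p1" "Cod E p1 = ob1 X" "Cod E q1 = ob1 A"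
      "F1 f \<cdot> p1 = F1 a \<cdot> q1"
    using is_pullbackD [OF pb0] is_pullbackD [OF pb1] f a dom by simp_all
  have sq1: "F1 f \<cdot> p1 \<cdot> x = F1 a \<cdot> q1 \<cdot> x" if "x \<in> Arr E" "Cod E x = Dom E p1" for x
    using that f a dom d1 Cmp_reassoc [OF d1(6), of x] by simp
  define s where "s = pairing E p0 q0 (src X \<cdot> p1) (src A \<cdot> q1)"
  define t where "t = pairing E p0 q0 (tgt X \<cdot> p1) (tgt A \<cdot> q1)"
  define u where "u = pairing E p1 q1 (unit X \<cdot> p0) (unit A \<cdot> q0)"
  have "src Y \<cdot> F1 f \<cdot> p1 = src Y \<cdot> F1 a \<cdot> q1"
    by (simp only: d1(6))
  then have "F0 f \<cdot> src X \<cdot> p1 = F0 a \<cdot> src A \<cdot> q1"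
    using f a dom d1(1-5) icat by simp
  then have s: "s \<in> Arr E" "Dom E s = Dom E p1" "Cod E s = Dom E p0"
      "p0 \<cdot> s = src X \<cdot> p1" "q0 \<cdot> s = src A \<cdot> q1"
    unfolding s_def using pairing_props [OF pb0, of "src X \<cdot> p1" "src A \<cdot> q1"] d1 f a dom icat by simp_all
  have "tgt Y \<cdot> F1 f \<cdot> p1 = tgt Y \<cdot> F1 a \<cdot> q1"
    by (simp only: d1(6))
  then have "F0 f \<cdot> tgt X \<cdot> p1 = F0 a \<cdot> tgt A \<cdot> q1"
    using f a dom d1(1-5) icat by simp
  then have t: "t \<in> Arr E" "Dom E t = Dom E p1" "Cod E t = Dom E p0"
      "p0 \<cdot> t = tgt X \<cdot> p1" "q0 \<cdot> t = tgt A \<cdot> q1"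
    unfolding t_def using pairing_props [OF pb0, of "tgt X \<cdot> p1" "tgt A \<cdot> q1"] d1 f a dom icat by simp_all
  have u: "u \<in> Arr E" "Dom E u = Dom E p0" "Cod E u = Dom E p1"
      "p1 \<cdot> u = unit X \<cdot> p0" "q1 \<cdot> u = unit A \<cdot> q0"
    unfolding u_def using pairing_props [OF pb1, of "unit X \<cdot> p0" "unit A \<cdot> q0"] d0 f a dom icat by simp_all
  have sx: "p0 \<cdot> s \<cdot> x = src X \<cdot> p1 \<cdot> x" "q0 \<cdot> s \<cdot> x = src A \<cdot> q1 \<cdot> x"
    "p0 \<cdot> t \<cdot> x = tgt X \<cdot> p1 \<cdot> x" "q0 \<cdot> t \<cdot> x = tgt A \<cdot> q1 \<cdot> x"
    if "x \<in> Arr E" "Cod E x = Dom E p1" for x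
    using that s t d0 d1 icat Cmp_reassoc [OF s(4), of x] Cmp_reassoc [OF s(5), of x]
      Cmp_reassoc [OF t(4), of x] Cmp_reassoc [OF t(5), of x] by simp_all
  have ux: "p1 \<cdot> u \<cdot> x = unit X \<cdot> p0 \<cdot> x" "q1 \<cdot> u \<cdot> x = unit A \<cdot> q0 \<cdot> x"
    if "x \<in> Arr E" "Cod E x = Dom E p0" for x
    using that u d0 d1 icat Cmp_reassoc [OF u(4), of x] Cmp_reassoc [OF u(5), of x] by simp_all
  have eq0: "x = y" if "x \<in> Arr E" "y \<in> Arr E" "Cod E x = Dom E p0" "Cod E y = Dom E p0"
      "p0 \<cdot> x = p0 \<cdot> y" "q0 \<cdot> x = q0 \<cdot> y" for x y
    using pullback_eqI [OF pb0] that by blast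
  have eq1: "x = y" if "x \<in> Arr E" "y \<in> Arr E" "Cod E x = Dom E p1" "Cod E y = Dom E p1"
      "p1 \<cdot> x = p1 \<cdot> y" "q1 \<cdot> x = q1 \<cdot> y" for x y
    using pullback_eqI [OF pb1] that by blast
  \<comment> \<open>Composable pairs are a pullback of the induced \<open>t\<close> and
    \<open>s\<close>, as an internal category demands, rather than a pullback of
    \<open>ob2 X\<close> and \<open>ob2 A\<close>; composition is therefore induced through the
    projected pairs.\<close>
  obtain p2 q2 where pb2: "is_pullback E t s p2 q2"
    using pullback_obtain [of t s] s t by auto
  have d2: "p2 \<in> Arr E" "q2 \<in> Arr E" "Dom E q2 = Dom E p2" "Cod E p2 = Dom E p1" "Cod E q2 = Dom E p1"
      "t \<cdot> p2 = s \<cdot> q2"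
    using is_pullbackD [OF pb2] s t by simp_all
  have comp: "tgt X \<cdot> p1 \<cdot> x = src X \<cdot> p1 \<cdot> y" "tgt A \<cdot> q1 \<cdot> x = src A \<cdot> q1 \<cdot> y"
    if "x \<in> Arr E" "y \<in> Arr E" "Cod E x = Dom E p1" "Cod E y = Dom E p1" "t \<cdot> x = s \<cdot> y" for x y
    using that sx by metis+
  have mul_eq: "F1 f \<cdot> mul X (p1 \<cdot> x) (p1 \<cdot> y) = F1 a \<cdot> mul A (q1 \<cdot> x) (q1 \<cdot> y)"
    if "x \<in> Arr E" "y \<in> Arr E" "Cod E x = Dom E p1" "Cod E y = Dom E p1" "t \<cdot> x = s \<cdot> y" for x y
    using that comp [OF that] f a dom d1(1-5) icat sq1 by simp
  define m where "m = pairing E p1 q1 (mul X (p1 \<cdot> p2) (p1 \<cdot> q2)) (mul A (q1 \<cdot> p2) (q1 \<cdot> q2))"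
  have m: "m \<in> Arr E" "Dom E m = Dom E p2" "Cod E m = Dom E p1"
      "p1 \<cdot> m = mul X (p1 \<cdot> p2) (p1 \<cdot> q2)" "q1 \<cdot> m = mul A (q1 \<cdot> p2) (q1 \<cdot> q2)"
    unfolding m_def
    using pairing_props [OF pb1, of "mul X (p1 \<cdot> p2) (p1 \<cdot> q2)" "mul A (q1 \<cdot> p2) (q1 \<cdot> q2)"]
      comp [of p2 q2] mul_eq [of p2 q2] d1(1-5) d2 f a dom icat by simp_all
  define P where "P = \<lparr>ob0 = Dom E p0, ob1 = Dom E p1, ob2 = Dom E p2, src = s, tgt = t, unit = u,
    fst_arr = p2, snd_arr = q2, icomp = m\<rparr>"
  have P: "ob0 P = Dom E p0" "ob1 P = Dom E p1" "ob2 P = Dom E p2" "src P = s" "tgt P = t" "unit P = u"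
    "fst_arr P = p2" "snd_arr P = q2" "icomp P = m"
    by (simp_all add: P_def)
  have mulP: "mul P x y \<in> Arr E" "Dom E (mul P x y) = Dom E x" "Cod E (mul P x y) = Dom E p1"
    "p1 \<cdot> mul P x y = mul X (p1 \<cdot> x) (p1 \<cdot> y)" "q1 \<cdot> mul P x y = mul A (q1 \<cdot> x) (q1 \<cdot> y)"
    if xy: "x \<in> Arr E" "y \<in> Arr E" "Cod E x = Dom E p1" "Cod E y = Dom E p1" "t \<cdot> x = s \<cdot> y" for x y
  proof -
    have w: "pairing E p2 q2 x y \<in> Arr E" "Dom E (pairing E p2 q2 x y) = Dom E x"
      "Cod E (pairing E p2 q2 x y) = Dom E p2" "p2 \<cdot> pairing E p2 q2 x y = x" "q2 \<cdot> pairing E p2 q2 x y = y"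
      using pairing_props [OF pb2, of x y] xy s t by simp_all
    show "mul P x y \<in> Arr E" "Dom E (mul P x y) = Dom E x" "Cod E (mul P x y) = Dom E p1"
      using w m by (simp_all add: mul_def P)
    have "p1 \<cdot> mul P x y = mul X (p1 \<cdot> p2) (p1 \<cdot> q2) \<cdot> pairing E p2 q2 x y"
      "q1 \<cdot> mul P x y = mul A (q1 \<cdot> p2) (q1 \<cdot> q2) \<cdot> pairing E p2 q2 x y"
      unfolding mul_def [of P] P using w m d1 Cmp_reassoc [OF m(4)] Cmp_reassoc [OF m(5)] by simp_all
    then show "p1 \<cdot> mul P x y = mul X (p1 \<cdot> x) (p1 \<cdot> y)" "q1 \<cdot> mul P x y = mul A (q1 \<cdot> x) (q1 \<cdot> y)"
      using w comp [of p2 q2] d1 d2 icat by simp_all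
  qed
  have st_mul: "s \<cdot> mul P x y = s \<cdot> x" "t \<cdot> mul P x y = t \<cdot> y"
    if xy: "x \<in> Arr E" "y \<in> Arr E" "Cod E x = Dom E p1" "Cod E y = Dom E p1" "t \<cdot> x = s \<cdot> y" for x y
    by (rule eq0; use xy mulP [OF xy] comp [OF xy] s t d0 d1 icat sx in simp)+
  have st_unit: "s \<cdot> u = Idn E (Dom E p0)" "t \<cdot> u = Idn E (Dom E p0)"
    by (rule eq0; use s t d0 d1 u icat sx in simp)+
  have st_unit': "s \<cdot> u \<cdot> x = x" "t \<cdot> u \<cdot> x = x" if "x \<in> Arr E" "Cod E x = Dom E p0" for x
    using Cmp_reassoc [OF st_unit(1), of x] Cmp_reassoc [OF st_unit(2), of x] that s t u d0 by simp_all
  have P_icat: "internal_category E P"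
  proof (rule internal_categoryI)
    show "is_pullback E (tgt P) (src P) (fst_arr P) (snd_arr P)"
      using pb2 P by simp
    have m2: "m = mul P p2 q2"
      using icomp_Cmp [of P "Idn E (Dom E p2)"] pb2 d2 m by (simp add: P)
    show "src P \<cdot> icomp P = src P \<cdot> fst_arr P" "tgt P \<cdot> icomp P = tgt P \<cdot> snd_arr P"
      unfolding P m2 using st_mul d2 by simp_all
    show "mul P (unit P \<cdot> src P) (Idn E (ob1 P)) = Idn E (ob1 P)"
      unfolding P by (rule eq1) (use mulP st_unit' s t d0 d1 u ux icat in simp_all)
    show "mul P (Idn E (ob1 P)) (unit P \<cdot> tgt P) = Idn E (ob1 P)"
      unfolding P by (rule eq1) (use mulP st_unit' s t d0 d1 u ux icat in simp_all)
  next
    fix x y z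
    assume xyz: "x \<in> Arr E" "y \<in> Arr E" "z \<in> Arr E" "Cod E x = ob1 P" "Cod E y = ob1 P" "Cod E z = ob1 P"
      "Dom E y = Dom E x" "Dom E z = Dom E x" "tgt P \<cdot> x = src P \<cdot> y" "tgt P \<cdot> y = src P \<cdot> z"
    show "mul P (mul P x y) z = mul P x (mul P y z)"
      by (rule eq1)
        (use xyz mulP st_mul comp [of x y] comp [of y z] d1 icat in \<open>simp_all add: P\<close>)
  qed (use P s t u m d0 d1 d2 st_unit in \<open>simp_all add: hom_def\<close>)
  define p where "p = \<lparr>idom = P, icod = X, F0 = p0, F1 = p1\<rparr>"
  define q where "q = \<lparr>idom = P, icod = A, F0 = q0, F1 = q1\<rparr>"
  have p: "idom p = P" "icod p = X" "F0 p = p0" "F1 p = p1" and q: "idom q = P" "icod q = A" "F0 q = q0" "F1 q = q1"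
    by (simp_all add: p_def q_def)
  have p_fun: "internal_functor E p"
    by (rule internal_functorI) (use P_icat icat p P d0 d1 s t u mulP in simp_all)
  have q_fun: "internal_functor E q"
    by (rule internal_functorI) (use P_icat icat q P d0 d1 s t u mulP in simp_all)
  interpret Cat: category "Cat E"
    by (rule category_Cat)
  have "is_pullback (Cat E) f a p q"
  proof (rule Cat.is_pullbackI)
    show "f \<cdot>\<^bsub>Cat E\<^esub> p = a \<cdot>\<^bsub>Cat E\<^esub> q"
      using p q dom d0 d1 by (intro ifun_eqI) simp_all
  next
    fix h k
    assume *: "h \<in> Arr (Cat E)" "k \<in> Arr (Cat E)" "Dom (Cat E) h = Dom (Cat E) k" "Cod (Cat E) h = Dom (Cat E) f"
      "Cod (Cat E) k = Dom (Cat E) a" "f \<cdot>\<^bsub>Cat E\<^esub> h = a \<cdot>\<^bsub>Cat E\<^esub> k"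
    have hk: "internal_functor E h" "internal_functor E k" "idom k = idom h" "icod h = X" "icod k = A"
      "F0 f \<cdot> F0 h = F0 a \<cdot> F0 k" "F1 f \<cdot> F1 h = F1 a \<cdot> F1 k"
      using * dom Cat_Cmp_eqD [OF *(6)] by simp_all
    define T where "T = idom h"
    have T: "internal_category E T" "idom h = T" "idom k = T"
      using hk T_def by auto
    define w0 where "w0 = pairing E p0 q0 (F0 h) (F0 k)"
    define w1 where "w1 = pairing E p1 q1 (F1 h) (F1 k)"
    have w0: "w0 \<in> Arr E" "Dom E w0 = ob0 T" "Cod E w0 = Dom E p0" "p0 \<cdot> w0 = F0 h" "q0 \<cdot> w0 = F0 k"
      unfolding w0_def using pairing_props [OF pb0, of "F0 h" "F0 k"] hk T f a dom by simp_all
    have w1: "w1 \<in> Arr E" "Dom E w1 = ob1 T" "Cod E w1 = Dom E p1" "p1 \<cdot> w1 = F1 h" "q1 \<cdot> w1 = F1 k"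
      unfolding w1_def using pairing_props [OF pb1, of "F1 h" "F1 k"] hk T f a dom by simp_all
    have w0x: "p0 \<cdot> w0 \<cdot> x = F0 h \<cdot> x" "q0 \<cdot> w0 \<cdot> x = F0 k \<cdot> x" if "x \<in> Arr E" "Cod E x = ob0 T" for x
      using that w0 d0 Cmp_reassoc [OF w0(4), of x] Cmp_reassoc [OF w0(5), of x] by simp_all
    have w1x: "p1 \<cdot> w1 \<cdot> x = F1 h \<cdot> x" "q1 \<cdot> w1 \<cdot> x = F1 k \<cdot> x" if "x \<in> Arr E" "Cod E x = ob1 T" for x
      using that w1 d1 Cmp_reassoc [OF w1(4), of x] Cmp_reassoc [OF w1(5), of x] by simp_all
    have sw: "s \<cdot> w1 = w0 \<cdot> src T"
      by (rule eq0) (use w0 w1 w0x sx s d0 d1 T hk(1-5) in simp_all)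
    have tw: "t \<cdot> w1 = w0 \<cdot> tgt T"
      by (rule eq0) (use w0 w1 w0x sx t d0 d1 T hk(1-5) in simp_all)
    have uw: "w1 \<cdot> unit T = u \<cdot> w0"
      by (rule eq1) (use w0 w1 w1x ux u d0 d1 T hk(1-5) in simp_all)
    define w where "w = \<lparr>idom = T, icod = P, F0 = w0, F1 = w1\<rparr>"
    have w: "idom w = T" "icod w = P" "F0 w = w0" "F1 w = w1"
      by (simp_all add: w_def)
    have "internal_functor E w"
    proof (rule internal_functorI)
      fix x y
      assume "x \<in> Arr E" "y \<in> Arr E" "Cod E x = ob1 (idom w)" "Cod E y = ob1 (idom w)"
        "Dom E y = Dom E x" "tgt (idom w) \<cdot> x = src (idom w) \<cdot> y"
      then have xy: "x \<in> Arr E" "y \<in> Arr E" "Cod E x = ob1 T" "Cod E y = ob1 T" "Dom E y = Dom E x"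
        "tgt T \<cdot> x = src T \<cdot> y"
        using w by auto
      have tsxy: "t \<cdot> w1 \<cdot> x = s \<cdot> w1 \<cdot> y"
        using xy T s t w0 w1 Cmp_reassoc [OF sw, of y] Cmp_reassoc [OF tw, of x] by simp
      show "F1 w \<cdot> mul (idom w) x y = mul (icod w) (F1 w \<cdot> x) (F1 w \<cdot> y)"
        unfolding w
        by (rule eq1) (use xy tsxy T w1 w1x mulP hk(1-5) in simp_all)
    qed (use w w0 w1 T P P_icat sw tw uw in simp_all)
    moreover have "p \<cdot>\<^bsub>Cat E\<^esub> w = h" "q \<cdot>\<^bsub>Cat E\<^esub> w = k"
      using p q w w0 w1 hk T by (auto intro!: ifun_eqI)
    ultimately show "\<exists>w \<in> Arr (Cat E). Dom (Cat E) w = Dom (Cat E) h \<and> Cod (Cat E) w = Dom (Cat E) p \<and>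
        p \<cdot>\<^bsub>Cat E\<^esub> w = h \<and> q \<cdot>\<^bsub>Cat E\<^esub> w = k"
      using w p T by (intro bexI [of _ w]) simp_all
  next
    fix w w'
    assume *: "w \<in> Arr (Cat E)" "w' \<in> Arr (Cat E)" "Dom (Cat E) w = Dom (Cat E) w'"
      "Cod (Cat E) w = Dom (Cat E) p" "Cod (Cat E) w' = Dom (Cat E) p"
      "p \<cdot>\<^bsub>Cat E\<^esub> w = p \<cdot>\<^bsub>Cat E\<^esub> w'" "q \<cdot>\<^bsub>Cat E\<^esub> w = q \<cdot>\<^bsub>Cat E\<^esub> w'"
    then have "p0 \<cdot> F0 w = p0 \<cdot> F0 w'" "q0 \<cdot> F0 w = q0 \<cdot> F0 w'" "p1 \<cdot> F1 w = p1 \<cdot> F1 w'" "q1 \<cdot> F1 w = q1 \<cdot> F1 w'"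
      using p q Cat_Cmp_eqD [OF *(6)] Cat_Cmp_eqD [OF *(7)] by simp_all
    then have "F0 w = F0 w'" "F1 w = F1 w'"
      using * p P by (auto intro: eq0 eq1)
    then show "w = w'"
      using * by (intro ifun_eqI) simp_all
  qed (use f a p q dom p_fun q_fun in simp_all)
  then show ?thesis
    using pb0 pb1 p q by metis
qed

lemma inverse_functors:
  assumes "category.inverse_arrows (Cat E) w w'"
  shows "inverse_arrows (F0 w) (F0 w')" "inverse_arrows (F1 w) (F1 w')"
proof -
  interpret Cat: category "Cat E"
    by (rule category_Cat)
  note d = Cat.inverse_arrowsD [OF assms]
  show "inverse_arrows (F0 w) (F0 w')" "inverse_arrows (F1 w) (F1 w')"
    using d(1-4) arg_cong [OF d(5), of F0] arg_cong [OF d(5), of F1]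
      arg_cong [OF d(6), of F0] arg_cong [OF d(6), of F1]
    by (simp_all add: inverse_arrows_def)
qed

text \<open>No pullback in \<open>Cat E\<close> is distinguished, so a given one is compared with
  the componentwise one; the components of the comparison isomorphism are invertible, and reindexing
  by them keeps pullbacks in \<open>E\<close>.\<close>

lemma Cat_pullback_components:
  assumes pb: "is_pullback (Cat E) f a p q"
  shows "is_pullback E (F0 f) (F0 a) (F0 p) (F0 q)" "is_pullback E (F1 f) (F1 a) (F1 p) (F1 q)"
proof -
  interpret Cat: category "Cat E"
    by (rule category_Cat)
  note d = Cat.is_pullbackD [OF pb]
  obtain p' q' where pb': "is_pullback (Cat E) f a p' q'"
    "is_pullback E (F0 f) (F0 a) (F0 p') (F0 q')" "is_pullback E (F1 f) (F1 a) (F1 p') (F1 q')"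
    using Cat_pullback_exists [of f a] d by auto
  note d' = Cat.is_pullbackD [OF pb'(1)]
  obtain w w' where w: "Cat.inverse_arrows w w'" "Cod (Cat E) w = Dom (Cat E) p'"
    "p' \<cdot>\<^bsub>Cat E\<^esub> w = p" "q' \<cdot>\<^bsub>Cat E\<^esub> w = q"
    using Cat.pullback_unique_up_to_iso [OF pb'(1) pb] by metis
  have fw: "F0 p = F0 p' \<cdot> F0 w" "F0 q = F0 q' \<cdot> F0 w" "F1 p = F1 p' \<cdot> F1 w" "F1 q = F1 q' \<cdot> F1 w"
    using w by auto
  have "internal_functor E w"
    using Cat.inverse_arrowsD [OF w(1)] by simp
  then show "is_pullback E (F0 f) (F0 a) (F0 p) (F0 q)" "is_pullback E (F1 f) (F1 a) (F1 p) (F1 q)"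
    unfolding fw
    using is_pullback_inverse_arrows [OF pb'(2) inverse_functors(1) [OF w(1)]]
      is_pullback_inverse_arrows [OF pb'(3) inverse_functors(2) [OF w(1)]] w(2) d'
    by simp_all
qed

end


subsection \<open>Coequalisers of functors that agree on objects\<close>

context category
begin

text \<open>\<open>l, m, r\<close> exhibit their common domain as the object of triples \<open>(l, m, r)\<close> for which
  \<open>l\<close>, \<open>F m\<close>, \<open>r\<close> are composable.\<close>

definition is_context :: "('o, 'm) ifun \<Rightarrow> 'm \<Rightarrow> 'm \<Rightarrow> 'm \<Rightarrow> bool" where
  "is_context F l m r \<longleftrightarrow>
     l \<in> Arr C \<and> m \<in> Arr C \<and> r \<in> Arr C \<and> Dom C m = Dom C l \<and> Dom C r = Dom C l \<and>
     Cod C l = ob1 (icod F) \<and> Cod C m = ob1 (idom F) \<and> Cod C r = ob1 (icod F) \<and>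
     tgt (icod F) \<cdot> l = F0 F \<cdot> src (idom F) \<cdot> m \<and> src (icod F) \<cdot> r = F0 F \<cdot> tgt (idom F) \<cdot> m \<and>
     (\<forall>x y z. x \<in> Arr C \<and> y \<in> Arr C \<and> z \<in> Arr C \<and>
        Cod C x = ob1 (icod F) \<and> Cod C y = ob1 (idom F) \<and> Cod C z = ob1 (icod F) \<and>
        tgt (icod F) \<cdot> x = F0 F \<cdot> src (idom F) \<cdot> y \<and> src (icod F) \<cdot> z = F0 F \<cdot> tgt (idom F) \<cdot> y \<longrightarrow>
        (\<exists>!w. w \<in> Arr C \<and> Cod C w = Dom C l \<and> l \<cdot> w = x \<and> m \<cdot> w = y \<and> r \<cdot> w = z))"

definition whiskered :: "('o, 'm) ifun \<Rightarrow> 'm \<Rightarrow> 'm \<Rightarrow> 'm \<Rightarrow> 'm" where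
  "whiskered F l m r = mul (icod F) l (mul (icod F) (F1 F \<cdot> m) r)"

text \<open>The object of contexts is determined only up to isomorphism by its universal property,
  hence the existential quantifier. One context is used for both functors.\<close>

definition is_whiskered_coequaliser :: "('o, 'm) ifun \<Rightarrow> ('o, 'm) ifun \<Rightarrow> 'm \<Rightarrow> bool" where
  "is_whiskered_coequaliser F G q \<longleftrightarrow>
     (\<exists>l m r. is_context F l m r \<and> is_coequaliser C (whiskered F l m r) (whiskered G l m r) q)"

definition parallel :: "('o, 'm) ifun \<Rightarrow> ('o, 'm) ifun \<Rightarrow> bool" where
  "parallel F G \<longleftrightarrow> internal_functor C F \<and> internal_functor C G \<and> idom G = idom F \<and> icod G = icod F \<and>
     F0 G = F0 F"

lemma parallelD:
  assumes "parallel F G"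
  shows "internal_functor C F" "internal_functor C G" "idom G = idom F" "icod G = icod F" "F0 G = F0 F"
  using assms by (auto simp: parallel_def)

lemma is_contextD:
  assumes "is_context F l m r"
  shows "l \<in> Arr C" "m \<in> Arr C" "r \<in> Arr C" "Dom C m = Dom C l" "Dom C r = Dom C l"
    "Cod C l = ob1 (icod F)" "Cod C m = ob1 (idom F)" "Cod C r = ob1 (icod F)"
    "tgt (icod F) \<cdot> l = F0 F \<cdot> src (idom F) \<cdot> m" "src (icod F) \<cdot> r = F0 F \<cdot> tgt (idom F) \<cdot> m"
  using assms by (auto simp: is_context_def)

lemma is_context_ex1:
  assumes "is_context F l m r" "x \<in> Arr C" "y \<in> Arr C" "z \<in> Arr C"
    "Cod C x = ob1 (icod F)" "Cod C y = ob1 (idom F)" "Cod C z = ob1 (icod F)"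
    "tgt (icod F) \<cdot> x = F0 F \<cdot> src (idom F) \<cdot> y" "src (icod F) \<cdot> z = F0 F \<cdot> tgt (idom F) \<cdot> y"
  shows "\<exists>!w. w \<in> Arr C \<and> Cod C w = Dom C l \<and> l \<cdot> w = x \<and> m \<cdot> w = y \<and> r \<cdot> w = z"
  using assms unfolding is_context_def by blast

lemma is_context_obtain:
  assumes "is_context F l m r" "x \<in> Arr C" "y \<in> Arr C" "z \<in> Arr C"
    "Cod C x = ob1 (icod F)" "Cod C y = ob1 (idom F)" "Cod C z = ob1 (icod F)"
    "tgt (icod F) \<cdot> x = F0 F \<cdot> src (idom F) \<cdot> y" "src (icod F) \<cdot> z = F0 F \<cdot> tgt (idom F) \<cdot> y"
  obtains w where "w \<in> Arr C" "Dom C w = Dom C x" "Cod C w = Dom C l" "l \<cdot> w = x" "m \<cdot> w = y" "r \<cdot> w = z"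
proof -
  obtain w where w: "w \<in> Arr C" "Cod C w = Dom C l" "l \<cdot> w = x" "m \<cdot> w = y" "r \<cdot> w = z"
    using is_context_ex1 [OF assms] by blast
  moreover have "Dom C (l \<cdot> w) = Dom C w"
    using w(1,2) is_contextD(1) [OF assms(1)] by simp
  ultimately show thesis
    using that by simp
qed

lemma is_context_Cmp:
  assumes F: "internal_functor C F" and c: "is_context F l m r" and w: "w \<in> Arr C" "Cod C w = Dom C l"
  shows "tgt (icod F) \<cdot> l \<cdot> w = F0 F \<cdot> src (idom F) \<cdot> m \<cdot> w" "src (icod F) \<cdot> r \<cdot> w = F0 F \<cdot> tgt (idom F) \<cdot> m \<cdot> w"
  using F is_contextD [OF c] w Cmp_reassoc [OF is_contextD(9) [OF c], of w]
    Cmp_reassoc [OF is_contextD(10) [OF c], of w] by simp_all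

lemma is_context_eqI:
  assumes F: "internal_functor C F" and c: "is_context F l m r" and w: "w \<in> Arr C" "Cod C w = Dom C l"
    "w' \<in> Arr C" "Cod C w' = Dom C l" "l \<cdot> w = l \<cdot> w'" "m \<cdot> w = m \<cdot> w'" "r \<cdot> w = r \<cdot> w'"
  shows "w = w'"
proof -
  have "\<exists>!v. v \<in> Arr C \<and> Cod C v = Dom C l \<and> l \<cdot> v = l \<cdot> w \<and> m \<cdot> v = m \<cdot> w \<and> r \<cdot> v = r \<cdot> w"
    by (rule is_context_ex1 [OF c]) (use is_contextD(1-8) [OF c] w(1,2) is_context_Cmp [OF F c w(1,2)] in simp_all)
  then show ?thesis
    using w by metis
qed

text \<open>A context involves \<open>F\<close> through its object part and not through
  \<open>F1 F\<close>; this is how agreement on objects lets \<open>F\<close> and \<open>G\<close>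
  share one object of contexts.\<close>

lemma is_context_cong:
  "\<lbrakk>idom G = idom F; icod G = icod F; F0 G = F0 F\<rbrakk> \<Longrightarrow> is_context G = is_context F"
  by (intro ext) (simp add: is_context_def)

lemma whiskered_simps:
  assumes F: "internal_functor C F" and c: "is_context F l m r"
  shows "whiskered F l m r \<in> Arr C" "Dom C (whiskered F l m r) = Dom C l"
    "Cod C (whiskered F l m r) = ob1 (icod F)"
    "src (icod F) \<cdot> whiskered F l m r = src (icod F) \<cdot> l"
    "tgt (icod F) \<cdot> whiskered F l m r = tgt (icod F) \<cdot> r"
  using F is_contextD [OF c] unfolding whiskered_def by simp_all

lemma whiskered_Cmp:
  assumes F: "internal_functor C F" and c: "is_context F l m r" and w: "w \<in> Arr C" "Cod C w = Dom C l"
  shows "whiskered F l m r \<cdot> w = mul (icod F) (l \<cdot> w) (mul (icod F) (F1 F \<cdot> m \<cdot> w) (r \<cdot> w))"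
  using F is_contextD [OF c] w unfolding whiskered_def by simp

end

section \<open>Existence of contexts, and representatives along a common epimorphism\<close>

context stable_category
begin

text \<open>Two successive pullbacks: \<open>lm\<close> pairs \<open>l\<close> with
  \<open>m\<close>, and \<open>kr\<close> adjoins \<open>r\<close> at the target of
  \<open>m\<close>. Hence the first two legs become \<open>l \<cdot> k\<close> and
  \<open>m \<cdot> k\<close>.\<close>

lemma is_context_exists:
  assumes F: "internal_functor E F"
  obtains l m r where "is_context F l m r"
proof -
  obtain A B where AB: "internal_category E A" "internal_category E B" "idom F = A" "icod F = B"
    using F ifun_simps(1,2) by metis
  obtain l m where lm: "is_pullback E (tgt B) (F0 F \<cdot> src A) l m"
    using pullback_obtain [of "tgt B" "F0 F \<cdot> src A"] F AB by auto
  have d: "l \<in> Arr E" "m \<in> Arr E" "Dom E m = Dom E l" "Cod E l = ob1 B" "Cod E m = ob1 A"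
    "tgt B \<cdot> l = F0 F \<cdot> src A \<cdot> m"
    using is_pullbackD [OF lm] F AB by simp_all
  obtain k r where kr: "is_pullback E (F0 F \<cdot> tgt A \<cdot> m) (src B) k r"
    using pullback_obtain [of "F0 F \<cdot> tgt A \<cdot> m" "src B"] F AB d by auto
  have d': "k \<in> Arr E" "r \<in> Arr E" "Dom E r = Dom E k" "Cod E k = Dom E l" "Cod E r = ob1 B"
    "F0 F \<cdot> tgt A \<cdot> m \<cdot> k = src B \<cdot> r"
    using is_pullbackD [OF kr] F AB d by simp_all
  have "is_context F (l \<cdot> k) (m \<cdot> k) r"
    unfolding is_context_def AB
  proof (intro conjI allI impI)
    fix x y z
    assume "x \<in> Arr E \<and> y \<in> Arr E \<and> z \<in> Arr E \<and> Cod E x = ob1 B \<and> Cod E y = ob1 A \<and> Cod E z = ob1 B \<and>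
      tgt B \<cdot> x = F0 F \<cdot> src A \<cdot> y \<and> src B \<cdot> z = F0 F \<cdot> tgt A \<cdot> y"
    then have xyz: "x \<in> Arr E" "y \<in> Arr E" "z \<in> Arr E" "Cod E x = ob1 B" "Cod E y = ob1 A" "Cod E z = ob1 B"
      "tgt B \<cdot> x = F0 F \<cdot> src A \<cdot> y" "F0 F \<cdot> tgt A \<cdot> y = src B \<cdot> z"
      by auto
    define v where "v = pairing E l m x y"
    have v: "v \<in> Arr E" "Dom E v = Dom E x" "Cod E v = Dom E l" "l \<cdot> v = x" "m \<cdot> v = y"
      unfolding v_def using pairing_props [OF lm, of x y] xyz F AB by simp_all
    define w where "w = pairing E k r v z"
    have w: "w \<in> Arr E" "Dom E w = Dom E v" "Cod E w = Dom E k" "k \<cdot> w = v" "r \<cdot> w = z"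
      unfolding w_def using pairing_props [OF kr, of v z] xyz F AB d v by simp_all
    show "\<exists>!w. w \<in> Arr E \<and> Cod E w = Dom E (l \<cdot> k) \<and> (l \<cdot> k) \<cdot> w = x \<and> (m \<cdot> k) \<cdot> w = y \<and> r \<cdot> w = z"
    proof (rule ex1I [of _ w])
      show "w \<in> Arr E \<and> Cod E w = Dom E (l \<cdot> k) \<and> (l \<cdot> k) \<cdot> w = x \<and> (m \<cdot> k) \<cdot> w = y \<and> r \<cdot> w = z"
        using w v d d' by simp
      fix w'
      assume "w' \<in> Arr E \<and> Cod E w' = Dom E (l \<cdot> k) \<and> (l \<cdot> k) \<cdot> w' = x \<and> (m \<cdot> k) \<cdot> w' = y \<and> r \<cdot> w' = z"
      then have w': "w' \<in> Arr E" "Cod E w' = Dom E k" "l \<cdot> k \<cdot> w' = x" "m \<cdot> k \<cdot> w' = y" "r \<cdot> w' = z"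
        using d d' by auto
      have "k \<cdot> w' = v"
        by (rule pullback_eqI [OF lm]) (use w' v d d' in simp_all)
      then show "w' = w"
        using w' w pullback_eqI [OF kr, of w' w] by simp
    qed
  next
    show "tgt B \<cdot> l \<cdot> k = F0 F \<cdot> src A \<cdot> m \<cdot> k"
      using Cmp_reassoc [OF d(6), of k] F AB d d' by simp
  qed (use d d' in simp_all)
  then show thesis
    using that by blast
qed

text \<open>Representatives of two classes would live over different epimorphisms. The second class
  is first restricted along the epimorphism of the first, so that the composite serves both.\<close>

lemma coequaliser_lift2:
  assumes q: "is_coequaliser E h k q" and x: "x \<in> Arr E" "Cod E x = Cod E q"
    and y: "y \<in> Arr E" "Cod E y = Cod E q" "Dom E y = Dom E x"
  obtains e x' y' where "epi e" "Cod E e = Dom E x" "x' \<in> Arr E" "Dom E x' = Dom E e" "Cod E x' = Dom E q"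
    "q \<cdot> x' = x \<cdot> e" "y' \<in> Arr E" "Dom E y' = Dom E e" "Cod E y' = Dom E q" "q \<cdot> y' = y \<cdot> e"
proof -
  note q' = is_coequaliserD [OF q]
  obtain e x' where e: "epi e" "Cod E e = Dom E x" "x' \<in> Arr E" "Dom E x' = Dom E e" "Cod E x' = Dom E q"
    "q \<cdot> x' = x \<cdot> e"
    using coequaliser_lift [OF q x] by metis
  note [simp] = epi_Arr [OF e(1)]
  obtain d y' where d: "epi d" "Cod E d = Dom E (y \<cdot> e)" "y' \<in> Arr E" "Dom E y' = Dom E d" "Cod E y' = Dom E q"
    "q \<cdot> y' = (y \<cdot> e) \<cdot> d"
    using coequaliser_lift [OF q, of "y \<cdot> e"] y e by auto
  note [simp] = epi_Arr [OF d(1)]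
  show thesis
  proof (rule that [of "e \<cdot> d" "x' \<cdot> d" y'])
    show "epi (e \<cdot> d)"
      using epi_Cmp e d y by simp
    show "q \<cdot> x' \<cdot> d = x \<cdot> e \<cdot> d"
      using Cmp_reassoc [OF e(6), of d] q' e d x y by simp
  qed (use e d x y in simp_all)
qed

lemma coequaliser_lift3:
  assumes q: "is_coequaliser E h k q" and x: "x \<in> Arr E" "Cod E x = Cod E q"
    and y: "y \<in> Arr E" "Cod E y = Cod E q" "Dom E y = Dom E x"
    and z: "z \<in> Arr E" "Cod E z = Cod E q" "Dom E z = Dom E x"
  obtains e x' y' z' where "epi e" "Cod E e = Dom E x" "x' \<in> Arr E" "Dom E x' = Dom E e" "Cod E x' = Dom E q"
    "q \<cdot> x' = x \<cdot> e" "y' \<in> Arr E" "Dom E y' = Dom E e" "Cod E y' = Dom E q" "q \<cdot> y' = y \<cdot> e"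
    "z' \<in> Arr E" "Dom E z' = Dom E e" "Cod E z' = Dom E q" "q \<cdot> z' = z \<cdot> e"
proof -
  note q' = is_coequaliserD [OF q]
  obtain e x' y' where e: "epi e" "Cod E e = Dom E x" "x' \<in> Arr E" "Dom E x' = Dom E e" "Cod E x' = Dom E q"
    "q \<cdot> x' = x \<cdot> e" "y' \<in> Arr E" "Dom E y' = Dom E e" "Cod E y' = Dom E q" "q \<cdot> y' = y \<cdot> e"
    using coequaliser_lift2 [OF q x y] by metis
  note [simp] = epi_Arr [OF e(1)]
  obtain d z' where d: "epi d" "Cod E d = Dom E (z \<cdot> e)" "z' \<in> Arr E" "Dom E z' = Dom E d" "Cod E z' = Dom E q"
    "q \<cdot> z' = (z \<cdot> e) \<cdot> d"
    using coequaliser_lift [OF q, of "z \<cdot> e"] z e by auto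
  note [simp] = epi_Arr [OF d(1)]
  show thesis
  proof (rule that [of "e \<cdot> d" "x' \<cdot> d" "y' \<cdot> d" z'])
    show "epi (e \<cdot> d)"
      using epi_Cmp e d z by simp
    show "q \<cdot> x' \<cdot> d = x \<cdot> e \<cdot> d" "q \<cdot> y' \<cdot> d = y \<cdot> e \<cdot> d"
      using Cmp_reassoc [OF e(6), of d] Cmp_reassoc [OF e(10), of d] q' e d x y z by simp_all
  qed (use e d x y z in simp_all)
qed

section \<open>Recognition of coequalisers in \<open>Cat E\<close>\<close>

lemma whiskered_coequaliser_equalises:
  assumes FG: "parallel F G" and q: "is_whiskered_coequaliser F G q"
  shows "q \<cdot> F1 F = q \<cdot> F1 G"
proof -
  obtain A B where AB: "internal_category E A" "internal_category E B" "idom F = A" "icod F = B"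
    using parallelD(1) [OF FG] ifun_simps(1,2) by metis
  note p = parallelD [OF FG]
  obtain l m r where c: "is_context F l m r" and q': "is_coequaliser E (whiskered F l m r) (whiskered G l m r) q"
    using q by (auto simp: is_whiskered_coequaliser_def)
  note qd = is_coequaliserD [OF q']
  have c': "is_context G l m r"
    using c is_context_cong p by metis
  \<comment> \<open>Identities on both sides: the context \<open>(1, m, 1)\<close> of every arrow
    \<open>m\<close> turns the whiskered arrows back into \<open>F1 F\<close> and
    \<open>F1 G\<close>.\<close>
  obtain w where w: "w \<in> Arr E" "Cod E w = Dom E l" "l \<cdot> w = unit B \<cdot> F0 F \<cdot> src A" "m \<cdot> w = Idn E (ob1 A)"
    "r \<cdot> w = unit B \<cdot> F0 F \<cdot> tgt A"
    using is_context_obtain [OF c, of "unit B \<cdot> F0 F \<cdot> src A" "Idn E (ob1 A)" "unit B \<cdot> F0 F \<cdot> tgt A"] p AB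
    by auto
  have "whiskered F l m r \<cdot> w = F1 F" "whiskered G l m r \<cdot> w = F1 G"
    using whiskered_Cmp [OF p(1) c w(1,2)] whiskered_Cmp [OF p(2) c' w(1,2)] w p AB by simp_all
  then show ?thesis
    using whiskered_simps [OF p(1) c] whiskered_simps [OF p(2) c'] qd w(1,2) p
      Cmp_assoc' [of w "whiskered F l m r" q] Cmp_assoc' [of w "whiskered G l m r" q] by simp
qed

text \<open>A functor that equalises \<open>F\<close> and \<open>G\<close> equalises all whiskered
  triples, so it factors on arrows through \<open>F1 Q\<close>, and on objects through the inverse
  of \<open>F0 Q\<close>. A transformation consists of components on objects, which are transported
  along that inverse.\<close>

lemma Cat_coequaliserI:
  assumes FG: "parallel F G" and Q: "internal_functor E Q" "idom Q = icod F"
    and Q0: "inverse_arrows (F0 Q) Q0'" and Q1: "is_whiskered_coequaliser F G (F1 Q)"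
  shows "is_Cat_coequaliser E F G Q"
proof -
  note p = parallelD [OF FG]
  define A where "A = idom F"
  define B where "B = icod F"
  define C where "C = icod Q"
  have ic: "internal_category E A" "internal_category E B" "internal_category E C"
    "idom F = A" "icod F = B" "idom G = A" "icod G = B" "idom Q = B" "icod Q = C"
    using p Q by (simp_all add: A_def B_def C_def)
  note p = p(1,2,5)
  interpret Cat: category "Cat E"
    by (rule category_Cat)
  obtain l m r where c: "is_context F l m r" and q: "is_coequaliser E (whiskered F l m r) (whiskered G l m r) (F1 Q)"
    using Q1 by (auto simp: is_whiskered_coequaliser_def)
  have c': "is_context G l m r"
    using c is_context_cong p ic by metis
  note d = is_contextD [OF c, unfolded ic]
  note epiQ1 = coequaliser_epi [OF q]
  have Q0': "Q0' \<in> Arr E" "Dom E Q0' = ob0 C" "Cod E Q0' = ob0 B" "Q0' \<cdot> F0 Q = Idn E (ob0 B)"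
      "F0 Q \<cdot> Q0' = Idn E (ob0 C)"
    using inverse_arrowsD [OF Q0] Q ic by simp_all
  have Q0'x: "Q0' \<cdot> F0 Q \<cdot> x = x" if "x \<in> Arr E" "Cod E x = ob0 B" for x
    using inverse_arrows_cancel [OF Q0] that Q ic by simp
  have Q0_epi: "g = h" if "g \<cdot> F0 Q = h \<cdot> F0 Q" "g \<in> Arr E" "h \<in> Arr E" "Dom E g = ob0 C" "Dom E h = ob0 C" for g h
  proof -
    have "(g \<cdot> F0 Q) \<cdot> Q0' = (h \<cdot> F0 Q) \<cdot> Q0'"
      using that(1) by simp
    then show ?thesis
      using that(2-) Q(1) Q0' ic by simp
  qed
  have "is_coequaliser (Cat E) F G Q"
  proof (rule Cat.is_coequaliserI)
    show "Q \<cdot>\<^bsub>Cat E\<^esub> F = Q \<cdot>\<^bsub>Cat E\<^esub> G"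
      using whiskered_coequaliser_equalises [OF FG Q1] p ic by (intro ifun_eqI) simp_all
    show "Cat.epi Q"
      unfolding Cat.epi_def
    proof (intro conjI ballI impI)
      fix H K
      assume "H \<in> Arr (Cat E)" "K \<in> Arr (Cat E)" and
        *: "Dom (Cat E) H = Cod (Cat E) Q \<and> Dom (Cat E) K = Cod (Cat E) Q \<and> H \<cdot>\<^bsub>Cat E\<^esub> Q = K \<cdot>\<^bsub>Cat E\<^esub> Q"
      then have HK: "internal_functor E H" "internal_functor E K" "idom H = C" "idom K = C" 
        and eq: "H \<cdot>\<^bsub>Cat E\<^esub> Q = K \<cdot>\<^bsub>Cat E\<^esub> Q"
        using ic by simp_all
      have "icod H = icod K"
        using arg_cong [OF eq, of icod] by simp
      have "F0 H = F0 K"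
        by (rule Q0_epi [OF Cat_Cmp_eqD(1) [OF eq]]) (use HK in simp_all)
      moreover have "F1 H = F1 K"
        by (rule epiD [OF epiQ1 Cat_Cmp_eqD(2) [OF eq]]) (use HK Q ic in simp_all)
      ultimately show "H = K"
        using HK \<open>icod H = icod K\<close> by (intro ifun_eqI) simp_all
    qed (use Q in simp)
  next
    fix H
    assume *: "H \<in> Arr (Cat E)" "Dom (Cat E) H = Cod (Cat E) G" "H \<cdot>\<^bsub>Cat E\<^esub> F = H \<cdot>\<^bsub>Cat E\<^esub> G"
    define D where "D = icod H"
    have H: "internal_functor E H" "idom H = B" "icod H = D" "internal_category E D"
      and HF: "F1 H \<cdot> F1 F = F1 H \<cdot> F1 G"
      using * ic Cat_Cmp_eqD(2) [OF *(3)] by (auto simp: D_def)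
    have "F1 H \<cdot> F1 F \<cdot> m = F1 H \<cdot> F1 G \<cdot> m"
      using Cmp_reassoc [OF HF, of m] H p ic d by simp
    then have "F1 H \<cdot> whiskered F l m r = F1 H \<cdot> whiskered G l m r"
      using H p ic d by (simp add: whiskered_def)
    then obtain K1 where K1: "K1 \<in> Arr E" "Dom E K1 = ob1 C" "Cod E K1 = ob1 D" "K1 \<cdot> F1 Q = F1 H"
      using coequaliser_ex [OF q, of "F1 H"] H whiskered_simps [OF p(2) c'] ic Q by auto
    have K1x: "K1 \<cdot> F1 Q \<cdot> x = F1 H \<cdot> x" if "x \<in> Arr E" "Cod E x = ob1 B" for x
      using Cmp_reassoc [OF K1(4), of x] that K1 Q ic by simp
    define K where "K = \<lparr>idom = C, icod = D, F0 = F0 H \<cdot> Q0', F1 = K1\<rparr>"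
    have K: "idom K = C" "icod K = D" "F0 K = F0 H \<cdot> Q0'" "F1 K = K1"
      by (simp_all add: K_def)
    have "internal_functor E K"
    proof (rule internal_functorI)
      show "src (icod K) \<cdot> F1 K = F0 K \<cdot> src (idom K)"
        unfolding K by (rule epiD [OF epiQ1]) (use K1 H Q ic Q0' Q0'x in simp_all)
      show "tgt (icod K) \<cdot> F1 K = F0 K \<cdot> tgt (idom K)"
        unfolding K by (rule epiD [OF epiQ1]) (use K1 H Q ic Q0' Q0'x in simp_all)
      \<comment> \<open>Units start at objects, so this law is tested after \<open>F0 Q\<close> and
        not after \<open>F1 Q\<close>.\<close>
      have "K1 \<cdot> unit C \<cdot> F0 Q = F1 H \<cdot> unit B"
        using K1x [of "unit B"] Q ic by simp
      then have "(K1 \<cdot> unit C) \<cdot> F0 Q = (unit D \<cdot> F0 H \<cdot> Q0') \<cdot> F0 Q"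
        using K1 K1x H Q ic Q0' by simp
      then show "F1 K \<cdot> unit (idom K) = unit (icod K) \<cdot> F0 K"
        unfolding K by (rule Q0_epi) (use K1 H Q ic Q0' in simp_all)
    next
      fix x y
      assume "x \<in> Arr E" "y \<in> Arr E" "Cod E x = ob1 (idom K)" "Cod E y = ob1 (idom K)" "Dom E y = Dom E x"
        "tgt (idom K) \<cdot> x = src (idom K) \<cdot> y"
      then have xy: "x \<in> Arr E" "y \<in> Arr E" "Cod E x = ob1 C" "Cod E y = ob1 C" "Dom E y = Dom E x"
        "tgt C \<cdot> x = src C \<cdot> y"
        using K by auto
      obtain e x' y' where e: "epi e" "Cod E e = Dom E x" "x' \<in> Arr E" "Dom E x' = Dom E e" "Cod E x' = ob1 B"
          "F1 Q \<cdot> x' = x \<cdot> e" "y' \<in> Arr E" "Dom E y' = Dom E e" "Cod E y' = ob1 B" "F1 Q \<cdot> y' = y \<cdot> e"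
        using coequaliser_lift2 [OF q, of x y] xy Q ic by auto
      note ee = epi_Arr [OF e(1)]
      \<comment> \<open>The representatives are composable in \<open>B\<close>: the target of
        \<open>x'\<close> and the source of \<open>y'\<close> agree after \<open>F0 Q\<close>, which
        is invertible.\<close>
      have "F0 Q \<cdot> tgt B \<cdot> x' = tgt C \<cdot> F1 Q \<cdot> x'" "F0 Q \<cdot> src B \<cdot> y' = src C \<cdot> F1 Q \<cdot> y'"
        using e(3-5,7-9) Q(1) ic by simp_all
      moreover have "tgt C \<cdot> x \<cdot> e = src C \<cdot> y \<cdot> e"
        using Cmp_reassoc [OF xy(6), of e] xy(1-5) ee e(2) ic by simp
      ultimately have "F0 Q \<cdot> tgt B \<cdot> x' = F0 Q \<cdot> src B \<cdot> y'"
        using e by simp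
      then have xy': "tgt B \<cdot> x' = src B \<cdot> y'"
        using Q0'x e ic by (metis Cmp_Arr Cod_Cmp icat_simps(4-9))
      have K1': "K1 \<cdot> x \<cdot> e = F1 H \<cdot> x'" "K1 \<cdot> y \<cdot> e = F1 H \<cdot> y'"
        using K1x [of x'] K1x [of y'] e by simp_all
      have "mul C x y \<cdot> e = F1 Q \<cdot> mul B x' y'"
        using xy xy' e ee Q ic by simp
      then have "K1 \<cdot> mul C x y \<cdot> e = mul D (F1 H \<cdot> x') (F1 H \<cdot> y')"
        using K1x [of "mul B x' y'"] xy' e H ic by simp
      \<comment> \<open>Composability of the images must be known before the composite in
        \<open>D\<close> can be restricted along \<open>e\<close>.\<close>
      moreover have "tgt D \<cdot> K1 \<cdot> x = src D \<cdot> K1 \<cdot> y"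
      proof (rule epiD [OF e(1)])
        show "(tgt D \<cdot> K1 \<cdot> x) \<cdot> e = (src D \<cdot> K1 \<cdot> y) \<cdot> e"
          using K1' K1 xy xy' e ee H ic by simp
      qed (use xy K1 e H in simp_all)
      ultimately show "F1 K \<cdot> mul (idom K) x y = mul (icod K) (F1 K \<cdot> x) (F1 K \<cdot> y)"
        unfolding K using K1' xy e ee K1 H ic
        by (intro epiD [OF e(1), of "K1 \<cdot> mul C x y" "mul D (K1 \<cdot> x) (K1 \<cdot> y)"]) simp_all
    qed (use K ic H Q0' K1 in simp_all)
    moreover have "K \<cdot>\<^bsub>Cat E\<^esub> Q = H"
      using K K1 Q0' H Q ic by (intro ifun_eqI) simp_all
    ultimately show "\<exists>K \<in> Arr (Cat E). Dom (Cat E) K = Cod (Cat E) Q \<and> Cod (Cat E) K = Cod (Cat E) H \<and> K \<cdot>\<^bsub>Cat E\<^esub> Q = H"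
      using K H ic by (intro bexI [of _ K]) simp_all
  qed (use p Q ic in simp_all)
  moreover have "\<exists>!\<beta>. \<beta> \<in> nat_transs E H K \<and> whisker E \<beta> Q = \<alpha>"
    if hk: "H \<in> hom (Cat E) (icod Q) D" "K \<in> hom (Cat E) (icod Q) D"
      and \<alpha>: "\<alpha> \<in> nat_transs E (H \<cdot>\<^bsub>Cat E\<^esub> Q) (K \<cdot>\<^bsub>Cat E\<^esub> Q)" for D H K \<alpha>
  proof -
    have HK: "internal_functor E H" "internal_functor E K" "idom H = C" "idom K = C" "icod H = D" "icod K = D"
      using hk ic by (auto simp: hom_def)
    then have D: "internal_category E D"
      by auto
    have n: "nsrc \<alpha> = H \<cdot>\<^bsub>Cat E\<^esub> Q" "ntgt \<alpha> = K \<cdot>\<^bsub>Cat E\<^esub> Q" "internal_nat_trans E \<alpha>"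
      using \<alpha> by (auto simp: nat_transs_def)
    define a where "a = component \<alpha>"
    have a: "a \<in> Arr E" "Dom E a = ob0 B" "Cod E a = ob1 D" "src D \<cdot> a = F0 H \<cdot> F0 Q" "tgt D \<cdot> a = F0 K \<cdot> F0 Q"
      using internal_nat_trans.component [OF n(3)] internal_nat_trans.src_component [OF n(3)]
        internal_nat_trans.tgt_component [OF n(3)] n HK ic by (auto simp: hom_def a_def)
    have nat: "mul D (a \<cdot> src B) (F1 K \<cdot> F1 Q) = mul D (F1 H \<cdot> F1 Q) (a \<cdot> tgt B)"
      using internal_nat_trans.naturality [OF n(3)] n HK ic by (simp add: mul_def a_def)
    have ax: "src D \<cdot> a \<cdot> x = F0 H \<cdot> F0 Q \<cdot> x" "tgt D \<cdot> a \<cdot> x = F0 K \<cdot> F0 Q \<cdot> x"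
      if "x \<in> Arr E" "Cod E x = ob0 B" for x
      using Cmp_reassoc [OF a(4), of x] Cmp_reassoc [OF a(5), of x] a(1-3) that D HK Q ic by simp_all
    \<comment> \<open>The component must satisfy \<open>b \<cdot> F0 Q = a\<close>, which forces
      this choice.\<close>
    define b where "b = a \<cdot> Q0'"
    have b: "b \<in> Arr E" "Dom E b = ob0 C" "Cod E b = ob1 D" "src D \<cdot> b = F0 H" "tgt D \<cdot> b = F0 K" "b \<cdot> F0 Q = a"
      unfolding b_def using a(1-3) ax Q0' HK D Q ic by simp_all
    have bx: "src D \<cdot> b \<cdot> x = F0 H \<cdot> x" "tgt D \<cdot> b \<cdot> x = F0 K \<cdot> x" if "x \<in> Arr E" "Cod E x = ob0 C" for x
      using Cmp_reassoc [OF b(4), of x] Cmp_reassoc [OF b(5), of x] b(1-3) that D HK Q ic by simp_all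
    have bQ: "b \<cdot> F0 Q \<cdot> x = a \<cdot> x" if "x \<in> Arr E" "Cod E x = ob0 B" for x
      using Cmp_reassoc [OF b(6), of x] b(1-3) that D HK Q ic by simp
    have natb: "mul D (b \<cdot> src C) (F1 K) = mul D (F1 H) (b \<cdot> tgt C)"
      by (rule epiD [OF epiQ1]) (use b bx bQ nat HK D Q ic in simp_all)
    define \<beta> where "\<beta> = \<lparr>nsrc = H, ntgt = K, component = b\<rparr>"
    have \<beta>: "nsrc \<beta> = H" "ntgt \<beta> = K" "component \<beta> = b"
      by (simp_all add: \<beta>_def)
    show ?thesis
    proof (rule ex1I [of _ \<beta>])
      have "internal_nat_trans E \<beta>"
        by (rule internal_nat_trans.intro) (use \<beta> HK b natb in \<open>simp_all add: hom_def mul_def\<close>)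
      moreover have "whisker E \<beta> Q = \<alpha>"
        using \<beta> n b by (cases \<alpha>) (simp add: whisker_def a_def)
      ultimately show "\<beta> \<in> nat_transs E H K \<and> whisker E \<beta> Q = \<alpha>"
        using \<beta> by (simp add: nat_transs_def)
      fix \<gamma>
      assume g: "\<gamma> \<in> nat_transs E H K \<and> whisker E \<gamma> Q = \<alpha>"
      then have g': "nsrc \<gamma> = H" "ntgt \<gamma> = K" "internal_nat_trans E \<gamma>" "component \<gamma> \<cdot> F0 Q = a"
        by (auto simp: nat_transs_def whisker_def a_def)
      then have "component \<gamma> \<in> Arr E" "Dom E (component \<gamma>) = ob0 C"
        using internal_nat_trans.component [OF g'(3)] HK by (auto simp: hom_def)
      then have "component \<gamma> = b"
        using g'(4) b Q0_epi [of "component \<gamma>" b] by simp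
      then show "\<gamma> = \<beta>"
        using g' by (cases \<gamma>) (simp add: \<beta>_def)
    qed
  qed
  ultimately show ?thesis
    unfolding is_Cat_coequaliser_def by blast
qed

section \<open>Construction of the quotient category\<close>

lemma whiskered_coequaliser_functor_exists:
  assumes FG: "parallel F G"
  obtains Q where "internal_functor E Q" "idom Q = icod F" "inverse_arrows (F0 Q) (F0 Q)"
    "is_whiskered_coequaliser F G (F1 Q)"
proof -
  note p = parallelD [OF FG]
  define A where "A = idom F"
  define B where "B = icod F"
  have ic: "internal_category E A" "internal_category E B" "idom F = A" "icod F = B" "idom G = A" "icod G = B"
    using p by (simp_all add: A_def B_def)
  note p = p(1,2,5)
  obtain l m r where c: "is_context F l m r"
    using is_context_exists [OF p(1)] by metis
  have c': "is_context G l m r"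
    using c is_context_cong p ic by metis
  note d = is_contextD [OF c, unfolded ic]
  define s where "s = whiskered F l m r"
  define t where "t = whiskered G l m r"
  have s: "s \<in> Arr E" "Dom E s = Dom E l" "Cod E s = ob1 B" "src B \<cdot> s = src B \<cdot> l" "tgt B \<cdot> s = tgt B \<cdot> r"
    and t: "t \<in> Arr E" "Dom E t = Dom E l" "Cod E t = ob1 B" "src B \<cdot> t = src B \<cdot> l" "tgt B \<cdot> t = tgt B \<cdot> r"
    using whiskered_simps [OF p(1) c] whiskered_simps [OF p(2) c'] ic by (simp_all add: s_def t_def)
  obtain q where q: "is_coequaliser E s t q"
    using stable s t unfolding has_pullback_stable_coequalisers_def has_coequalisers_def by metis
  have qd: "q \<in> Arr E" "Dom E q = ob1 B" "q \<cdot> s = q \<cdot> t"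
    using is_coequaliserD [OF q] t by simp_all
  note q_epi = coequaliser_epi [OF q]
  \<comment> \<open>Whiskered triples of \<open>F\<close> and of \<open>G\<close> both start at the
    source of \<open>l\<close> and end at the target of \<open>r\<close>, so source and target
    descend to the quotient.\<close>
  obtain S where S: "S \<in> Arr E" "Dom E S = Cod E q" "Cod E S = ob0 B" "S \<cdot> q = src B"
    using coequaliser_ex [OF q, of "src B"] s t ic by auto
  obtain T where T: "T \<in> Arr E" "Dom E T = Cod E q" "Cod E T = ob0 B" "T \<cdot> q = tgt B"
    using coequaliser_ex [OF q, of "tgt B"] s t ic by auto
  have STx: "S \<cdot> q \<cdot> x = src B \<cdot> x" "T \<cdot> q \<cdot> x = tgt B \<cdot> x" if "x \<in> Arr E" "Cod E x = ob1 B" for x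
    using Cmp_reassoc [OF S(4), of x] Cmp_reassoc [OF T(4), of x] that S T qd by simp_all
  \<comment> \<open>The relation in usable form: every triple \<open>(x, F y, z)\<close> comes from
    a generalised element of the object of contexts, so \<open>q\<close> identifies its composite
    with that of \<open>(x, G y, z)\<close>.\<close>
  have key: "q \<cdot> mul B x (mul B (F1 F \<cdot> y) z) = q \<cdot> mul B x (mul B (F1 G \<cdot> y) z)"
    if xyz: "x \<in> Arr E" "y \<in> Arr E" "z \<in> Arr E" "Cod E x = ob1 B" "Cod E y = ob1 A" "Cod E z = ob1 B"
      "tgt B \<cdot> x = F0 F \<cdot> src A \<cdot> y" "src B \<cdot> z = F0 F \<cdot> tgt A \<cdot> y" for x y z
  proof -
    obtain w where w: "w \<in> Arr E" "Cod E w = Dom E l" "l \<cdot> w = x" "m \<cdot> w = y" "r \<cdot> w = z"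
      using is_context_obtain [OF c, unfolded ic, OF xyz] by metis
    have "s \<cdot> w = mul B x (mul B (F1 F \<cdot> y) z)" "t \<cdot> w = mul B x (mul B (F1 G \<cdot> y) z)"
      using whiskered_Cmp [OF p(1) c w(1,2)] whiskered_Cmp [OF p(2) c' w(1,2)] w ic by (simp_all add: s_def t_def)
    moreover have "q \<cdot> s \<cdot> w = q \<cdot> t \<cdot> w"
      using Cmp_reassoc [OF qd(3), of w] w s t qd by simp
    ultimately show ?thesis
      by simp
  qed
  have sw: "s \<cdot> w = mul B (l \<cdot> w) (mul B (F1 F \<cdot> m \<cdot> w) (r \<cdot> w))"
    "t \<cdot> w = mul B (l \<cdot> w) (mul B (F1 G \<cdot> m \<cdot> w) (r \<cdot> w))"
    "tgt B \<cdot> l \<cdot> w = F0 F \<cdot> src A \<cdot> m \<cdot> w" "src B \<cdot> r \<cdot> w = F0 F \<cdot> tgt A \<cdot> m \<cdot> w"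
    if "w \<in> Arr E" "Cod E w = Dom E l" for w
    using whiskered_Cmp [OF p(1) c that] whiskered_Cmp [OF p(2) c' that] is_context_Cmp [OF p(1) c that] ic
    by (simp_all add: s_def t_def)
  \<comment> \<open>The extra factor is absorbed into the outer leg: \<open>(l, F m, r)\<close>
    followed by \<open>z\<close> is the triple whose last leg is \<open>r\<close> followed by
    \<open>z\<close>. This and its mirror image make the relation a congruence.\<close>
  have key_left: "q \<cdot> mul B (s \<cdot> w) z = q \<cdot> mul B (t \<cdot> w) z"
    if "w \<in> Arr E" "Cod E w = Dom E l" "z \<in> Arr E" "Cod E z = ob1 B" "tgt B \<cdot> r \<cdot> w = src B \<cdot> z" for w z
    using key [of "l \<cdot> w" "m \<cdot> w" "mul B (r \<cdot> w) z"] sw [OF that(1,2)] that p ic d(1-8) by simp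
  have key_right: "q \<cdot> mul B z (s \<cdot> w) = q \<cdot> mul B z (t \<cdot> w)"
    if "w \<in> Arr E" "Cod E w = Dom E l" "z \<in> Arr E" "Cod E z = ob1 B" "tgt B \<cdot> z = src B \<cdot> l \<cdot> w" for w z
    using key [of "mul B z (l \<cdot> w)" "m \<cdot> w" "r \<cdot> w"] sw [OF that(1,2)] that p ic d(1-8) by simp
  have stx: "src B \<cdot> s \<cdot> w = src B \<cdot> l \<cdot> w" "src B \<cdot> t \<cdot> w = src B \<cdot> l \<cdot> w"
    "tgt B \<cdot> s \<cdot> w = tgt B \<cdot> r \<cdot> w" "tgt B \<cdot> t \<cdot> w = tgt B \<cdot> r \<cdot> w" if "w \<in> Arr E" "Cod E w = Dom E l" for w
    using Cmp_reassoc [OF s(4), of w] Cmp_reassoc [OF t(4), of w] Cmp_reassoc [OF s(5), of w] Cmp_reassoc [OF t(5), of w]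
      s(1-3) t(1-3) d(1-8) that ic by simp_all
  have pbB: "is_pullback E (src B) (T \<cdot> q) (snd_arr B) (fst_arr B)"
    using is_pullback_sym [OF icat_pullback [OF ic(2)]] T by simp
  \<comment> \<open>The intermediate object: pairs of a class \<open>y'\<close> followed by an arrow
    \<open>x'\<close> of \<open>B\<close>. Each of the two descents below replaces a single factor
    by its class.\<close>
  obtain x' y' where pbM: "is_pullback E (src B) T x' y'"
    using pullback_obtain [of "src B" T] T ic by auto
  have M: "x' \<in> Arr E" "y' \<in> Arr E" "Dom E y' = Dom E x'" "Cod E x' = ob1 B" "Cod E y' = Cod E q"
      "src B \<cdot> x' = T \<cdot> y'"
    using is_pullbackD [OF pbM] T ic by simp_all
  have icomp_w: "icomp B \<cdot> w = mul B (fst_arr B \<cdot> w) (snd_arr B \<cdot> w)"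
    "tgt B \<cdot> fst_arr B \<cdot> w = src B \<cdot> snd_arr B \<cdot> w" if "w \<in> Arr E" "Cod E w = ob2 B" for w
    using icomp_Cmp [OF icat_pullback, of B w] Cmp_reassoc [OF is_pullbackD(9) [OF icat_pullback [OF ic(2)]], of w]
      that ic by simp_all
  \<comment> \<open>First descent: with the second factor kept in \<open>B\<close>,
    \<open>q \<cdot> icomp B\<close> depends only on the class of the first factor, by
    \<open>key_left\<close>.\<close>
  obtain g where g: "g \<in> Arr E" "Dom E g = Dom E x'" "Cod E g = Cod E q"
    and g_eq: "\<And>v w. \<lbrakk>v \<in> Arr E; w \<in> Arr E; Cod E v = Dom E x'; Cod E w = ob2 B; x' \<cdot> v = snd_arr B \<cdot> w;
       y' \<cdot> v = q \<cdot> fst_arr B \<cdot> w\<rbrakk> \<Longrightarrow> g \<cdot> v = q \<cdot> icomp B \<cdot> w"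
  proof (rule coequaliser_descent [OF q T(1,2) pbB pbM, of "q \<cdot> icomp B"])
    fix w w' u
    assume *: "w \<in> Arr E" "w' \<in> Arr E" "u \<in> Arr E" "Cod E w = Dom E (snd_arr B)" "Cod E w' = Dom E (snd_arr B)"
      "Cod E u = Dom E s" "snd_arr B \<cdot> w = snd_arr B \<cdot> w'" "fst_arr B \<cdot> w = s \<cdot> u" "fst_arr B \<cdot> w' = t \<cdot> u"
    have ww: "Cod E w = ob2 B" "Cod E w' = ob2 B" "Cod E u = Dom E l"
      using * s ic by simp_all
    have "tgt B \<cdot> r \<cdot> u = src B \<cdot> snd_arr B \<cdot> w'"
      using icomp_w(2) [OF *(2) ww(2)] stx [OF *(3) ww(3)] *(9) by simp
    then have "q \<cdot> mul B (s \<cdot> u) (snd_arr B \<cdot> w') = q \<cdot> mul B (t \<cdot> u) (snd_arr B \<cdot> w')"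
      using key_left [of u "snd_arr B \<cdot> w'"] * ww ic by simp
    then show "(q \<cdot> icomp B) \<cdot> w = (q \<cdot> icomp B) \<cdot> w'"
      using * ww icomp_w(1) qd ic by simp
  next
    fix g
    assume g: "g \<in> Arr E" "Dom E g = Dom E x'" "Cod E g = Cod E (q \<cdot> icomp B)"
      and *: "\<And>v w. \<lbrakk>v \<in> Arr E; w \<in> Arr E; Cod E v = Dom E x'; Cod E w = Dom E (snd_arr B);
        x' \<cdot> v = snd_arr B \<cdot> w; y' \<cdot> v = q \<cdot> fst_arr B \<cdot> w\<rbrakk> \<Longrightarrow> g \<cdot> v = (q \<cdot> icomp B) \<cdot> w"
    show thesis
      using that [of g] g * qd ic by simp
  qed (use qd ic in simp_all)
  have g_mul: "g \<cdot> v = q \<cdot> mul B x y"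
    if "v \<in> Arr E" "x \<in> Arr E" "y \<in> Arr E" "Cod E v = Dom E x'" "Cod E x = ob1 B" "Cod E y = ob1 B"
      "x' \<cdot> v = y" "y' \<cdot> v = q \<cdot> x" "tgt B \<cdot> x = src B \<cdot> y" for v x y
    using g_eq [of v "ipair E B x y"] ipair_simps [OF ic(2) that(2,3,5,6,9)] that by (simp add: mul_def)
  obtain p2 q2 where pbC: "is_pullback E T S p2 q2"
    using pullback_obtain [of T S] S T by auto
  have C2: "p2 \<in> Arr E" "q2 \<in> Arr E" "Dom E q2 = Dom E p2" "Cod E p2 = Cod E q" "Cod E q2 = Cod E q"
      "T \<cdot> p2 = S \<cdot> q2"
    using is_pullbackD [OF pbC] S T by simp_all
  have pbM': "is_pullback E T (S \<cdot> q) y' x'"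
    using is_pullback_sym [OF pbM] S by simp
  \<comment> \<open>Second descent: \<open>g\<close> depends only on the class of the second factor
    as well, so composition is defined on pairs of classes.\<close>
  obtain n where n: "n \<in> Arr E" "Dom E n = Dom E p2" "Cod E n = Cod E q"
    and n_eq: "\<And>v w. \<lbrakk>v \<in> Arr E; w \<in> Arr E; Cod E v = Dom E p2; Cod E w = Dom E y'; p2 \<cdot> v = y' \<cdot> w;
       q2 \<cdot> v = q \<cdot> x' \<cdot> w\<rbrakk> \<Longrightarrow> n \<cdot> v = g \<cdot> w"
  proof (rule coequaliser_descent [OF q S(1,2) pbM' pbC, of g])
    fix w w' u
    assume "w \<in> Arr E" "w' \<in> Arr E" "u \<in> Arr E" "Cod E w = Dom E y'" "Cod E w' = Dom E y'"
      "Cod E u = Dom E s" "y' \<cdot> w = y' \<cdot> w'" "x' \<cdot> w = s \<cdot> u" "x' \<cdot> w' = t \<cdot> u"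
    then have w: "w \<in> Arr E" "w' \<in> Arr E" "u \<in> Arr E" "Cod E w = Dom E x'" "Cod E w' = Dom E x'"
      "Cod E u = Dom E l" "y' \<cdot> w = y' \<cdot> w'" "x' \<cdot> w = s \<cdot> u" "x' \<cdot> w' = t \<cdot> u"
      using M s by simp_all
    have dom: "Dom E w = Dom E u" "Dom E w' = Dom E u"
      using w M s t by (metis Dom_Cmp)+
    \<comment> \<open>The first factor is by now only a class, to which \<open>key_right\<close>
      does not apply; it is represented by \<open>b\<close> over the epimorphism \<open>e\<close>,
      and \<open>e\<close> is cancelled at the end.\<close>
    obtain e b where e: "epi e" "Cod E e = Dom E (y' \<cdot> w)" "b \<in> Arr E" "Dom E b = Dom E e" "Cod E b = Dom E q"
      "q \<cdot> b = (y' \<cdot> w) \<cdot> e"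
      using coequaliser_lift [OF q, of "y' \<cdot> w"] w M by auto
    note ee = epi_Arr [OF e(1)]
    have e': "Cod E e = Dom E u" "Cod E b = ob1 B" "y' \<cdot> w \<cdot> e = q \<cdot> b" "y' \<cdot> w' \<cdot> e = q \<cdot> b"
      using e ee w M dom qd Cmp_reassoc [OF w(7), of e] by simp_all
    have x'w: "x' \<cdot> w \<cdot> e = s \<cdot> u \<cdot> e" "x' \<cdot> w' \<cdot> e = t \<cdot> u \<cdot> e"
      using e' ee w M dom s t Cmp_reassoc [OF w(8), of e] Cmp_reassoc [OF w(9), of e] by simp_all
    have "src B \<cdot> x' \<cdot> w \<cdot> e = T \<cdot> y' \<cdot> w \<cdot> e"
      using Cmp_reassoc [OF M(6), of "w \<cdot> e"] w(1-6) M(1-5) ee e'(1) dom T ic by simp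
    then have tb: "tgt B \<cdot> b = src B \<cdot> l \<cdot> u \<cdot> e"
      using stx [of "u \<cdot> e"] STx [of b] x'w e' e(3) ee w(3,6) by simp
    have "g \<cdot> w \<cdot> e = q \<cdot> mul B b (s \<cdot> u \<cdot> e)"
      by (rule g_mul) (use w(1-6) dom e' e ee x'w tb stx [of "u \<cdot> e"] s in simp_all)
    moreover have "g \<cdot> w' \<cdot> e = q \<cdot> mul B b (t \<cdot> u \<cdot> e)"
      by (rule g_mul) (use w(1-6) dom e' e ee x'w tb stx [of "u \<cdot> e"] t in simp_all)
    moreover have "q \<cdot> mul B b (s \<cdot> u \<cdot> e) = q \<cdot> mul B b (t \<cdot> u \<cdot> e)"
      by (rule key_right) (use w(1-6) e' e ee tb in simp_all)
    ultimately have "(g \<cdot> w) \<cdot> e = (g \<cdot> w') \<cdot> e"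
      using w(1-6) dom e' ee g by simp
    then show "g \<cdot> w = g \<cdot> w'"
      by (rule epiD [OF e(1)]) (use w(1-6) dom e' g in simp_all)
  next
    fix n
    assume "n \<in> Arr E" "Dom E n = Dom E p2" "Cod E n = Cod E g"
      "\<And>v w. \<lbrakk>v \<in> Arr E; w \<in> Arr E; Cod E v = Dom E p2; Cod E w = Dom E y'; p2 \<cdot> v = y' \<cdot> w;
       q2 \<cdot> v = q \<cdot> x' \<cdot> w\<rbrakk> \<Longrightarrow> n \<cdot> v = g \<cdot> w"
    then show thesis
      using that [of n] g by simp
  qed (use g M in simp_all)
  define C where "C = \<lparr>ob0 = ob0 B, ob1 = Cod E q, ob2 = Dom E p2, src = S, tgt = T, unit = q \<cdot> unit B,
    fst_arr = p2, snd_arr = q2, icomp = n\<rparr>"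
  have C: "ob0 C = ob0 B" "ob1 C = Cod E q" "ob2 C = Dom E p2" "src C = S" "tgt C = T" "unit C = q \<cdot> unit B"
    "fst_arr C = p2" "snd_arr C = q2" "icomp C = n"
    by (simp_all add: C_def)
  have mulC: "mul C x y \<in> Arr E" "Dom E (mul C x y) = Dom E x" "Cod E (mul C x y) = Cod E q"
    if "x \<in> Arr E" "y \<in> Arr E" "Cod E x = Cod E q" "Cod E y = Cod E q" "T \<cdot> x = S \<cdot> y" for x y
    unfolding mul_def C using pairing_props [OF pbC, of x y] that S T n by simp_all
  have mulC_Cmp: "mul C x y \<cdot> e = mul C (x \<cdot> e) (y \<cdot> e)"
    if "x \<in> Arr E" "y \<in> Arr E" "Cod E x = Cod E q" "Cod E y = Cod E q" "T \<cdot> x = S \<cdot> y"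
      "e \<in> Arr E" "Cod E e = Dom E x" for x y e
    unfolding mul_def C using pairing_props [OF pbC, of x y] pairing_Cmp [OF pbC, of x y e] that S T n by simp
  \<comment> \<open>Both descents evaluated on actual arrows of \<open>B\<close>: \<open>v\<close>
    is the pair of classes and \<open>w\<close> the pair in the intermediate object.\<close>
  have mulC_q: "mul C (q \<cdot> x) (q \<cdot> y) = q \<cdot> mul B x y"
    if "x \<in> Arr E" "y \<in> Arr E" "Cod E x = ob1 B" "Cod E y = ob1 B" "tgt B \<cdot> x = src B \<cdot> y" for x y
  proof -
    define v where "v = pairing E p2 q2 (q \<cdot> x) (q \<cdot> y)"
    have v: "v \<in> Arr E" "Cod E v = Dom E p2" "p2 \<cdot> v = q \<cdot> x" "q2 \<cdot> v = q \<cdot> y"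
      unfolding v_def using pairing_props [OF pbC, of "q \<cdot> x" "q \<cdot> y"] that S T qd STx by simp_all
    define w where "w = pairing E x' y' y (q \<cdot> x)"
    have w: "w \<in> Arr E" "Cod E w = Dom E x'" "x' \<cdot> w = y" "y' \<cdot> w = q \<cdot> x"
      unfolding w_def using pairing_props [OF pbM, of y "q \<cdot> x"] that T qd STx ic by simp_all
    have "mul C (q \<cdot> x) (q \<cdot> y) = n \<cdot> v"
      by (simp add: mul_def C v_def)
    also have "\<dots> = g \<cdot> w"
      using n_eq [of v w] v w M by simp
    also have "\<dots> = q \<cdot> mul B x y"
      using g_mul [of w x y] w that by simp
    finally show ?thesis .
  qed
  \<comment> \<open>Representatives of composable classes are composable, since
    \<open>S \<cdot> q = src B\<close> and \<open>T \<cdot> q = tgt B\<close>. This is what allows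
    the laws of \<open>C\<close> to be read off from those of \<open>B\<close>.\<close>
  have STe: "tgt B \<cdot> x = src B \<cdot> y"
    if "x' \<in> Arr E" "y' \<in> Arr E" "Cod E x' = Cod E q" "Cod E y' = Cod E q" "T \<cdot> x' = S \<cdot> y'"
      "x \<in> Arr E" "y \<in> Arr E" "Cod E x = ob1 B" "Cod E y = ob1 B" "q \<cdot> x = x' \<cdot> e" "q \<cdot> y = y' \<cdot> e"
      "e \<in> Arr E" "Cod E e = Dom E x'" "Dom E y' = Dom E x'" for x y x' y' e
    using STx(2) [of x] STx(1) [of y] Cmp_reassoc [OF that(5), of e] S T that by simp
  have ST_mulC: "S \<cdot> mul C x y = S \<cdot> x" "T \<cdot> mul C x y = T \<cdot> y"
    if xy: "x \<in> Arr E" "y \<in> Arr E" "Cod E x = Cod E q" "Cod E y = Cod E q" "Dom E y = Dom E x" "T \<cdot> x = S \<cdot> y" for x y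
  proof -
    obtain e a b where e: "epi e" "Cod E e = Dom E x" "a \<in> Arr E" "Dom E a = Dom E e" "Cod E a = Dom E q"
        "q \<cdot> a = x \<cdot> e" "b \<in> Arr E" "Dom E b = Dom E e" "Cod E b = Dom E q" "q \<cdot> b = y \<cdot> e"
      by (rule coequaliser_lift2 [OF q xy(1,3,2,4,5)])
    note ee = epi_Arr [OF e(1)]
    have ab: "tgt B \<cdot> a = src B \<cdot> b"
      using STe [of x y a b e] that e ee qd by simp
    have "mul C x y \<cdot> e = q \<cdot> mul B a b"
      using mulC_Cmp [of x y e] mulC_q [of a b] that e ee ab qd by simp
    then have "S \<cdot> mul C x y \<cdot> e = S \<cdot> x \<cdot> e" "T \<cdot> mul C x y \<cdot> e = T \<cdot> y \<cdot> e"
      using STx [of "mul B a b"] STx [of a] STx [of b] e ab qd ic by simp_all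
    then show "S \<cdot> mul C x y = S \<cdot> x" "T \<cdot> mul C x y = T \<cdot> y"
      using that S T mulC [of x y] e ee
        epiD [OF e(1), of "S \<cdot> mul C x y" "S \<cdot> x"] epiD [OF e(1), of "T \<cdot> mul C x y" "T \<cdot> y"] by simp_all
  qed
  have C_icat: "internal_category E C"
  proof (rule internal_categoryI)
    show "is_pullback E (tgt C) (src C) (fst_arr C) (snd_arr C)"
      using pbC C by simp
    have "n = mul C p2 q2"
      using icomp_Cmp [of C "Idn E (Dom E p2)"] pbC C2 n by (simp add: C)
    then show "src C \<cdot> icomp C = src C \<cdot> fst_arr C" "tgt C \<cdot> icomp C = tgt C \<cdot> snd_arr C"
      unfolding C using ST_mulC [of p2 q2] C2 by simp_all
    have u: "T \<cdot> q \<cdot> unit B \<cdot> S = S" "S \<cdot> q \<cdot> unit B \<cdot> T = T"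
      using STx [of "unit B \<cdot> S"] STx [of "unit B \<cdot> T"] S T ic by simp_all
    have qu: "(q \<cdot> unit B) \<cdot> S = q \<cdot> unit B \<cdot> S" "(q \<cdot> unit B) \<cdot> T = q \<cdot> unit B \<cdot> T"
      using S T qd ic by simp_all
    have "mul C (q \<cdot> unit B \<cdot> S) (Idn E (Cod E q)) \<cdot> q = mul C ((q \<cdot> unit B \<cdot> S) \<cdot> q) (Idn E (Cod E q) \<cdot> q)"
      by (rule mulC_Cmp) (use u S T qd ic in simp_all)
    also have "\<dots> = mul C (q \<cdot> unit B \<cdot> src B) (q \<cdot> Idn E (ob1 B))"
      using S qd ic by simp
    also have "\<dots> = q \<cdot> mul B (unit B \<cdot> src B) (Idn E (ob1 B))"
      by (rule mulC_q) (use ic in simp_all)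
    also have "\<dots> = Idn E (Cod E q) \<cdot> q"
      using qd ic by simp
    finally show "mul C (unit C \<cdot> src C) (Idn E (ob1 C)) = Idn E (ob1 C)"
      unfolding C qu by (rule epiD [OF q_epi]) (use mulC [of "q \<cdot> unit B \<cdot> S" "Idn E (Cod E q)"] u S T qd ic in simp_all)
    have "mul C (Idn E (Cod E q)) (q \<cdot> unit B \<cdot> T) \<cdot> q = mul C (Idn E (Cod E q) \<cdot> q) ((q \<cdot> unit B \<cdot> T) \<cdot> q)"
      by (rule mulC_Cmp) (use u S T qd ic in simp_all)
    also have "\<dots> = mul C (q \<cdot> Idn E (ob1 B)) (q \<cdot> unit B \<cdot> tgt B)"
      using T qd ic by simp
    also have "\<dots> = q \<cdot> mul B (Idn E (ob1 B)) (unit B \<cdot> tgt B)"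
      by (rule mulC_q) (use ic in simp_all)
    also have "\<dots> = Idn E (Cod E q) \<cdot> q"
      using qd ic by simp
    finally show "mul C (Idn E (ob1 C)) (unit C \<cdot> tgt C) = Idn E (ob1 C)"
      unfolding C qu by (rule epiD [OF q_epi]) (use mulC [of "Idn E (Cod E q)" "q \<cdot> unit B \<cdot> T"] u S T qd ic in simp_all)
  next
    fix x y z
    assume "x \<in> Arr E" "y \<in> Arr E" "z \<in> Arr E" "Cod E x = ob1 C" "Cod E y = ob1 C" "Cod E z = ob1 C"
      "Dom E y = Dom E x" "Dom E z = Dom E x" "tgt C \<cdot> x = src C \<cdot> y" "tgt C \<cdot> y = src C \<cdot> z"
    then have xyz: "x \<in> Arr E" "y \<in> Arr E" "z \<in> Arr E" "Cod E x = Cod E q" "Cod E y = Cod E q" "Cod E z = Cod E q"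
      "Dom E y = Dom E x" "Dom E z = Dom E x" "T \<cdot> x = S \<cdot> y" "T \<cdot> y = S \<cdot> z"
      using C by simp_all
    obtain e i j k where e: "epi e" "Cod E e = Dom E x" "i \<in> Arr E" "Dom E i = Dom E e" "Cod E i = Dom E q"
        "q \<cdot> i = x \<cdot> e" "j \<in> Arr E" "Dom E j = Dom E e" "Cod E j = Dom E q" "q \<cdot> j = y \<cdot> e"
        "k \<in> Arr E" "Dom E k = Dom E e" "Cod E k = Dom E q" "q \<cdot> k = z \<cdot> e"
      by (rule coequaliser_lift3 [OF q xyz(1,4,2,5,7,3,6,8)])
    note ee = epi_Arr [OF e(1)]
    have ij: "tgt B \<cdot> i = src B \<cdot> j"
      using STe [of x y i j e] xyz e ee qd by simp
    have jk: "tgt B \<cdot> j = src B \<cdot> k"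
      using STe [of y z j k e] xyz e ee qd by simp
    have exy: "mul C x y \<cdot> e = q \<cdot> mul B i j"
      using mulC_Cmp [of x y e] mulC_q [of i j] xyz e ee ij qd by simp
    have eyz: "mul C y z \<cdot> e = q \<cdot> mul B j k"
      using mulC_Cmp [of y z e] mulC_q [of j k] xyz e ee jk qd by simp
    have 1: "mul C (mul C x y) z \<cdot> e = q \<cdot> mul B (mul B i j) k"
      using mulC_Cmp [of "mul C x y" z e] mulC_q [of "mul B i j" k] mulC [of x y] ST_mulC [of x y] xyz e ee ij jk exy qd ic
      by simp
    have 2: "mul C x (mul C y z) \<cdot> e = q \<cdot> mul B i (mul B j k)"
      using mulC_Cmp [of x "mul C y z" e] mulC_q [of i "mul B j k"] mulC [of y z] ST_mulC [of y z] xyz e ee ij jk eyz qd ic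
      by simp
    have "mul C (mul C x y) z \<cdot> e = mul C x (mul C y z) \<cdot> e"
      using 1 2 e ij jk qd ic by simp
    then show "mul C (mul C x y) z = mul C x (mul C y z)"
      by (rule epiD [OF e(1)]) (use mulC ST_mulC xyz e in simp_all)
  qed (use C S T n qd C2 STx ic in \<open>simp_all add: hom_def\<close>)
  define Q where "Q = \<lparr>idom = B, icod = C, F0 = Idn E (ob0 B), F1 = q\<rparr>"
  have Q: "idom Q = B" "icod Q = C" "F0 Q = Idn E (ob0 B)" "F1 Q = q"
    by (simp_all add: Q_def)
  have "internal_functor E Q"
    by (rule internal_functorI) (use Q C_icat C S T qd mulC_q ic in simp_all)
  moreover have "inverse_arrows (F0 Q) (F0 Q)"
    using Q ic by (simp add: inverse_arrows_def)
  moreover have "is_whiskered_coequaliser F G (F1 Q)"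
    using c q Q unfolding is_whiskered_coequaliser_def s_def t_def by auto
  moreover have "idom Q = icod F"
    using Q ic by simp
  ultimately show thesis
    by (intro that [of Q])
qed

text \<open>A given coequaliser is isomorphic to the constructed one, so its arrow component is
  again a coequaliser of the whiskered arrows. On objects only invertibility survives, because the
  isomorphism need not be the identity there.\<close>

lemma Cat_coequaliser_components:
  assumes FG: "parallel F G" and Q: "is_coequaliser (Cat E) F G Q"
  obtains Q0' where "inverse_arrows (F0 Q) Q0'" "is_whiskered_coequaliser F G (F1 Q)"
proof -
  interpret Cat: category "Cat E"
    by (rule category_Cat)
  obtain P where P: "internal_functor E P" "idom P = icod F" "inverse_arrows (F0 P) (F0 P)"
    "is_whiskered_coequaliser F G (F1 P)"
    using whiskered_coequaliser_functor_exists [OF FG] by metis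
  then have "is_coequaliser (Cat E) F G P"
    using Cat_coequaliserI [OF FG] by (simp add: is_Cat_coequaliser_def)
  then obtain K K' where K: "Cat.inverse_arrows K K'" "Dom (Cat E) K = Cod (Cat E) P" "K \<cdot>\<^bsub>Cat E\<^esub> P = Q"
    using Cat.coequaliser_unique_up_to_iso [OF _ Q] by metis
  have QK: "F0 Q = F0 K \<cdot> F0 P" "F1 Q = F1 K \<cdot> F1 P"
    using K by auto
  note Kd = Cat.inverse_arrowsD [OF K(1)] and K0 = inverse_functors [OF K(1)]
  obtain l m r where "is_context F l m r" "is_coequaliser E (whiskered F l m r) (whiskered G l m r) (F1 P)"
    using P(4) by (auto simp: is_whiskered_coequaliser_def)
  moreover from this have "is_coequaliser E (whiskered F l m r) (whiskered G l m r) (F1 Q)"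
    unfolding QK using is_coequaliser_inverse_arrows [OF _ K0(2)] K(2) Kd(1) P(1) by simp
  ultimately have "is_whiskered_coequaliser F G (F1 Q)"
    unfolding is_whiskered_coequaliser_def by blast
  moreover have "inverse_arrows (F0 Q) (F0 P \<cdot> F0 K')"
    unfolding QK by (rule inverse_arrows_Cmp [OF P(3) K0(1)]) (use K(2) Kd(1) P(1) in simp)
  ultimately show thesis
    using that by blast
qed


subsection \<open>Discrete Conduche fibrations\<close>

text \<open>Existence half of the pullback square, on generalised elements: \<open>x\<close>
  together with a factorisation of its image is one element \<open>w\<close> of the composable pairs
  in \<open>X\<close>, whose two projections are the lifted factors.\<close>

lemma Conduche_factor:
  assumes f: "discrete_Conduche_fibration E f" "idom f = X" "icod f = Y"
    and x: "x \<in> Arr E" "Cod E x = ob1 X"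
    and y: "y \<in> Arr E" "z \<in> Arr E" "Cod E y = ob1 Y" "Cod E z = ob1 Y" "tgt Y \<cdot> y = src Y \<cdot> z"
      "F1 f \<cdot> x = mul Y y z"
  obtains x' x'' where "x' \<in> Arr E" "x'' \<in> Arr E" "Dom E x' = Dom E x" "Dom E x'' = Dom E x"
    "Cod E x' = ob1 X" "Cod E x'' = ob1 X" "tgt X \<cdot> x' = src X \<cdot> x''"
    "mul X x' x'' = x" "F1 f \<cdot> x' = y" "F1 f \<cdot> x'' = z"
proof -
  have fn: "internal_functor E f" and pb: "is_pullback E (icomp Y) (F1 f) (F2 E f) (icomp X)"
    using f by (auto simp: discrete_Conduche_fibration_def)
  have ic: "internal_category E X" "internal_category E Y"
    using fn f ifun_simps(1,2) by blast+
  note f2 = F2_simps [OF fn, unfolded f(2,3)] and pr = ipair_simps [OF ic(2) y(1-5)]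
  define w where "w = pairing E (F2 E f) (icomp X) (ipair E Y y z) x"
  have w: "w \<in> Arr E" "Cod E w = ob2 X" "F2 E f \<cdot> w = ipair E Y y z" "icomp X \<cdot> w = x"
    unfolding w_def using pairing_props [OF pb, of "ipair E Y y z" x] x y pr fn f ic f2 by (simp_all add: mul_def)
  have "Dom E (icomp X \<cdot> w) = Dom E w"
    using w(1,2) ic by simp
  then have "Dom E w = Dom E x"
    using w(4) by simp
  note px = is_pullbackD(9) [OF icat_pullback [OF ic(1)]]
  show thesis
  proof (rule that [of "fst_arr X \<cdot> w" "snd_arr X \<cdot> w"])
    show "tgt X \<cdot> fst_arr X \<cdot> w = src X \<cdot> snd_arr X \<cdot> w"
      using Cmp_reassoc [OF px, of w] w ic by simp
    show "mul X (fst_arr X \<cdot> w) (snd_arr X \<cdot> w) = x"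
      using icomp_Cmp [OF icat_pullback [OF ic(1)], of w] w ic by simp
    show "F1 f \<cdot> fst_arr X \<cdot> w = y" "F1 f \<cdot> snd_arr X \<cdot> w = z"
      using Cmp_reassoc [OF f2(4), of w] Cmp_reassoc [OF f2(5), of w] w ic f2 fn f pr by simp_all
  qed (use w \<open>Dom E w = Dom E x\<close> ic in simp_all)
qed

text \<open>Uniqueness half: a composable pair in \<open>X\<close> is determined by its composite
  and its image under \<open>F2 E f\<close>. The latter is determined by the images of the two
  factors, as \<open>fst_arr\<close> and \<open>snd_arr\<close> are jointly monic.\<close>

lemma Conduche_unique:
  assumes f: "discrete_Conduche_fibration E f" "idom f = X"
    and x: "x \<in> Arr E" "y \<in> Arr E" "Cod E x = ob1 X" "Cod E y = ob1 X" "tgt X \<cdot> x = src X \<cdot> y"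
    and x': "x' \<in> Arr E" "y' \<in> Arr E" "Cod E x' = ob1 X" "Cod E y' = ob1 X" "tgt X \<cdot> x' = src X \<cdot> y'"
    and eq: "mul X x y = mul X x' y'" "F1 f \<cdot> x = F1 f \<cdot> x'" "F1 f \<cdot> y = F1 f \<cdot> y'"
  shows "x = x'" "y = y'"
proof -
  define Y where "Y = icod f"
  have fn: "internal_functor E f" and pb: "is_pullback E (icomp Y) (F1 f) (F2 E f) (icomp X)"
    using f by (auto simp: discrete_Conduche_fibration_def Y_def)
  have ic: "internal_category E X" "internal_category E Y"
    using fn f Y_def by auto
  note f2 = F2_simps [OF fn, unfolded f(2) Y_def [symmetric]]
  note p = ipair_simps [OF ic(1) x] and p' = ipair_simps [OF ic(1) x']
  have 1: "fst_arr Y \<cdot> F2 E f \<cdot> ipair E X x y = F1 f \<cdot> x" "snd_arr Y \<cdot> F2 E f \<cdot> ipair E X x y = F1 f \<cdot> y"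
    "fst_arr Y \<cdot> F2 E f \<cdot> ipair E X x' y' = F1 f \<cdot> x'" "snd_arr Y \<cdot> F2 E f \<cdot> ipair E X x' y' = F1 f \<cdot> y'"
    using Cmp_reassoc [OF f2(4)] Cmp_reassoc [OF f2(5)] p p' f2 ic fn f by simp_all
  have F2: "F2 E f \<cdot> ipair E X x y = F2 E f \<cdot> ipair E X x' y'"
    by (rule pullback_eqI [OF icat_pullback [OF ic(2)]]) (use 1 eq p p' f2 ic in simp_all)
  have "ipair E X x y = ipair E X x' y'"
    by (rule pullback_eqI [OF pb]) (use F2 eq(1) p p' f2 ic in \<open>simp_all add: mul_def\<close>)
  then show "x = x'" "y = y'"
    using p p' by metis+
qed

text \<open>Both \<open>F\<close> and \<open>G\<close> lie over \<open>a\<close>, so the image in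
  \<open>Y\<close> of a whiskered triple does not see which of them was used. The heart is that the
  contexts of \<open>F'\<close>, with \<open>u\<close> to \<open>ob1 X\<close> and \<open>w\<close>
  to the contexts of \<open>F\<close>, form a pullback of \<open>F1 f\<close> and
  \<open>F1 b \<cdot> s\<close>: an arrow of \<open>X\<close> over a composite of three arrows
  splits uniquely into three. Stability in \<open>E\<close> does the rest.\<close>

lemma whiskered_coequaliser_pullback:
  assumes f: "discrete_Conduche_fibration E f" "idom f = X" "icod f = Y"
    and c: "internal_functor E c" "icod c = Y" and Q: "internal_functor E Q" "icod Q = idom c"
    and FG: "parallel F G" "icod F = idom Q" and FG': "parallel F' G'"
    and QF: "Q \<cdot>\<^bsub>Cat E\<^esub> F = Q \<cdot>\<^bsub>Cat E\<^esub> G"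
    and a: "is_pullback (Cat E) f a a' \<pi>" "c \<cdot>\<^bsub>Cat E\<^esub> Q \<cdot>\<^bsub>Cat E\<^esub> F = a"
    and b: "is_pullback (Cat E) f b b' \<rho>" "c \<cdot>\<^bsub>Cat E\<^esub> Q = b"
    and c': "is_pullback (Cat E) f c c' \<sigma>"
    and F': "icod F' = idom b'" "b' \<cdot>\<^bsub>Cat E\<^esub> F' = a'" "\<rho> \<cdot>\<^bsub>Cat E\<^esub> F' = F \<cdot>\<^bsub>Cat E\<^esub> \<pi>"
    and G': "b' \<cdot>\<^bsub>Cat E\<^esub> G' = a'" "\<rho> \<cdot>\<^bsub>Cat E\<^esub> G' = G \<cdot>\<^bsub>Cat E\<^esub> \<pi>"
    and Q': "internal_functor E Q'" "icod Q' = idom c'" "c' \<cdot>\<^bsub>Cat E\<^esub> Q' = b'" "\<sigma> \<cdot>\<^bsub>Cat E\<^esub> Q' = Q \<cdot>\<^bsub>Cat E\<^esub> \<rho>"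
    and wc: "is_whiskered_coequaliser F G (F1 Q)"
  shows "is_whiskered_coequaliser F' G' (F1 Q')"
proof -
  interpret Cat: category "Cat E"
    by (rule category_Cat)
  note p = parallelD [OF FG(1)] and p' = parallelD [OF FG']
  define A where "A = idom F"
  define B where "B = icod F"
  define C where "C = idom c"
  define A' where "A' = idom F'"
  define B' where "B' = icod F'"
  define C' where "C' = idom c'"
  note da = Cat.is_pullbackD [OF a(1)] and db = Cat.is_pullbackD [OF b(1)] and dc = Cat.is_pullbackD [OF c']
  have fn: "internal_functor E f" "internal_functor E F" "internal_functor E G" "internal_functor E Q"
    "internal_functor E a" "internal_functor E b" "internal_functor E c"
    "internal_functor E F'" "internal_functor E G'" "internal_functor E Q'"
    "internal_functor E a'" "internal_functor E b'" "internal_functor E c'"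
    "internal_functor E \<pi>" "internal_functor E \<rho>" "internal_functor E \<sigma>"
    using da db dc p p' Q Q' by simp_all
  have dom: "idom f = X" "icod f = Y" "idom F = A" "icod F = B" "idom G = A" "icod G = B" "idom Q = B" "icod Q = C"
    "idom F' = A'" "icod F' = B'" "idom G' = A'" "icod G' = B'" "icod Q' = C'"
    using f p p' Q Q' FG(2) by (simp_all add: A_def B_def C_def A'_def B'_def C'_def)
  have dom': "idom a = A" "idom b = B" "idom c = C" "icod a = Y" "icod b = Y" "icod c = Y"
    using arg_cong [OF a(2), of idom] arg_cong [OF b(2), of idom] arg_cong [OF a(2), of icod]
      arg_cong [OF b(2), of icod] c dom by (simp_all add: C_def)
  have dom'': "idom a' = A'" "idom b' = B'" "idom c' = C'" "icod a' = X" "icod b' = X" "icod c' = X"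
    "idom \<pi> = A'" "idom \<rho> = B'" "idom \<sigma> = C'" "icod \<pi> = A" "icod \<rho> = B" "icod \<sigma> = C" "idom Q' = B'"
    using da(1-8) db(1-8) dc(1-8) dom dom' F'(1) Q'(2) arg_cong [OF F'(2), of idom] arg_cong [OF Q'(3), of idom]
    by (simp_all add: C'_def)
  note dom = dom dom' dom''
  have ic: "internal_category E X" "internal_category E Y" "internal_category E A" "internal_category E B"
    "internal_category E C" "internal_category E A'" "internal_category E B'" "internal_category E C'"
    using ifun_simps(1,2) [OF fn(1)] ifun_simps(1,2) [OF fn(2)] ifun_simps(1,2) [OF fn(7)]
      ifun_simps(1,2) [OF fn(8)] ifun_simps(1) [OF fn(13)] by (simp_all only: dom)
  note pa = Cat_pullback_components [OF a(1)] and pb = Cat_pullback_components [OF b(1)]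
    and pc = Cat_pullback_components [OF c']
  have e: "F1 b' \<cdot> F1 F' = F1 a'" "F1 b' \<cdot> F1 G' = F1 a'" "F1 c' \<cdot> F1 Q' = F1 b'"
    "F1 c \<cdot> F1 Q \<cdot> F1 F = F1 a" "F1 c \<cdot> F1 Q = F1 b" "F0 c \<cdot> F0 Q \<cdot> F0 F = F0 a" "F0 c \<cdot> F0 Q = F0 b"
    "F0 b' \<cdot> F0 F' = F0 a'"
    using arg_cong [OF F'(2), of F1] arg_cong [OF G'(1), of F1] arg_cong [OF Q'(3), of F1] arg_cong [OF a(2), of F1]
      arg_cong [OF b(2), of F1] arg_cong [OF a(2), of F0] arg_cong [OF b(2), of F0] arg_cong [OF F'(2), of F0]
    by simp_all
  have r: "F1 \<rho> \<cdot> F1 F' = F1 F \<cdot> F1 \<pi>" "F1 \<rho> \<cdot> F1 G' = F1 G \<cdot> F1 \<pi>" "F1 \<sigma> \<cdot> F1 Q' = F1 Q \<cdot> F1 \<rho>"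
    "F0 \<rho> \<cdot> F0 F' = F0 F \<cdot> F0 \<pi>" "F1 f \<cdot> F1 a' = F1 a \<cdot> F1 \<pi>" "F1 f \<cdot> F1 b' = F1 b \<cdot> F1 \<rho>"
    "F1 Q \<cdot> F1 F = F1 Q \<cdot> F1 G" "F0 f \<cdot> F0 a' = F0 a \<cdot> F0 \<pi>"
    using Cat_Cmp_eqD [OF F'(3)] Cat_Cmp_eqD [OF G'(2)] Cat_Cmp_eqD [OF Q'(4)] Cat_Cmp_eqD [OF QF]
      Cat_Cmp_eqD [OF da(9)] Cat_Cmp_eqD [OF db(9)] by simp_all
  have ex: "F1 b' \<cdot> F1 F' \<cdot> x = F1 a' \<cdot> x" "F1 b' \<cdot> F1 G' \<cdot> x = F1 a' \<cdot> x"
    "F1 \<rho> \<cdot> F1 F' \<cdot> x = F1 F \<cdot> F1 \<pi> \<cdot> x" "F1 \<rho> \<cdot> F1 G' \<cdot> x = F1 G \<cdot> F1 \<pi> \<cdot> x"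
    "F1 f \<cdot> F1 a' \<cdot> x = F1 a \<cdot> F1 \<pi> \<cdot> x" if "x \<in> Arr E" "Cod E x = ob1 A'" for x
    using Cmp_reassoc [OF e(1), of x] Cmp_reassoc [OF e(2), of x] Cmp_reassoc [OF r(1), of x]
      Cmp_reassoc [OF r(2), of x] Cmp_reassoc [OF r(5), of x] that fn dom by simp_all
  have ex0: "F0 b' \<cdot> F0 F' \<cdot> x = F0 a' \<cdot> x" "F0 \<rho> \<cdot> F0 F' \<cdot> x = F0 F \<cdot> F0 \<pi> \<cdot> x"
    if "x \<in> Arr E" "Cod E x = ob0 A'" for x
    using Cmp_reassoc [OF e(8), of x] Cmp_reassoc [OF r(4), of x] that fn dom by simp_all
  have eb: "F1 f \<cdot> F1 b' \<cdot> x = F1 b \<cdot> F1 \<rho> \<cdot> x" if "x \<in> Arr E" "Cod E x = ob1 B'" for x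
    using Cmp_reassoc [OF r(6), of x] that fn dom by simp
  have bx: "F1 c \<cdot> F1 Q \<cdot> x = F1 b \<cdot> x" if "x \<in> Arr E" "Cod E x = ob1 B" for x
    using Cmp_reassoc [OF e(5), of x] that fn dom by simp
  have ebF0x: "F0 b \<cdot> F0 F \<cdot> x = F0 a \<cdot> x" if "x \<in> Arr E" "Cod E x = ob0 A" for x
    using Cmp_reassoc [OF e(7), of "F0 F \<cdot> x"] Cmp_reassoc [OF e(6), of x] that fn dom by simp
  \<comment> \<open>For \<open>G\<close> this uses that \<open>Q\<close> equalises the pair.\<close>
  have ebF: "F1 b \<cdot> F1 F = F1 a" "F1 b \<cdot> F1 G = F1 a" "F0 b \<cdot> F0 F = F0 a"
    using e(4-7) r(7) fn dom Cmp_assoc' [of "F1 F" "F1 Q" "F1 c"] Cmp_assoc' [of "F1 G" "F1 Q" "F1 c"]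
      Cmp_assoc' [of "F0 F" "F0 Q" "F0 c"] by simp_all
  have ebFx: "F1 b \<cdot> F1 F \<cdot> x = F1 a \<cdot> x" if "x \<in> Arr E" "Cod E x = ob1 A" for x
    using Cmp_reassoc [OF ebF(1), of x] that fn dom by simp
  obtain l m r where ctx: "is_context F l m r"
    and q: "is_coequaliser E (whiskered F l m r) (whiskered G l m r) (F1 Q)"
    using wc by (auto simp: is_whiskered_coequaliser_def)
  have ctxG: "is_context G l m r"
    using ctx is_context_cong p by metis
  obtain l' m' r' where ctx': "is_context F' l' m' r'"
    using is_context_exists fn(8) by metis
  have ctxG': "is_context G' l' m' r'"
    using ctx' is_context_cong p' by metis
  note d = is_contextD [OF ctx, unfolded dom] and d' = is_contextD [OF ctx', unfolded dom]
  note cw = is_context_Cmp [OF fn(2) ctx, unfolded dom] and cw' = is_context_Cmp [OF fn(8) ctx', unfolded dom]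
  define s where "s = whiskered F l m r"
  define t where "t = whiskered G l m r"
  define s' where "s' = whiskered F' l' m' r'"
  define t' where "t' = whiskered G' l' m' r'"
  have s: "s \<in> Arr E" "Dom E s = Dom E l" "Cod E s = ob1 B" and t: "t \<in> Arr E" "Dom E t = Dom E l" "Cod E t = ob1 B"
    and s': "s' \<in> Arr E" "Dom E s' = Dom E l'" "Cod E s' = ob1 B'"
    and t': "t' \<in> Arr E" "Dom E t' = Dom E l'" "Cod E t' = ob1 B'"
    using whiskered_simps [OF fn(2) ctx] whiskered_simps [OF fn(3) ctxG]
      whiskered_simps [OF fn(8) ctx'] whiskered_simps [OF fn(9) ctxG'] dom
    by (simp_all add: s_def t_def s'_def t'_def)
  have sw: "s \<cdot> w = mul B (l \<cdot> w) (mul B (F1 F \<cdot> m \<cdot> w) (r \<cdot> w))"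
    "t \<cdot> w = mul B (l \<cdot> w) (mul B (F1 G \<cdot> m \<cdot> w) (r \<cdot> w))" if "w \<in> Arr E" "Cod E w = Dom E l" for w
    using whiskered_Cmp [OF fn(2) ctx that] whiskered_Cmp [OF fn(3) ctxG that] dom by (simp_all add: s_def t_def)
  have s'_eq: "s' = mul B' l' (mul B' (F1 F' \<cdot> m') r')" "t' = mul B' l' (mul B' (F1 G' \<cdot> m') r')"
    using dom by (simp_all add: s'_def t'_def whiskered_def)
  have G'0: "F0 G' = F0 F'"
    by (fact p'(5))
  \<comment> \<open>The image in \<open>X\<close> of a triple of the pulled-back pair. It is the
    same for \<open>F'\<close> and \<open>G'\<close>, since both lie over \<open>a'\<close>.\<close>
  define u where "u = F1 b' \<cdot> s'"
  have b's': "u = mul X (F1 b' \<cdot> l') (mul X (F1 a' \<cdot> m') (F1 b' \<cdot> r'))"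
    and b't': "F1 b' \<cdot> t' = u"
    unfolding u_def s'_eq using d' ex fn dom ic G'0 by simp_all
  have ux: "u \<cdot> w = mul X (F1 b' \<cdot> l' \<cdot> w) (mul X (F1 a' \<cdot> m' \<cdot> w) (F1 b' \<cdot> r' \<cdot> w))"
    "tgt X \<cdot> F1 b' \<cdot> l' \<cdot> w = src X \<cdot> F1 a' \<cdot> m' \<cdot> w" "tgt X \<cdot> F1 a' \<cdot> m' \<cdot> w = src X \<cdot> F1 b' \<cdot> r' \<cdot> w"
    if "w \<in> Arr E" "Cod E w = Dom E l'" for w
    unfolding b's' using d' cw' [OF that] ex0 that fn dom ic by simp_all
  have u: "u \<in> Arr E" "Dom E u = Dom E l'" "Cod E u = ob1 X"
    unfolding u_def using s' fn dom by simp_all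
  \<comment> \<open>Projection of contexts: the three legs are sent back to the original categories
    by \<open>\<rho>\<close>, \<open>\<pi>\<close> and \<open>\<rho>\<close>.\<close>
  obtain w where w: "w \<in> Arr E" "Dom E w = Dom E l'" "Cod E w = Dom E l"
    "l \<cdot> w = F1 \<rho> \<cdot> l'" "m \<cdot> w = F1 \<pi> \<cdot> m'" "r \<cdot> w = F1 \<rho> \<cdot> r'"
    by (rule is_context_obtain [OF ctx, of "F1 \<rho> \<cdot> l'" "F1 \<pi> \<cdot> m'" "F1 \<rho> \<cdot> r'"])
      (use d' ex0 fn dom ic in simp_all)
  have bs: "(F1 b \<cdot> s) \<cdot> v = mul Y (F1 b \<cdot> l \<cdot> v) (mul Y (F1 a \<cdot> m \<cdot> v) (F1 b \<cdot> r \<cdot> v))"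
    "tgt Y \<cdot> F1 b \<cdot> l \<cdot> v = src Y \<cdot> F1 a \<cdot> m \<cdot> v" "tgt Y \<cdot> F1 a \<cdot> m \<cdot> v = src Y \<cdot> F1 b \<cdot> r \<cdot> v"
    if "v \<in> Arr E" "Cod E v = Dom E l" for v
    using sw [OF that] cw [OF that] ebFx ebF0x d(1-8) s that fn dom ic by simp_all
  have lw: "l \<cdot> w \<cdot> y = F1 \<rho> \<cdot> l' \<cdot> y" "m \<cdot> w \<cdot> y = F1 \<pi> \<cdot> m' \<cdot> y" "r \<cdot> w \<cdot> y = F1 \<rho> \<cdot> r' \<cdot> y"
    if "y \<in> Arr E" "Cod E y = Dom E l'" for y
    using Cmp_reassoc [OF w(4), of y] Cmp_reassoc [OF w(5), of y] Cmp_reassoc [OF w(6), of y] that w(1-3) d(1-8) d'(1-8)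
      fn dom by simp_all
  have "is_pullback E (F1 f) (F1 b \<cdot> s) u w"
  proof (rule is_pullbackI)
    have "F1 f \<cdot> u = mul Y (F1 b \<cdot> F1 \<rho> \<cdot> l') (mul Y (F1 a \<cdot> F1 \<pi> \<cdot> m') (F1 b \<cdot> F1 \<rho> \<cdot> r'))"
      unfolding b's' using ex0 ex eb d' fn dom ic by simp
    then show "F1 f \<cdot> u = (F1 b \<cdot> s) \<cdot> w"
      using bs(1) [OF w(1,3)] w(4-6) by simp
  next
    fix x v
    assume "x \<in> Arr E" "v \<in> Arr E" "Dom E x = Dom E v" "Cod E x = Dom E (F1 f)" "Cod E v = Dom E (F1 b \<cdot> s)"
      "F1 f \<cdot> x = (F1 b \<cdot> s) \<cdot> v"
    then have xv: "x \<in> Arr E" "v \<in> Arr E" "Dom E x = Dom E v" "Cod E x = ob1 X" "Cod E v = Dom E l"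
      and fx: "F1 f \<cdot> x = mul Y (F1 b \<cdot> l \<cdot> v) (mul Y (F1 a \<cdot> m \<cdot> v) (F1 b \<cdot> r \<cdot> v))"
      using bs(1) s fn dom by simp_all
    note bv = bs(2,3) [OF xv(2,5)]
    \<comment> \<open>The image of \<open>x\<close> is a threefold composite: its first factor is
      split off here, and the remainder \<open>x'\<close> is split once more below.\<close>
    obtain x1 x' where x1: "x1 \<in> Arr E" "x' \<in> Arr E" "Dom E x1 = Dom E x" "Dom E x' = Dom E x" "Cod E x1 = ob1 X"
      "Cod E x' = ob1 X" "tgt X \<cdot> x1 = src X \<cdot> x'" "mul X x1 x' = x" "F1 f \<cdot> x1 = F1 b \<cdot> l \<cdot> v"
      "F1 f \<cdot> x' = mul Y (F1 a \<cdot> m \<cdot> v) (F1 b \<cdot> r \<cdot> v)"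
      by (rule Conduche_factor [OF f xv(1,4) _ _ _ _ _ fx]) (use bv xv d(1-8) fn dom ic in simp_all)
    obtain x2 x3 where x2: "x2 \<in> Arr E" "x3 \<in> Arr E" "Dom E x2 = Dom E x'" "Dom E x3 = Dom E x'" "Cod E x2 = ob1 X"
      "Cod E x3 = ob1 X" "tgt X \<cdot> x2 = src X \<cdot> x3" "mul X x2 x3 = x'" "F1 f \<cdot> x2 = F1 a \<cdot> m \<cdot> v"
      "F1 f \<cdot> x3 = F1 b \<cdot> r \<cdot> v"
      by (rule Conduche_factor [OF f x1(2,6) _ _ _ _ _ x1(10)]) (use bv xv d(1-8) fn dom ic in simp_all)
    have x12: "tgt X \<cdot> x1 = src X \<cdot> x2"
      using x1(7) mul_simps(4) [OF ic(1) x2(1,2,5-7)] x2(8) by simp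
    \<comment> \<open>Each lifted factor in \<open>X\<close> is paired with the matching leg in
      \<open>A\<close> or \<open>B\<close>, giving arrows of the pulled-back categories.\<close>
    define l1 where "l1 = pairing E (F1 b') (F1 \<rho>) x1 (l \<cdot> v)"
    define m1 where "m1 = pairing E (F1 a') (F1 \<pi>) x2 (m \<cdot> v)"
    define r1 where "r1 = pairing E (F1 b') (F1 \<rho>) x3 (r \<cdot> v)"
    have l1: "l1 \<in> Arr E" "Cod E l1 = ob1 B'" "F1 b' \<cdot> l1 = x1" "F1 \<rho> \<cdot> l1 = l \<cdot> v"
      unfolding l1_def using pairing_props [OF pb(2), of x1 "l \<cdot> v"] x1 xv d(1-8) fn dom by simp_all
    have m1: "m1 \<in> Arr E" "Dom E m1 = Dom E x" "Cod E m1 = ob1 A'" "F1 a' \<cdot> m1 = x2" "F1 \<pi> \<cdot> m1 = m \<cdot> v"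
      unfolding m1_def using pairing_props [OF pa(2), of x2 "m \<cdot> v"] x1 x2 xv d(1-8) fn dom by simp_all
    have r1: "r1 \<in> Arr E" "Cod E r1 = ob1 B'" "F1 b' \<cdot> r1 = x3" "F1 \<rho> \<cdot> r1 = r \<cdot> v"
      unfolding r1_def using pairing_props [OF pb(2), of x3 "r \<cdot> v"] x2 xv d(1-8) fn dom by simp_all
    \<comment> \<open>Composability is an equation between generalised objects of \<open>B'\<close>,
      verified on both projections: in \<open>X\<close> by the choice of the factors, in
      \<open>B\<close> because \<open>v\<close> maps into the object of contexts.\<close>
    have "F0 b' \<cdot> tgt B' \<cdot> l1 = F0 a' \<cdot> src A' \<cdot> m1" "F0 a' \<cdot> tgt A' \<cdot> m1 = F0 b' \<cdot> src B' \<cdot> r1"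
      using arg_cong [OF l1(3), of "\<lambda>z. tgt X \<cdot> z"] arg_cong [OF m1(4), of "\<lambda>z. src X \<cdot> z"]
        arg_cong [OF m1(4), of "\<lambda>z. tgt X \<cdot> z"] arg_cong [OF r1(3), of "\<lambda>z. src X \<cdot> z"]
        l1(1,2) m1(1,3) r1(1,2) x12 x2(7) fn dom by simp_all
    moreover have "F0 \<rho> \<cdot> tgt B' \<cdot> l1 = F0 F \<cdot> F0 \<pi> \<cdot> src A' \<cdot> m1" "F0 \<rho> \<cdot> src B' \<cdot> r1 = F0 F \<cdot> F0 \<pi> \<cdot> tgt A' \<cdot> m1"
      using arg_cong [OF l1(4), of "\<lambda>z. tgt B \<cdot> z"] arg_cong [OF m1(5), of "\<lambda>z. src A \<cdot> z"]
        arg_cong [OF m1(5), of "\<lambda>z. tgt A \<cdot> z"] arg_cong [OF r1(4), of "\<lambda>z. src B \<cdot> z"]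
        l1(1,2) m1(1,3) r1(1,2) cw [OF xv(2,5)] fn dom by simp_all
    ultimately have lmr: "tgt B' \<cdot> l1 = F0 F' \<cdot> src A' \<cdot> m1" "src B' \<cdot> r1 = F0 F' \<cdot> tgt A' \<cdot> m1"
      using pullback_eqI [OF pb(1), of "tgt B' \<cdot> l1" "F0 F' \<cdot> src A' \<cdot> m1"]
        pullback_eqI [OF pb(1), of "src B' \<cdot> r1" "F0 F' \<cdot> tgt A' \<cdot> m1"] ex0 l1(1,2) m1(1,3) r1(1,2) fn dom ic
      by simp_all
    obtain y where y: "y \<in> Arr E" "Cod E y = Dom E l'" "l' \<cdot> y = l1" "m' \<cdot> y = m1" "r' \<cdot> y = r1"
      using is_context_obtain [OF ctx', unfolded dom, OF l1(1) m1(1) r1(1) l1(2) m1(3) r1(2) lmr] by metis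
    have "Dom E (m' \<cdot> y) = Dom E y"
      using y(1,2) d' by simp
    moreover have "u \<cdot> y = x"
      using ux [OF y(1,2)] y(3-5) l1 m1 r1 x1 x2 by simp
    moreover have "w \<cdot> y = v"
      by (rule is_context_eqI [OF fn(2) ctx]) (use y w(1-3) lw xv l1 m1 r1 in simp_all)
    ultimately show "\<exists>y \<in> Arr E. Dom E y = Dom E x \<and> Cod E y = Dom E u \<and> u \<cdot> y = x \<and> w \<cdot> y = v"
      using y m1(2) u by (intro bexI [of _ y]) simp_all
  next
    fix y z
    assume "y \<in> Arr E" "z \<in> Arr E" "Dom E y = Dom E z" "Cod E y = Dom E u" "Cod E z = Dom E u"
      and eq: "u \<cdot> y = u \<cdot> z" "w \<cdot> y = w \<cdot> z"
    then have yz: "y \<in> Arr E" "z \<in> Arr E" "Cod E y = Dom E l'" "Cod E z = Dom E l'"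
      using u by simp_all
    note uy = ux [OF yz(1,3)] and uz = ux [OF yz(2,4)]
    have rho: "F1 \<rho> \<cdot> l' \<cdot> y = F1 \<rho> \<cdot> l' \<cdot> z" "F1 \<pi> \<cdot> m' \<cdot> y = F1 \<pi> \<cdot> m' \<cdot> z" "F1 \<rho> \<cdot> r' \<cdot> y = F1 \<rho> \<cdot> r' \<cdot> z"
      using lw [OF yz(1,3)] lw [OF yz(2,4)] eq(2) by simp_all
    then have fe: "F1 f \<cdot> F1 b' \<cdot> l' \<cdot> y = F1 f \<cdot> F1 b' \<cdot> l' \<cdot> z" "F1 f \<cdot> F1 a' \<cdot> m' \<cdot> y = F1 f \<cdot> F1 a' \<cdot> m' \<cdot> z"
      "F1 f \<cdot> F1 b' \<cdot> r' \<cdot> y = F1 f \<cdot> F1 b' \<cdot> r' \<cdot> z"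
      using eb ex(5) yz d'(1-8) by simp_all
    have ty: "F1 b' \<cdot> l' \<cdot> x \<in> Arr E" "F1 a' \<cdot> m' \<cdot> x \<in> Arr E" "F1 b' \<cdot> r' \<cdot> x \<in> Arr E"
      "Cod E (F1 b' \<cdot> l' \<cdot> x) = ob1 X" "Cod E (F1 a' \<cdot> m' \<cdot> x) = ob1 X" "Cod E (F1 b' \<cdot> r' \<cdot> x) = ob1 X"
      if "x \<in> Arr E" "Cod E x = Dom E l'" for x
      using that d'(1-8) fn dom by simp_all
    note ty = ty [OF yz(1,3)] ty [OF yz(2,4)]
    \<comment> \<open>Uniqueness also runs twice: the tails \<open>y'\<close>, \<open>z'\<close>
      have equal images under \<open>f\<close>, so the first factors and the tails agree, and then
      the tails are split in turn.\<close>
    define y' where "y' = mul X (F1 a' \<cdot> m' \<cdot> y) (F1 b' \<cdot> r' \<cdot> y)"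
    define z' where "z' = mul X (F1 a' \<cdot> m' \<cdot> z) (F1 b' \<cdot> r' \<cdot> z)"
    have y': "y' \<in> Arr E" "Cod E y' = ob1 X" "tgt X \<cdot> F1 b' \<cdot> l' \<cdot> y = src X \<cdot> y'"
      unfolding y'_def using mul_simps [OF ic(1) ty(2,3,5,6) uy(3)] uy(2) by simp_all
    have z': "z' \<in> Arr E" "Cod E z' = ob1 X" "tgt X \<cdot> F1 b' \<cdot> l' \<cdot> z = src X \<cdot> z'"
      unfolding z'_def using mul_simps [OF ic(1) ty(8,9,11,12) uz(3)] uz(2) by simp_all
    have "F1 f \<cdot> y' = F1 f \<cdot> z'"
      unfolding y'_def z'_def
      using ifun_mul [OF fn(1) dom(1) ty(2,3,5,6) uy(3)] ifun_mul [OF fn(1) dom(1) ty(8,9,11,12) uz(3)] fe by simp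
    moreover have "mul X (F1 b' \<cdot> l' \<cdot> y) y' = mul X (F1 b' \<cdot> l' \<cdot> z) z'"
      unfolding y'_def z'_def uy(1) [symmetric] uz(1) [symmetric] by (fact eq)
    ultimately have bl: "F1 b' \<cdot> l' \<cdot> y = F1 b' \<cdot> l' \<cdot> z" and "y' = z'"
      using Conduche_unique [OF f(1,2) ty(1) y'(1) ty(4) y'(2,3) ty(7) z'(1) ty(10) z'(2,3)] fe(1) by blast+
    then have am: "F1 a' \<cdot> m' \<cdot> y = F1 a' \<cdot> m' \<cdot> z" "F1 b' \<cdot> r' \<cdot> y = F1 b' \<cdot> r' \<cdot> z"
      unfolding y'_def z'_def
      using Conduche_unique [OF f(1,2) ty(2,3,5,6) uy(3) ty(8,9,11,12) uz(3)] fe(2,3) by blast+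
    \<comment> \<open>The legs agree in \<open>X\<close> by uniqueness of the factors and in
      \<open>A\<close> or \<open>B\<close> because \<open>w\<close> does not separate
      \<open>y\<close> and \<open>z\<close>; the two projections are jointly monic.\<close>
    have "l' \<cdot> y = l' \<cdot> z" "r' \<cdot> y = r' \<cdot> z"
      by (rule pullback_eqI [OF pb(2)]; use bl am rho yz d'(1-8) fn dom in simp)+
    moreover have "m' \<cdot> y = m' \<cdot> z"
      by (rule pullback_eqI [OF pa(2)]) (use am rho yz d'(1-8) fn dom in simp_all)
    ultimately show "y = z"
      using is_context_eqI [OF fn(8) ctx'] yz by simp
  qed (use u w s fn dom in simp_all)
  then have pu: "is_pullback E (F1 f) (F1 c \<cdot> F1 Q \<cdot> s) u w"
    using bx [OF s(1,3)] by simp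
  \<comment> \<open>Base change along \<open>F1 f\<close>, with \<open>F1 c\<close> as the structure
    arrow of the quotient; \<open>pu\<close> identifies the pullback of the relation with the
    contexts of \<open>F'\<close>.\<close>
  have "is_coequaliser E s' t' (F1 Q')"
  proof (rule coequaliser_stable [OF q [folded s_def t_def] _ _ pu])
    show "is_pullback E (F1 f) (F1 c \<cdot> F1 Q) (F1 b') (F1 \<rho>)"
      using pb(2) e by simp
    show "is_pullback E (F1 f) (F1 c) (F1 c') (F1 \<sigma>)"
      by (fact pc)
    show "F1 \<rho> \<cdot> s' = s \<cdot> w" "F1 \<rho> \<cdot> t' = t \<cdot> w"
      unfolding s'_eq sw [OF w(1,3)] w(4-6) using d' ex fn dom ic G'0 by simp_all
  qed (use s' t' u_def b't' e r fn dom in simp_all)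
  then show ?thesis
    unfolding is_whiskered_coequaliser_def s'_def t'_def using ctx' by blast
qed

end

theorem proposition3p7:
  fixes E :: "('o, 'm) cat"
    and X Y A B C :: "('o, 'm) icat"
    and f F G Q a b c :: "('o, 'm) ifun"
    and a' \<pi> b' \<rho> c' \<sigma> F' G' Q' :: "('o, 'm) ifun"
  assumes "category E"
    and "has_pullbacks E"
    and "has_pullback_stable_coequalisers E"
    and "f \<in> hom (Cat E) X Y"
    and "discrete_Conduche_fibration E f"
    and "a \<in> hom (Cat E) A Y" and "b \<in> hom (Cat E) B Y" and "c \<in> hom (Cat E) C Y"
    and "(a, F, b) \<in> Arr (slice (Cat E) Y)"
    and "(a, G, b) \<in> Arr (slice (Cat E) Y)"
    and "(b, Q, c) \<in> Arr (slice (Cat E) Y)"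
    and "F0 F = F0 G"
    and "is_Cat_coequaliser E F G Q"
    and "is_pullback (Cat E) f a a' \<pi>"
    and "is_pullback (Cat E) f b b' \<rho>"
    and "is_pullback (Cat E) f c c' \<sigma>"
    and "is_pullback_arrow (Cat E) a' \<pi> b' \<rho> F F'"
    and "is_pullback_arrow (Cat E) a' \<pi> b' \<rho> G G'"
    and "is_pullback_arrow (Cat E) b' \<rho> c' \<sigma> Q Q'"
  shows "is_Cat_coequaliser E F' G' Q'"
proof -
  interpret stable_category E
    using assms(1-3) by (intro stable_category.intro stable_category_axioms.intro)
  interpret Cat: category "Cat E"
    by (rule category_Cat)
  have f: "internal_functor E f" "idom f = X" "icod f = Y"
    using assms(4) by (auto simp: hom_def)
  have F: "internal_functor E F" "idom F = idom a" "icod F = idom b" "b \<cdot>\<^bsub>Cat E\<^esub> F = a"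
    and G: "internal_functor E G" "idom G = idom a" "icod G = idom b"
    and Q: "internal_functor E Q" "idom Q = idom b" "icod Q = idom c" "c \<cdot>\<^bsub>Cat E\<^esub> Q = b"
    using assms(9-11) by (simp_all add: slice_def hom_def)
  have abc: "internal_functor E a" "internal_functor E b" "internal_functor E c" "icod a = Y" "icod b = Y" "icod c = Y"
    using assms(6-8) by (simp_all add: hom_def)
  have FG: "parallel F G"
    using F G assms(12) by (simp add: parallel_def)
  have Qcoeq: "is_coequaliser (Cat E) F G Q"
    using assms(13) by (simp add: is_Cat_coequaliser_def)
  \<comment> \<open>The given coequaliser is replaced by its description on objects and on arrows,
    which is the form that can be transported along \<open>f\<close>.\<close>
  obtain Q0' where Q0': "inverse_arrows (F0 Q) Q0'" and Q1: "is_whiskered_coequaliser F G (F1 Q)"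
    using Cat_coequaliser_components [OF FG Qcoeq] by metis
  note db = Cat.is_pullbackD [OF assms(15)]
    and dc = Cat.is_pullbackD [OF assms(16)]
  have F': "internal_functor E F'" "idom F' = idom a'" "icod F' = idom b'" "b' \<cdot>\<^bsub>Cat E\<^esub> F' = a'"
      "\<rho> \<cdot>\<^bsub>Cat E\<^esub> F' = F \<cdot>\<^bsub>Cat E\<^esub> \<pi>"
    and G': "internal_functor E G'" "idom G' = idom a'" "icod G' = idom b'" "b' \<cdot>\<^bsub>Cat E\<^esub> G' = a'"
      "\<rho> \<cdot>\<^bsub>Cat E\<^esub> G' = G \<cdot>\<^bsub>Cat E\<^esub> \<pi>"
    and Q': "internal_functor E Q'" "idom Q' = idom b'" "icod Q' = idom c'" "c' \<cdot>\<^bsub>Cat E\<^esub> Q' = b'"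
      "\<sigma> \<cdot>\<^bsub>Cat E\<^esub> Q' = Q \<cdot>\<^bsub>Cat E\<^esub> \<rho>"
    using assms(17-19) by (simp_all add: is_pullback_arrow_def hom_def)
  \<comment> \<open>The pulled-back functors again agree on objects: their object parts have equal
    composites with \<open>F0 b'\<close> and \<open>F0 \<rho>\<close>, which are jointly
    monic.\<close>
  have "F0 b' \<cdot>\<^bsub>E\<^esub> F0 G' = F0 b' \<cdot>\<^bsub>E\<^esub> F0 F'" "F0 \<rho> \<cdot>\<^bsub>E\<^esub> F0 G' = F0 \<rho> \<cdot>\<^bsub>E\<^esub> F0 F'"
    using Cat_Cmp_eqD(1) [OF F'(5)] Cat_Cmp_eqD(1) [OF G'(5)] Cat_Cmp_eqD(1) [OF trans [OF F'(4) G'(4) [symmetric]]]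
      assms(12) by simp_all
  then have "F0 G' = F0 F'"
    using pullback_eqI [OF Cat_pullback_components(1) [OF assms(15)], of "F0 G'" "F0 F'"] F' G' db(4,5) by simp
  then have FG': "parallel F' G'"
    using F' G' by (simp add: parallel_def)
  have cQF: "c \<cdot>\<^bsub>Cat E\<^esub> Q \<cdot>\<^bsub>Cat E\<^esub> F = a"
    using Cat.Cmp_assoc' [of F Q c] F(1-3) Q(1-3) abc(3) by (simp add: Q(4) F(4))
  have Q1': "is_whiskered_coequaliser F' G' (F1 Q')"
    by (rule whiskered_coequaliser_pullback [OF assms(5) f(2,3) abc(3,6) Q(1,3) FG _ FG' Cat.is_coequaliserD(7) [OF Qcoeq]
          assms(14) _ assms(15) Q(4) assms(16) F'(3-5) G'(4,5) Q'(1,3-5) Q1])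
      (use F(3) Q(2) cQF in simp_all)
  note pb0 = Cat_pullback_components(1) [OF assms(15)] and pc0 = Cat_pullback_components(1) [OF assms(16)]
  have e0: "F0 c \<cdot>\<^bsub>E\<^esub> F0 Q = F0 b" "F0 c' \<cdot>\<^bsub>E\<^esub> F0 Q' = F0 b'" "F0 \<sigma> \<cdot>\<^bsub>E\<^esub> F0 Q' = F0 Q \<cdot>\<^bsub>E\<^esub> F0 \<rho>"
    "F0 f \<cdot>\<^bsub>E\<^esub> F0 c' = F0 c \<cdot>\<^bsub>E\<^esub> F0 \<sigma>"
    using arg_cong [OF Q(4), of F0] arg_cong [OF Q'(4), of F0] Cat_Cmp_eqD(1) [OF Q'(5)] Cat_Cmp_eqD(1) [OF dc(9)]
    by simp_all
  note Q0d = inverse_arrowsD [OF Q0']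
  \<comment> \<open>The inverse of \<open>F0 Q'\<close> is the base change of \<open>Q0'\<close>:
    its component in \<open>X\<close> is \<open>F0 c'\<close>, and its component in \<open>B\<close>
    is \<open>F0 \<sigma>\<close> followed by \<open>Q0'\<close>.\<close>
  define P where "P = pairing E (F0 b') (F0 \<rho>) (F0 c') (Q0' \<cdot>\<^bsub>E\<^esub> F0 \<sigma>)"
  have "F0 b \<cdot>\<^bsub>E\<^esub> Q0' \<cdot>\<^bsub>E\<^esub> F0 \<sigma> = F0 c \<cdot>\<^bsub>E\<^esub> F0 \<sigma>"
    using Cmp_reassoc [OF e0(1), of "Q0' \<cdot>\<^bsub>E\<^esub> F0 \<sigma>"] inverse_arrows_cancel(2) [OF Q0', of "F0 \<sigma>"] Q0d(1-4) Q abc dc(1-8)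
    by simp
  then have P: "P \<in> Arr E" "Dom E P = ob0 (idom c')" "Cod E P = ob0 (idom b')" "F0 b' \<cdot>\<^bsub>E\<^esub> P = F0 c'"
    "F0 \<rho> \<cdot>\<^bsub>E\<^esub> P = Q0' \<cdot>\<^bsub>E\<^esub> F0 \<sigma>"
    unfolding P_def using pairing_props [OF pb0, of "F0 c'" "Q0' \<cdot>\<^bsub>E\<^esub> F0 \<sigma>"] e0(4) Q0d(1-4) Q abc db(1-8) dc(1-8)
    by simp_all
  have x: "F0 b' \<cdot>\<^bsub>E\<^esub> P \<cdot>\<^bsub>E\<^esub> F0 Q' = F0 b'" "F0 \<rho> \<cdot>\<^bsub>E\<^esub> P \<cdot>\<^bsub>E\<^esub> F0 Q' = F0 \<rho>"
    "F0 c' \<cdot>\<^bsub>E\<^esub> F0 Q' \<cdot>\<^bsub>E\<^esub> P = F0 c'" "F0 \<sigma> \<cdot>\<^bsub>E\<^esub> F0 Q' \<cdot>\<^bsub>E\<^esub> P = F0 \<sigma>"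
    using Cmp_reassoc [OF P(4), of "F0 Q'"] Cmp_reassoc [OF P(5), of "F0 Q'"] Cmp_reassoc [OF e0(2), of P]
      Cmp_reassoc [OF e0(3), of P] inverse_arrows_cancel [OF Q0'] e0(2,3) P Q0d(1-4) Q Q' db(1-8) dc(1-8)
    by simp_all
  have "P \<cdot>\<^bsub>E\<^esub> F0 Q' = Idn E (ob0 (idom b'))"
    by (rule pullback_eqI [OF pb0]) (use x P Q' db(1-8) in simp_all)
  moreover have "F0 Q' \<cdot>\<^bsub>E\<^esub> P = Idn E (ob0 (idom c'))"
    by (rule pullback_eqI [OF pc0]) (use x P Q' dc(1-8) in simp_all)
  ultimately have "inverse_arrows (F0 Q') P"
    using P Q' by (simp add: inverse_arrows_def)
  then show ?thesis
    using Cat_coequaliserI [OF FG' Q'(1) _ _ Q1'] Q'(2) F'(3) by simp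
qed

end
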